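(* Let $K$ be a field of characteristic zero. Let $2\leq d_1<d_2=d_3=:d$ be integers. Let $f_1,f_2,f_3\in S=K[x_1,x_2,x_3]$ be a regular sequence of homogeneous polynomials of degrees $d_1,d_2,d_3$, let $I=(f_1,f_2,f_3)$ and let $J=\operatorname{Gin}(I)$ be the generic initial ideal with respect to the reverse lexicographic order. Suppose $S/I$ has the strong Lefschetz property. If $d_1$ is even, then $J$ is the ideal generated by - $x_1^{d_1}$; $x_1^{d_1-2j+1}x_2^{d-d_1-2+3j}$ and $x_1^{d_1-2j}x_2^{d-d_1-1+3j}$ for $1\leq j\leq\frac{d_1-2}{2}$; $x_1x_2^{\frac{d_1+2d-4}{2}}$; $x_2^{\frac{d_1+2d-2}{2}}$; - $x_3^{2j}x_1^{2j-1}x_2^{\frac{d_1+2d}{2}-3j},\ldots,x_3^{2j}x_2^{\frac{d_1+2d-2}{2}-j}$ for $1\leq j\leq\frac{d_1-2}{2}$; - $x_3^{d_1-2+2j}x_2^{d-d_1-j+1}\{x_1,x_2\}^{d_1-1}$ for $1\leq j\leq d-d_1$; - $x_3^{2d-d_1-2+2j}\{x_1,x_2\}^{d_1-j}$ for $1\leq j\leq d_1$. If $d_1$ is odd, then $J$ is the ideal generated by - $x_1^{d_1}$; $x_1^{d_1-2j+1}x_2^{d-d_1-2+3j}$ and $x_1^{d_1-2j}x_2^{d-d_1-1+3j}$ for $1\leq j\leq\frac{d_1-1}{2}$; - $x_2^{\frac{d_1+2d-1}{2}}$; $x_3x_2^{\frac{d_1+2d-3}{2}}$; $x_3^{2j+1}x_1^{2j}x_2^{\frac{d_1+2d-3}{2}-3j},\ldots,x_3^{2j+1}x_2^{\frac{d_1+2d-3}{2}-j}$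 for $1\leq j\leq\frac{d_1-3}{2}$; - $x_3^{d_1-2+2j}x_2^{d-d_1-j+1}\{x_1,x_2\}^{d_1-1}$ for $1\leq j\leq d-d_1$; - $x_3^{2d-d_1-2+2j}\{x_1,x_2\}^{d_1-j}$ for $1\leq j\leq d_1$.
   Context: $\{x_1,x_2\}^j$ denotes the set of all monomials of degree $j$ in $x_1,x_2$ (with $\{x_1,x_2\}^0=\{1\}$), and $m\{x_1,x_2\}^j$ is the set of products of the monomial $m$ with elements of it. A list $x_3^{c}x_1^{a}x_2^{b},\ldots,x_3^{c}x_2^{a+b}$ means all monomials $x_3^{c}x_1^{a-i}x_2^{b+i}$ with $0\leq i\leq a$. $S/I$ has the strong Lefschetz property (SLP) if there is a linear form $\ell\in S$ such that for all integers $b\geq 1$ and $t\geq 0$ the multiplication map $\ell^b:(S/I)_t\to(S/I)_{t+b}$ is injective or surjective. $\operatorname{Gin}(I)$ is the common initial ideal, with respect to the graded reverse lexicographic order with $x_1>x_2>x_3$, of $\alpha I$ for all $\alpha$ in a nonempty Zariski open subset of $GL_3(K)$ acting by linear changes of coordinates. *)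

theory Defs
  imports
    "HOL-Analysis.Determinants"
    "HOL-Library.Poly_Mapping"
    "HOL-Library.Set_Algebras"
begin

section \<open>Polynomials and ideals\<close>

text \<open>
  A polynomial is a finitely supported function from exponent vectors to coefficients;
  multiplication is the convolution product of \<^theory>\<open>HOL-Library.Poly_Mapping\<close>.
  The three variables of \<open>S\<close> are indexed by the three-element type \<open>3\<close>, whose elements are
  \<open>1, 2, 3\<close>. Arithmetic there is modulo 3 (so \<open>3 = 0\<close>), and the built-in order of that type
  is not used.
\<close>

type_synonym ('v, 'a) mpoly = "('v \<Rightarrow>\<^sub>0 nat) \<Rightarrow>\<^sub>0 'a"

type_synonym 'a poly3 = "(3, 'a) mpoly"

definition X :: "'v \<Rightarrow> ('v, 'a::comm_ring_1) mpoly" where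
  "X i = Poly_Mapping.single (Poly_Mapping.single i 1) 1"

definition const_poly :: "'a \<Rightarrow> ('v, 'a::comm_ring_1) mpoly" where
  "const_poly c = Poly_Mapping.single 0 c"

definition eval_poly ::
  "('a \<Rightarrow> 'b) \<Rightarrow> ('v \<Rightarrow> 'b) \<Rightarrow> ('v, 'a::comm_ring_1) mpoly \<Rightarrow> 'b::comm_ring_1" where
  "eval_poly h g p =
     (\<Sum>m\<in>Poly_Mapping.keys p. h (Poly_Mapping.lookup p m) * (\<Prod>v\<in>Poly_Mapping.keys m. g v ^ Poly_Mapping.lookup m v))"

definition mon_degree :: "('v::finite \<Rightarrow>\<^sub>0 nat) \<Rightarrow> nat" where
  "mon_degree m = (\<Sum>v\<in>UNIV. Poly_Mapping.lookup m v)"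

definition homogeneous :: "nat \<Rightarrow> ('v::finite, 'a::comm_ring_1) mpoly \<Rightarrow> bool" where
  "homogeneous t p \<longleftrightarrow> (\<forall>m\<in>Poly_Mapping.keys p. mon_degree m = t)"

lemma module_times: "module ((*) :: 'a::comm_ring_1 \<Rightarrow> 'a \<Rightarrow> 'a)"
  by unfold_locales (auto simp: algebra_simps)

text \<open>An ideal of a commutative ring is a submodule of the ring over itself.\<close>

definition ideal_gen :: "'a::comm_ring_1 set \<Rightarrow> 'a set" where
  "ideal_gen = module.span (*)"

definition regular_sequence :: "'a::comm_ring_1 list \<Rightarrow> bool" where
  "regular_sequence fs \<longleftrightarrow>
     (\<forall>i<length fs. \<forall>g. fs ! i * g \<in> ideal_gen (set (take i fs)) \<longrightarrow>
                         g \<in> ideal_gen (set (take i fs))) \<and>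
     ideal_gen (set fs) \<noteq> UNIV"


section \<open>The strong Lefschetz property\<close>

text \<open>
  Elements of \<open>S/I\<close> are the cosets \<open>f +o I\<close>. The product of such a coset \<open>C\<close> with the class
  of \<open>p\<close> is \<open>p *o C + I\<close>, i.e. \<open>p *o (f +o I) + I = (p * f) +o I\<close> for an ideal \<open>I\<close>.
\<close>

definition quot_graded :: "('v::finite, 'a::comm_ring_1) mpoly set \<Rightarrow> nat \<Rightarrow>
    ('v, 'a) mpoly set set" where
  "quot_graded I t = {f +o I | f. homogeneous t f}"

definition quot_mult :: "'a::comm_ring_1 set \<Rightarrow> 'a \<Rightarrow> 'a set \<Rightarrow> 'a set" where
  "quot_mult I p C = p *o C + I"

definition strong_lefschetz :: "('v::finite, 'a::field) mpoly set \<Rightarrow> bool" where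
  "strong_lefschetz I \<longleftrightarrow>
     (\<exists>l. homogeneous 1 l \<and>
        (\<forall>b\<ge>1. \<forall>t.
           inj_on (quot_mult I (l ^ b)) (quot_graded I t) \<or>
           quot_mult I (l ^ b) ` quot_graded I t = quot_graded I (t + b)))"


section \<open>Generic initial ideals\<close>

text \<open>
  Graded reverse lexicographic order with \<open>x\<^sub>1 > x\<^sub>2 > x\<^sub>3\<close>. If the degrees and the exponents
  of \<open>x\<^sub>2\<close> and \<open>x\<^sub>3\<close> agree, then the monomials are equal.
\<close>

definition grevlex_less :: "(3 \<Rightarrow>\<^sub>0 nat) \<Rightarrow> (3 \<Rightarrow>\<^sub>0 nat) \<Rightarrow> bool" where
  "grevlex_less m n \<longleftrightarrow>
     mon_degree m < mon_degree n \<or>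
     mon_degree m = mon_degree n \<and>
       (Poly_Mapping.lookup m 3 > Poly_Mapping.lookup n 3 \<or> Poly_Mapping.lookup m 3 = Poly_Mapping.lookup n 3 \<and> Poly_Mapping.lookup m 2 > Poly_Mapping.lookup n 2)"

definition leading_exponent :: "'a::comm_ring_1 poly3 \<Rightarrow> (3 \<Rightarrow>\<^sub>0 nat)" where
  "leading_exponent f =
     (THE m. m \<in> Poly_Mapping.keys f \<and> (\<forall>n\<in>Poly_Mapping.keys f. n \<noteq> m \<longrightarrow> grevlex_less n m))"

definition initial_ideal :: "'a::comm_ring_1 poly3 set \<Rightarrow> 'a poly3 set" where
  "initial_ideal I = ideal_gen {Poly_Mapping.single (leading_exponent f) 1 | f. f \<in> I \<and> f \<noteq> 0}"

definition linear_change :: "'a::field^3^3 \<Rightarrow> 'a poly3 \<Rightarrow> 'a poly3" where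
  "linear_change \<alpha> = eval_poly const_poly (\<lambda>j. \<Sum>i\<in>UNIV. const_poly (\<alpha> $ i $ j) * X i)"

text \<open>
  Open subsets of \<open>GL\<^sub>3(K)\<close> in the topology induced from the affine space of 3-by-3 matrices;
  \<open>P\<close> is a set of polynomials in the nine matrix entries.
\<close>

definition zariski_open_GL3 :: "('a::field^3^3) set \<Rightarrow> bool" where
  "zariski_open_GL3 U \<longleftrightarrow>
     (\<exists>P :: (3 \<times> 3, 'a) mpoly set.
        U = {\<alpha>. invertible \<alpha> \<and> (\<exists>p\<in>P. eval_poly id (\<lambda>(i, j). \<alpha> $ i $ j) p \<noteq> 0)})"

definition Gin :: "'a::field poly3 set \<Rightarrow> 'a poly3 set" where
  "Gin I =
     (THE J. \<exists>U. zariski_open_GL3 U \<and> U \<noteq> {} \<and>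
                 (\<forall>\<alpha>\<in>U. initial_ideal (linear_change \<alpha> ` I) = J))"


section \<open>Families of monomials\<close>

definition mon :: "nat \<Rightarrow> nat \<Rightarrow> nat \<Rightarrow> 'a::comm_ring_1 poly3" where
  "mon a b c = X 1 ^ a * X 2 ^ b * X 3 ^ c"

text \<open>\<open>{x\<^sub>1, x\<^sub>2}\<^sup>j\<close>; its translate by a monomial \<open>m\<close> is \<open>m *o mons12 j\<close>.\<close>

definition mons12 :: "nat \<Rightarrow> 'a::comm_ring_1 poly3 set" where
  "mons12 j = {mon a b 0 | a b. a + b = j}"

text \<open>The list \<open>x\<^sub>3\<^sup>c x\<^sub>1\<^sup>a x\<^sub>2\<^sup>b, \<dots>, x\<^sub>3\<^sup>c x\<^sub>2\<^bsup>a+b\<^esup>\<close>.\<close>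

definition mon_list :: "nat \<Rightarrow> nat \<Rightarrow> nat \<Rightarrow> 'a::comm_ring_1 poly3 set" where
  "mon_list a b c = {mon (a - i) (b + i) c | i. i \<le> a}"

end

theory Submission
  imports Defs "HOL-Computational_Algebra.Polynomial"
begin

text \<open>
  Write \<open>p = d\<^sub>1\<close>, \<open>A = S/I\<close> with Hilbert function \<open>H\<close>, and \<open>e = p + 2d - 3\<close>. The claim is that a
  monomial \<open>x\<^sub>1\<^sup>a x\<^sub>2\<^sup>b x\<^sub>3\<^sup>c\<close> lies in \<open>Gin(I)\<close> iff
  \<open>a \<ge> p\<close> or \<open>3a + 2b > e\<close> or \<open>2(a + b) + c > e\<close>; the two lists of generators in the theorem
  are then found by linear arithmetic on exponents (\<open>generators_even\<close>, \<open>generators_odd\<close>).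

  Regularity determines \<open>H\<close>: it is symmetric, \<open>H(t) = H(e - t)\<close>, and for \<open>2t \<le> e\<close> the difference
  \<open>H(t) - H(t - 1)\<close> is \<open>G(t) = min(t + 1, p, e + 1 - 2t)\<close>. In particular \<open>H\<close> is unimodal.

  Let \<open>\<ell>\<close> be a strong Lefschetz element. A dimension count gives two facts. If \<open>2t + c > e\<close>, then
  multiplication by \<open>\<ell>\<^bsup>c+1\<^esup>\<close> maps \<open>A\<^bsub>t-1\<^esub>\<close> onto \<open>A\<^bsub>t+c\<^esub>\<close>. If \<open>2t \<le> e\<close>, then
  \<open>A\<^bsub>t\<^esub>/\<ell> A\<^bsub>t-1\<^esub>\<close> has dimension at most \<open>h = G(t)\<close>. This last space is a quotient of the space of binary
  forms of degree \<open>t\<close> in two further linear forms \<open>x, y\<close>, and for all but finitely many \<open>s\<close> it is spanned by the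
  forms \<open>(y + s x)\<^bsup>t-a\<^esup> x\<^sup>a\<close> with \<open>a < h\<close> (\<open>osculating_span\<close>). By duality this says that an
  \<open>h\<close>-dimensional space of univariate polynomials over a field of characteristic zero contains no nonzero element
  vanishing to order \<open>h\<close> at a general point (\<open>wronskian\<close>).

  Choose coordinates in which \<open>\<ell>\<close> becomes \<open>x\<^sub>3\<close>, a general \<open>y + s x\<close> becomes \<open>x\<^sub>2\<close>, and
  \<open>x\<close> becomes \<open>x\<^sub>1\<close> (\<open>general_coordinates\<close>). The two facts then say that certain monomials are congruent,
  modulo the transformed ideal, to combinations of monomials that are smaller in the reverse lexicographic order, so
  that all monomials of the claimed set are leading monomials (\<open>leading_exponents\<close>). There are no others: the number of
  monomials of degree \<open>T\<close> outside the claimed set is at most \<open>H(T)\<close> (\<open>card_standard\<close>).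

  The facts used about the coordinate change \<open>\<alpha>\<close> state that finitely many families of polynomials, with coefficients
  polynomial in the entries of \<open>\<alpha>\<close>, span; such conditions are Zariski open (\<open>spanning_is_open\<close>). Hence the initial
  ideal is the claimed one on a nonempty open set, and since two such sets meet (\<open>zariski_open_inter\<close>), it is
  \<open>Gin(I)\<close>. No use is made of the fact that generic initial ideals are Borel-fixed.
\<close>

abbreviation lookup where "lookup \<equiv> Poly_Mapping.lookup"
abbreviation keys where "keys \<equiv> Poly_Mapping.keys"
abbreviation single where "single \<equiv> Poly_Mapping.single"

section \<open>Dimensions of subspaces\<close>

text \<open>
  Rank-nullity for the map from \<open>V\<close> to the quotient by \<open>W\<close> induced by \<open>\<phi>\<close>. The ambient
  space may be infinite-dimensional; only \<open>V\<close> and \<open>W\<close> are assumed to be finite-dimensional.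
\<close>

lemma (in vector_space) dim_sum_image:
  assumes \<phi>: "\<And>x y. \<phi> (x + y) = \<phi> x + \<phi> y" "\<And>c x. \<phi> (scale c x) = scale c (\<phi> x)"
    and W: "subspace W" "W \<subseteq> span FW" "finite FW"
    and V: "subspace V" "V \<subseteq> span FV" "finite FV"
  shows "dim {w + \<phi> v | w v. w \<in> W \<and> v \<in> V} + dim {v \<in> V. \<phi> v \<in> W} = dim W + dim V"
proof -
  have lin: "module_hom scale scale \<phi>"
    unfolding module_hom_iff using \<phi> module_axioms by auto
  interpret \<phi>: module_hom scale scale \<phi> by (fact lin)
  define Kr where "Kr = {v \<in> V. \<phi> v \<in> W}"
  have Kr: "subspace Kr"
    using subspace_inter[OF V(1) \<phi>.subspace_linear_preimage[OF W(1)]]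
    by (simp add: Kr_def Int_def)
  obtain C where C: "C \<subseteq> Kr" "independent C" "Kr \<subseteq> span C" "card C = dim Kr"
    using basis_exists by blast
  have "C \<subseteq> V" using C(1) by (auto simp: Kr_def)
  then obtain B where B: "C \<subseteq> B" "B \<subseteq> V" "independent B" "V \<subseteq> span B"
    using maximal_independent_subset_extend C(2) by metis
  obtain E where E: "E \<subseteq> W" "independent E" "W \<subseteq> span E" "card E = dim W"
    using basis_exists by blast
  have finE: "finite E"
    using independent_span_bound[OF W(3) E(2)] E(1) W(2) by blast
  have finB: "finite B"
    using independent_span_bound[OF V(3) B(3)] B(2) V(2) by blast
  have spE: "span E = W" using E W(1) by (metis span_subspace)
  have spB: "span B = V" using B V(1) by (metis span_subspace)
  \<comment> \<open>a basis of \<open>W\<close> together with the images of a complement of the kernel\<close>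
  have "independent (E \<union> \<phi> ` D') \<and> card (E \<union> \<phi> ` D') = card E + card D'"
    if "D' \<subseteq> B - C" for D'
    using finite_subset[OF that finite_Diff[OF finB]] that
  proof (induction D' rule: finite_induct)
    case empty
    then show ?case using E by simp
  next
    case (insert d D')
    have "\<phi> d \<notin> span (E \<union> \<phi> ` D')"
    proof
      assume "\<phi> d \<in> span (E \<union> \<phi> ` D')"
      then obtain x y where xy: "\<phi> d = x + y" "x \<in> span E" "y \<in> span (\<phi> ` D')"
        unfolding span_Un by blast
      then obtain u where u: "u \<in> span D'" "y = \<phi> u"
        using \<phi>.span_image by blast
      have "d \<in> V" using insert.prems B(2) by auto
      moreover have "u \<in> V" using u(1) insert.prems span_mono[of D' B] spB by blast
      ultimately have "d - u \<in> V" using V(1) subspace_diff by blast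
      moreover have "\<phi> (d - u) \<in> W" using xy u spE by (simp add: \<phi>.diff)
      ultimately have "d - u \<in> span C" using C(3) by (auto simp: Kr_def)
      then have "d - u \<in> span (C \<union> D')" "u \<in> span (C \<union> D')"
        using span_mono[of C "C \<union> D'"] span_mono[of D' "C \<union> D'"] u(1) by auto
      then have "d \<in> span (C \<union> D')" using span_add by fastforce
      moreover have "C \<union> D' \<subseteq> B - {d}" using insert B(1) by auto
      ultimately have "d \<in> span (B - {d})" using span_mono by blast
      then show False using B(3) insert.prems by (auto simp: dependent_def)
    qed
    then show ?case
      using insert finE independent_insert span_base[of "\<phi> d" "E \<union> \<phi> ` D'"] by auto
  qed
  from this[of "B - C"]
  have F: "independent (E \<union> \<phi> ` (B - C))" "card (E \<union> \<phi> ` (B - C)) = card E + card (B - C)"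
    by auto
  have "dim {w + \<phi> v | w v. w \<in> W \<and> v \<in> V} = card (E \<union> \<phi> ` (B - C))"
  proof (rule dim_eq_card[OF _ F(1)], rule antisym)
    have "e \<in> span {w + \<phi> v | w v. w \<in> W \<and> v \<in> V}" if "e \<in> E \<union> \<phi> ` (B - C)" for e
      using that
    proof
      assume "e \<in> E"
      then have "e = e + \<phi> 0 \<and> e \<in> W \<and> 0 \<in> V" using E V(1) subspace_0 by auto
      then show ?thesis by (blast intro: span_base)
    next
      assume "e \<in> \<phi> ` (B - C)"
      then obtain v where "e = 0 + \<phi> v \<and> 0 \<in> W \<and> v \<in> V"
        using B W(1) subspace_0 by auto
      then show ?thesis by (blast intro: span_base)
    qed
    then show "span (E \<union> \<phi> ` (B - C)) \<subseteq> span {w + \<phi> v | w v. w \<in> W \<and> v \<in> V}"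
      by (intro span_minimal) auto
    have "w + \<phi> v \<in> span (E \<union> \<phi> ` (B - C))" if "w \<in> W" "v \<in> V" for w v
    proof (rule span_add)
      show "w \<in> span (E \<union> \<phi> ` (B - C))" using that spE span_mono by blast
      have "v \<in> span (C \<union> (B - C))" using that spB B(1) by (simp add: Un_absorb1)
      then obtain c b where cb: "v = c + b" "c \<in> span C" "b \<in> span (B - C)"
        unfolding span_Un by blast
      have "c \<in> Kr" using cb(2) C(1) Kr span_minimal by blast
      then have "\<phi> c \<in> span E" using spE by (auto simp: Kr_def)
      moreover have "\<phi> b \<in> span (\<phi> ` (B - C))" using cb(3) \<phi>.span_image by blast
      ultimately show "\<phi> v \<in> span (E \<union> \<phi> ` (B - C))"
        using span_mono[of E "E \<union> \<phi> ` (B - C)"] span_mono[of "\<phi> ` (B - C)" "E \<union> \<phi> ` (B - C)"]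
        by (auto simp: cb(1) \<phi>(1) intro: span_add)
    qed
    then show "span {w + \<phi> v | w v. w \<in> W \<and> v \<in> V} \<subseteq> span (E \<union> \<phi> ` (B - C))"
      by (intro span_minimal) auto
  qed
  moreover have "card (B - C) + card C = card B"
    using B(1) finB by (metis card_Diff_subset card_mono finite_subset le_add_diff_inverse2)
  moreover have "dim V = card B" using B basis_card_eq_dim by metis
  ultimately show ?thesis using F(2) C(4) E(4) by (simp add: Kr_def)
qed

lemma (in vector_space) dim_le_imp_eq:
  assumes "subspace W" "W \<subseteq> V" "V \<subseteq> span F" "finite F" "dim V \<le> dim W"
  shows "W = V"
proof -
  obtain E where E: "E \<subseteq> W" "independent E" "W \<subseteq> span E" "card E = dim W"
    using basis_exists by blast
  obtain B where B: "E \<subseteq> B" "B \<subseteq> V" "independent B" "V \<subseteq> span B"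
    using maximal_independent_subset_extend[of E V] E assms(2) by blast
  have "finite B" using independent_span_bound[OF assms(4) B(3)] B(2) assms(3) by blast
  moreover have "card B = dim V" using B basis_card_eq_dim by metis
  ultimately have "E = B" using E(4) B(1) assms(5) by (metis card_seteq)
  then show ?thesis using B(4) E(1) assms(1,2) span_minimal[of E W] by blast
qed

lemma (in vector_space) complement_exists:
  assumes "subspace W" "W \<subseteq> V" "V \<subseteq> span F" "finite F" "dim V \<le> dim W + h"
  obtains D where "finite D" "card D \<le> h" "V \<subseteq> span (W \<union> D)"
proof -
  obtain E where E: "E \<subseteq> W" "independent E" "W \<subseteq> span E" "card E = dim W"
    using basis_exists by blast
  obtain B where B: "E \<subseteq> B" "B \<subseteq> V" "independent B" "V \<subseteq> span B"
    using maximal_independent_subset_extend[of E V] E assms(2) by blast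
  have fB: "finite B" using independent_span_bound[OF assms(4) B(3)] B(2) assms(3) by blast
  moreover have "card B = dim V" using B basis_card_eq_dim by metis
  ultimately have "card (B - E) \<le> h" using E(4) B(1) assms(5)
    by (simp add: card_Diff_subset finite_subset)
  moreover have "V \<subseteq> span (W \<union> (B - E))"
    using B(4) span_mono[of B "W \<union> (B - E)"] E(1) by blast
  ultimately show ?thesis using that fB by blast
qed

lemma (in vector_space) separating_functional:
  assumes "p \<notin> span U"
  obtains \<phi> where "\<And>x y. \<phi> (x + y) = \<phi> x + \<phi> y" "\<And>c x. \<phi> (scale c x) = c * \<phi> x"
    "\<And>u. u \<in> span U \<Longrightarrow> \<phi> u = 0" "\<phi> p = 1"
proof -
  obtain E where E: "E \<subseteq> U" "independent E" "U \<subseteq> span E"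
    using basis_exists[of U] by metis
  have sp: "span E = span U" using E by (simp add: span_eq span_superset subset_trans[OF E(1) span_superset])
  have ind: "independent (insert p E)" using assms E(2) sp by (simp add: independent_insertI)
  obtain B where B: "insert p E \<subseteq> B" "independent B" "UNIV \<subseteq> span B"
    by (rule maximal_independent_subset_extend[OF subset_UNIV ind])
  have s: "x \<in> span B" for x using B(3) by blast
  define \<phi> where "\<phi> = (\<lambda>x. representation B x p)"
  show ?thesis
  proof (rule that[of \<phi>])
    show "\<phi> (x + y) = \<phi> x + \<phi> y" for x y
      by (simp add: \<phi>_def representation_add[OF B(2) s s])
    show "\<phi> (scale c x) = c * \<phi> x" for c x
      by (simp add: \<phi>_def representation_scale[OF B(2) s])
    show "\<phi> p = 1" using B by (simp add: \<phi>_def representation_basis)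
    have pE: "p \<notin> E" using assms sp span_base by blast
    show "\<phi> u = 0" if "u \<in> span U" for u
    proof -
      have "u \<in> span E" using that sp by simp
      then have "representation B u = representation E u"
        using B by (intro representation_extend) auto
      then show ?thesis using pE representation_ne_zero[of E u p] by (auto simp: \<phi>_def)
    qed
  qed
qed

section \<open>Order of vanishing at a general point\<close>

text \<open>
  The set \<open>D\<close> indexes a generating family of a space \<open>P\<close> of polynomials. The proof is by induction on the number of
  generators: if \<open>q\<close> is one of them, the map \<open>f \<mapsto> f' q - f q'\<close> kills \<open>q\<close> and lowers the order of vanishing at
  a point by at most one, so the induction hypothesis applies to the image of \<open>P\<close>. In characteristic zero, an
  element of its kernel that vanishes at a point where \<open>q\<close> does not is zero.
\<close>

lemma wronskian:
  fixes p :: "'d \<Rightarrow> 'a::field_char_0 Polynomial.poly"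
  assumes "finite D"
  shows "\<exists>E. finite E \<and> (\<forall>s. s \<notin> E \<longrightarrow> (\<forall>c. [:-s, 1:] ^ card D dvd (\<Sum>\<delta>\<in>D. Polynomial.smult (c \<delta>) (p \<delta>))
            \<longrightarrow> (\<Sum>\<delta>\<in>D. Polynomial.smult (c \<delta>) (p \<delta>)) = 0))"
  using assms
proof (induction D arbitrary: p rule: finite_induct)
  case empty
  show ?case by auto
next
  case (insert \<delta>0 D)
  show ?case
  proof (cases "p \<delta>0 = 0")
    case True
    obtain E where E: "finite E" "\<And>s c. s \<notin> E \<Longrightarrow> [:-s, 1:] ^ card D dvd (\<Sum>\<delta>\<in>D. Polynomial.smult (c \<delta>) (p \<delta>))
            \<Longrightarrow> (\<Sum>\<delta>\<in>D. Polynomial.smult (c \<delta>) (p \<delta>)) = 0"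
      using insert.IH[of p] by blast
    have "[:-s, 1:] ^ card D dvd q" if "[:-s, 1:] ^ Suc (card D) dvd q" for s and q :: "'a Polynomial.poly"
      using that by (rule power_le_dvd) simp
    then show ?thesis using insert E True by auto
  next
    case False
    define L where "L q = pderiv q * p \<delta>0 - q * pderiv (p \<delta>0)" for q
    have L_lin: "L (q + r) = L q + L r" "L (Polynomial.smult a q) = Polynomial.smult a (L q)" for q r a
      by (simp_all add: L_def pderiv_add pderiv_smult algebra_simps smult_diff_right)
    have L_sum: "L (\<Sum>\<delta>\<in>D. Polynomial.smult (c \<delta>) (p \<delta>)) = (\<Sum>\<delta>\<in>D. Polynomial.smult (c \<delta>) (L (p \<delta>)))" for c
      using insert.hyps(1) by (induction D rule: finite_induct) (auto simp: L_lin, simp add: L_def)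
    obtain E where E: "finite E" "\<And>s c. s \<notin> E \<Longrightarrow> [:-s, 1:] ^ card D dvd (\<Sum>\<delta>\<in>D. Polynomial.smult (c \<delta>) (L (p \<delta>)))
            \<Longrightarrow> (\<Sum>\<delta>\<in>D. Polynomial.smult (c \<delta>) (L (p \<delta>))) = 0"
      using insert.IH[of "\<lambda>\<delta>. L (p \<delta>)"] by blast
    show ?thesis
    proof (intro exI conjI allI impI)
      show "finite (E \<union> {s. poly (p \<delta>0) s = 0})" using E(1) poly_roots_finite[OF False] by simp
      fix s c
      assume s: "s \<notin> E \<union> {s. poly (p \<delta>0) s = 0}"
      define P where "P = (\<Sum>\<delta>\<in>insert \<delta>0 D. Polynomial.smult (c \<delta>) (p \<delta>))"
      assume "[:-s, 1:] ^ card (insert \<delta>0 D) dvd (\<Sum>\<delta>\<in>insert \<delta>0 D. Polynomial.smult (c \<delta>) (p \<delta>))"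
      then have dv: "[:-s, 1:] ^ Suc (card D) dvd P" using insert.hyps by (simp add: P_def)
      then obtain Q where Q: "P = [:-s, 1:] ^ Suc (card D) * Q" by blast
      have LP: "L P = (\<Sum>\<delta>\<in>D. Polynomial.smult (c \<delta>) (L (p \<delta>)))"
        using insert.hyps by (simp add: P_def L_lin L_sum) (simp add: L_def)
      have "[:-s, 1:] ^ card D dvd pderiv P"
        unfolding Q pderiv_mult pderiv_power_Suc
        by (rule dvd_add[OF dvd_mult2[OF le_imp_power_dvd] dvd_mult[OF dvd_mult2[OF dvd_smult[OF dvd_refl]]]]) simp
      moreover have "[:-s, 1:] ^ card D dvd P" using dv by (rule power_le_dvd) simp
      ultimately have "[:-s, 1:] ^ card D dvd L P" unfolding L_def by (intro dvd_diff dvd_mult2) auto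
      then have L0: "L P = 0" using E(2)[of s c] s LP by simp
      have root: "poly P s = 0" using Q by simp
      have "P = 0"
      proof (rule ccontr)
        assume "P \<noteq> 0"
        then have o: "order s P = Suc (order s (pderiv P))" using root by (rule order_pderiv)
        have eq: "pderiv P * p \<delta>0 = P * pderiv (p \<delta>0)" using L0 by (simp add: L_def)
        have nz: "pderiv P \<noteq> 0"
        proof
          assume "pderiv P = 0"
          then obtain a where "P = [:a:]" using pderiv_iszero by blast
          then show False using root \<open>P \<noteq> 0\<close> by simp
        qed
        have "order s (p \<delta>0) = 0" using s by (simp add: order_0I)
        then have "order s (pderiv P * p \<delta>0) = order s (pderiv P)" using nz False by (simp add: order_mult)
        moreover have "order s (P * pderiv (p \<delta>0)) \<ge> order s P"
          using eq nz False by (metis le_add1 mult_eq_0_iff order_mult)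
        ultimately show False using o eq by simp
      qed
      then show "(\<Sum>\<delta>\<in>insert \<delta>0 D. Polynomial.smult (c \<delta>) (p \<delta>)) = 0" by (simp add: P_def)
    qed
  qed
qed


section \<open>Polynomials and gradings\<close>

lemma mpoly_sum_single: "p = (\<Sum>m\<in>keys p. single m (lookup p m))"
  by (rule poly_mapping_eqI) (auto simp: lookup_sum lookup_single when_def in_keys_iff sum.delta)

lemma mpoly_induct [case_names single add]:
  fixes p :: "'a \<Rightarrow>\<^sub>0 'b::comm_monoid_add"
  assumes "\<And>m c. P (single m c)" "\<And>p q. P p \<Longrightarrow> P q \<Longrightarrow> P (p + q)"
  shows "P p"
proof -
  have "P (\<Sum>m\<in>A. single m (c m))" if "finite A" for A and c :: "_ \<Rightarrow> 'b::comm_monoid_add"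
    using that
  proof (induction A rule: finite_induct)
    case empty
    then show ?case using assms(1)[of undefined 0] by simp
  qed (simp add: assms)
  from this[of "keys p"] show ?thesis by (subst mpoly_sum_single) simp
qed

lemma lookup_single_mult:
  fixes p :: "('v, 'a::comm_ring_1) mpoly"
  shows "lookup (single k a * p) (k + m) = a * lookup p m"
  by (simp add: lookup_mult lookup_single when_mult)

lemma lookup_const_mult:
  fixes p :: "('v, 'a::comm_ring_1) mpoly"
  shows "lookup (const_poly c * p) m = c * lookup p m"
  using lookup_single_mult[of 0 c p m] by (simp add: const_poly_def)

lemma lookup_single_mult_eq_0:
  fixes p :: "('v, 'a::comm_ring_1) mpoly"
  assumes "\<And>n. m \<noteq> k + n"
  shows "lookup (single k a * p) m = 0"
  using assms keys_mult[of "single k a" p]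
  by (auto simp: not_in_keys_iff_lookup_eq_zero[symmetric] split: if_splits)

lemma const_poly_simps:
  "const_poly 0 = 0" "const_poly 1 = 1"
  "const_poly (a + b) = const_poly a + const_poly b"
  "const_poly (a * b) = const_poly a * const_poly b"
  by (simp_all add: const_poly_def single_add mult_single)

text \<open>
  Scalar multiplication, which makes the polynomials a vector space over the coefficient field.
\<close>

definition smul :: "'a::field \<Rightarrow> ('v, 'a) mpoly \<Rightarrow> ('v, 'a) mpoly" where
  "smul c p = const_poly c * p"

lemma lookup_smul: "lookup (smul c p) m = c * lookup p m"
  by (simp add: smul_def lookup_const_mult)

interpretation vs: vector_space "smul :: 'a::field \<Rightarrow> ('v, 'a) mpoly \<Rightarrow> ('v, 'a) mpoly"
  by unfold_locales (auto simp: smul_def const_poly_simps algebra_simps)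

text \<open>Ideals are the subspaces (\<open>rng.subspace\<close>) of the ring regarded as a module over itself.\<close>

interpretation rng: module "(*) :: 'a::comm_ring_1 \<Rightarrow> 'a \<Rightarrow> 'a"
  by (fact module_times)

lemma ideal_imp_subspace: "rng.subspace I \<Longrightarrow> vs.subspace I"
  by (auto simp: rng.subspace_def vs.subspace_def smul_def)

lemma mon_degree_simps:
  "mon_degree (m + n) = mon_degree m + mon_degree n"
  "mon_degree 0 = 0"
  "mon_degree (single v k) = k"
  by (auto simp: mon_degree_def lookup_add sum.distrib lookup_single when_def)

lemma homogeneous_0: "homogeneous t 0"
  by (simp add: homogeneous_def)

lemma homogeneous_add: "homogeneous t p \<Longrightarrow> homogeneous t q \<Longrightarrow> homogeneous t (p + q)"
  using keys_add[of p q] by (auto simp: homogeneous_def)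

lemma homogeneous_mult: "homogeneous s p \<Longrightarrow> homogeneous t q \<Longrightarrow> homogeneous (s + t) (p * q)"
  using keys_mult[of p q] by (auto simp: homogeneous_def mon_degree_simps)

lemma homogeneous_single: "homogeneous (mon_degree m) (single m c)"
  by (auto simp: homogeneous_def)

lemma homogeneous_const: "homogeneous 0 (const_poly c)"
  using homogeneous_single[of 0 c] by (simp add: const_poly_def mon_degree_simps)

lemma homogeneous_smul: "homogeneous t p \<Longrightarrow> homogeneous t (smul c p)"
  using homogeneous_mult[OF homogeneous_const, of t p c] by (simp add: smul_def)

lemma homogeneous_sum: "(\<And>x. x \<in> A \<Longrightarrow> homogeneous t (f x)) \<Longrightarrow> homogeneous t (sum f A)"
  by (induction A rule: infinite_finite_induct) (auto intro: homogeneous_0 homogeneous_add)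

lemma homogeneous_power: "homogeneous t p \<Longrightarrow> homogeneous (k * t) (p ^ k)"
proof (induction k)
  case 0
  show ?case using homogeneous_const[of 1] by (simp add: const_poly_simps)
qed (auto dest: homogeneous_mult)

lemma homogeneous_X: "homogeneous 1 (X i)"
  using homogeneous_single[of "single i 1" 1] by (simp add: X_def mon_degree_simps)

text \<open>
  The homogeneous polynomials of degree \<open>t\<close>, including zero.
\<close>

definition dspace :: "nat \<Rightarrow> ('v::finite, 'a::comm_ring_1) mpoly set" where
  "dspace t = {p. homogeneous t p}"

lemma subspace_dspace: "vs.subspace (dspace t)"
  by (auto simp: vs.subspace_def dspace_def homogeneous_0 homogeneous_add homogeneous_smul)

text \<open>
  The homogeneous component of degree \<open>t\<close>.
\<close>

definition hcomp :: "nat \<Rightarrow> ('v::finite, 'a::comm_ring_1) mpoly \<Rightarrow> ('v, 'a) mpoly" where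
  "hcomp t p = (\<Sum>m\<in>{m\<in>keys p. mon_degree m = t}. single m (lookup p m))"

lemma lookup_hcomp: "lookup (hcomp t p) m = (if mon_degree m = t then lookup p m else 0)"
  by (auto simp: hcomp_def lookup_sum lookup_single when_def in_keys_iff sum.delta)

lemma hcomp_add: "hcomp t (p + q) = hcomp t p + hcomp t q"
  by (rule poly_mapping_eqI) (simp add: lookup_hcomp lookup_add)

lemma hcomp_diff: "hcomp t (p - q) = hcomp t p - hcomp t q"
  by (rule poly_mapping_eqI) (simp add: lookup_hcomp lookup_minus)

lemma homogeneous_hcomp: "homogeneous t (hcomp t p)"
  by (auto simp: homogeneous_def in_keys_iff lookup_hcomp split: if_splits)

lemma hcomp_homogeneous: "homogeneous s p \<Longrightarrow> hcomp t p = (if s = t then p else 0)"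
  by (rule poly_mapping_eqI) (auto simp: homogeneous_def in_keys_iff lookup_hcomp)

lemma hcomp_mult:
  assumes "homogeneous d f"
  shows "hcomp t (r * f) = (if d \<le> t then hcomp (t - d) r * f else 0)"
proof (induction r rule: mpoly_induct)
  case (single m c)
  have "homogeneous (mon_degree m + d) (single m c * f)"
    by (intro homogeneous_mult homogeneous_single assms)
  then show ?case
    by (auto simp: hcomp_homogeneous[OF homogeneous_single] hcomp_homogeneous)
qed (simp add: hcomp_add distrib_right)

text \<open>
  An ideal that contains the homogeneous components of its elements.
\<close>

definition graded_ideal :: "('v::finite, 'a::comm_ring_1) mpoly set \<Rightarrow> bool" where
  "graded_ideal I \<longleftrightarrow> rng.subspace I \<and> (\<forall>p\<in>I. \<forall>t. hcomp t p \<in> I)"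

text \<open>
  For an ideal \<open>I\<close>, this is the ideal \<open>I + (f)\<close>.
\<close>

definition add_gen :: "'a::comm_ring_1 set \<Rightarrow> 'a \<Rightarrow> 'a set" where
  "add_gen I f = {p. \<exists>k. p - k * f \<in> I}"

lemma ideal_gen_insert: "ideal_gen (insert f F) = add_gen (ideal_gen F) f"
  by (simp add: ideal_gen_def add_gen_def rng.span_insert)

lemma graded_ideal_add_gen:
  assumes "graded_ideal I" "homogeneous d f"
  shows "graded_ideal (add_gen I f)"
  unfolding graded_ideal_def
proof (intro conjI ballI allI)
  have I: "rng.subspace I" using assms(1) by (simp add: graded_ideal_def)
  have "I = rng.span I" using I by (metis rng.span_eq_iff)
  then have "add_gen I f = rng.span (insert f I)"
    by (metis add_gen_def rng.span_insert)
  then show "rng.subspace (add_gen I f)" by simp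
  fix p t
  assume "p \<in> add_gen I f"
  then obtain k where "p - k * f \<in> I" by (auto simp: add_gen_def)
  then have "hcomp t (p - k * f) \<in> I" using assms(1) by (simp add: graded_ideal_def)
  then have "hcomp t p - (if d \<le> t then hcomp (t - d) k else 0) * f \<in> I"
    by (simp add: hcomp_diff hcomp_mult[OF assms(2)] split: if_splits)
  then show "hcomp t p \<in> add_gen I f" unfolding add_gen_def by blast
qed

lemma graded_ideal_0: "graded_ideal {0}"
  by (simp add: graded_ideal_def hcomp_def)

section \<open>Monomials in three variables\<close>

text \<open>
  The exponent vector of \<open>x\<^sub>1\<^sup>a x\<^sub>2\<^sup>b x\<^sub>3\<^sup>c\<close>.
\<close>

definition expo :: "nat \<Rightarrow> nat \<Rightarrow> nat \<Rightarrow> 3 \<Rightarrow>\<^sub>0 nat" where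
  "expo a b c = single 1 a + single 2 b + single 3 c"

lemma three_neq: "(1::3) \<noteq> 2" "(2::3) \<noteq> 1" "(1::3) \<noteq> 3" "(3::3) \<noteq> 1" "(2::3) \<noteq> 3" "(3::3) \<noteq> 2"
  by auto

lemma lookup_expo: "lookup (expo a b c) 1 = a" "lookup (expo a b c) 2 = b" "lookup (expo a b c) 3 = c"
  by (simp_all only: expo_def lookup_add lookup_single three_neq when_simps) simp_all

lemma exponent_eqI:
  assumes "lookup m 1 = lookup n 1" "lookup m 2 = lookup n 2" "lookup m 3 = lookup n 3"
  shows "m = (n :: 3 \<Rightarrow>\<^sub>0 nat)"
proof (rule poly_mapping_eqI)
  fix k :: 3
  show "lookup m k = lookup n k" using assms exhaust_3[of k] by auto
qed

lemma expo_lookup: "expo (lookup m 1) (lookup m 2) (lookup m 3) = m"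
  by (rule exponent_eqI) (simp_all only: lookup_expo)

lemma mon_degree_3: "mon_degree (m :: 3 \<Rightarrow>\<^sub>0 nat) = lookup m 1 + lookup m 2 + lookup m 3"
  by (simp add: mon_degree_def sum_3)

lemma mon_degree_expo: "mon_degree (expo a b c) = a + b + c"
  by (simp add: mon_degree_3 lookup_expo del: Numeral_Type.num1_eq_iff)

lemma expo_add: "expo a b c + expo a' b' c' = expo (a + a') (b + b') (c + c')"
  by (rule exponent_eqI) (simp_all only: lookup_expo lookup_add)

lemma X_power: "(X i :: ('v, 'a::comm_ring_1) mpoly) ^ k = single (single i k) 1"
proof (induction k)
  case (Suc k)
  then show ?case by (simp add: X_def mult_single single_add[symmetric])
qed simp

lemma mon_eq_single: "mon a b c = single (expo a b c) 1"
  by (simp add: mon_def X_power mult_single expo_def)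

lemma exponents_of_degree: "{m :: 3 \<Rightarrow>\<^sub>0 nat. mon_degree m = t} = (\<lambda>(a, b). expo a b (t - a - b)) ` (SIGMA a:{..t}. {..t - a})"
proof (intro equalityI subsetI)
  fix m :: "3 \<Rightarrow>\<^sub>0 nat" assume "m \<in> {m. mon_degree m = t}"
  then have "m = expo (lookup m 1) (lookup m 2) (t - lookup m 1 - lookup m 2)"
      "lookup m 1 \<in> {..t}" "lookup m 2 \<in> {..t - lookup m 1}"
    by (auto simp: mon_degree_3 intro!: exponent_eqI simp: lookup_expo simp del: Numeral_Type.num1_eq_iff)
  then show "m \<in> (\<lambda>(a, b). expo a b (t - a - b)) ` (SIGMA a:{..t}. {..t - a})"
    by (intro image_eqI[of _ _ "(lookup m 1, lookup m 2)"]) auto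
qed (auto simp: mon_degree_expo)

lemma finite_exponents: "finite {m :: 3 \<Rightarrow>\<^sub>0 nat. mon_degree m = t}"
  by (simp add: exponents_of_degree)

lemma card_exponents: "2 * card {m :: 3 \<Rightarrow>\<^sub>0 nat. mon_degree m = t} = (t + 1) * (t + 2)"
proof -
  have "inj_on (\<lambda>(a, b). expo a b (t - a - b)) (SIGMA a:{..t}. {..t - a})"
    by (rule inj_onI) (auto dest!: arg_cong[where f = "\<lambda>m. (lookup m 1, lookup m 2)"] simp: lookup_expo)
  then have "card {m :: 3 \<Rightarrow>\<^sub>0 nat. mon_degree m = t} = (\<Sum>a\<le>t. t - a + 1)"
    unfolding exponents_of_degree by (simp add: card_image)
  also have "\<dots> = (\<Sum>a\<le>t. a + 1)"
    using sum.nat_diff_reindex[of "\<lambda>a. a + 1" "Suc t"] by (simp add: lessThan_Suc_atMost)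
  also have "2 * (\<Sum>a\<le>t. a + 1) = (t + 1) * (t + 2)" by (induction t) auto
  finally show ?thesis .
qed

lemma homogeneous_in_span:
  assumes "homogeneous t p"
  shows "p \<in> vs.span ((\<lambda>m. single m 1) ` {m. mon_degree m = t})"
proof -
  have "p = (\<Sum>m\<in>keys p. smul (lookup p m) (single m 1))"
    by (subst mpoly_sum_single) (simp add: smul_def const_poly_def mult_single)
  also have "\<dots> \<in> vs.span ((\<lambda>m. single m 1) ` {m. mon_degree m = t})"
    using assms by (intro vs.span_sum vs.span_scale vs.span_base) (auto simp: homogeneous_def)
  finally show ?thesis .
qed

text \<open>
  The monomials of degree \<open>t\<close>, as polynomials.
\<close>

definition dbasis :: "nat \<Rightarrow> 'a::field poly3 set" where
  "dbasis t = (\<lambda>m. single m 1) ` {m. mon_degree m = t}"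

lemma finite_dbasis: "finite (dbasis t)"
  by (simp add: dbasis_def finite_exponents)

lemma dspace_span: "dspace t \<subseteq> vs.span (dbasis t)"
  using homogeneous_in_span by (auto simp: dspace_def dbasis_def)

section \<open>Leading exponents\<close>

lemma grevlex_irrefl: "\<not> grevlex_less m m"
  by (simp add: grevlex_less_def)

lemma grevlex_trans: "grevlex_less k m \<Longrightarrow> grevlex_less m n \<Longrightarrow> grevlex_less k n"
  by (auto simp: grevlex_less_def)

lemma grevlex_total: "m \<noteq> n \<Longrightarrow> grevlex_less m n \<or> grevlex_less n m"
  unfolding grevlex_less_def using exponent_eqI[of m n] mon_degree_3[of m] mon_degree_3[of n] by linarith

lemma grevlex_max:
  assumes "finite A" "A \<noteq> {}"
  obtains m where "m \<in> A" "\<And>n. n \<in> A \<Longrightarrow> n \<noteq> m \<Longrightarrow> grevlex_less n m"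
proof -
  have "\<exists>m\<in>A. \<forall>n\<in>A. n \<noteq> m \<longrightarrow> grevlex_less n m"
    using assms
  proof (induction A rule: finite_ne_induct)
    case (insert x A)
    then obtain m where "m \<in> A" "\<forall>n\<in>A. n \<noteq> m \<longrightarrow> grevlex_less n m" by blast
    then show ?case using grevlex_total[of x m] grevlex_trans by (metis insert_iff)
  qed auto
  then show ?thesis using that by blast
qed

lemma leading_exponentI:
  assumes "m \<in> keys f" "\<And>n. n \<in> keys f \<Longrightarrow> n \<noteq> m \<Longrightarrow> grevlex_less n m"
  shows "leading_exponent f = m"
  unfolding leading_exponent_def
proof (rule the_equality)
  show "m \<in> keys f \<and> (\<forall>n\<in>keys f. n \<noteq> m \<longrightarrow> grevlex_less n m)" using assms by blast
  show "n = m" if "n \<in> keys f \<and> (\<forall>k\<in>keys f. k \<noteq> n \<longrightarrow> grevlex_less k n)" for n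
    using that assms grevlex_trans[of m n m] grevlex_irrefl[of m] by metis
qed

lemma leading_exponent_props:
  assumes "f \<noteq> 0"
  shows "leading_exponent f \<in> keys f" "\<And>n. n \<in> keys f \<Longrightarrow> n \<noteq> leading_exponent f \<Longrightarrow> grevlex_less n (leading_exponent f)"
proof -
  have "keys f \<noteq> {}" using assms by (metis empty_iff lookup_not_eq_zero_eq_in_keys lookup_zero poly_mapping_eqI)
  then obtain m where m: "m \<in> keys f" "\<And>n. n \<in> keys f \<Longrightarrow> n \<noteq> m \<Longrightarrow> grevlex_less n m"
    using grevlex_max[OF finite_keys] by blast
  then have "leading_exponent f = m" by (rule leading_exponentI)
  then show "leading_exponent f \<in> keys f" "\<And>n. n \<in> keys f \<Longrightarrow> n \<noteq> leading_exponent f \<Longrightarrow> grevlex_less n (leading_exponent f)"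
    using m by auto
qed

lemma independent_leading_exponents:
  fixes F :: "(3 \<Rightarrow>\<^sub>0 nat) \<Rightarrow> 'a::field poly3"
  assumes "finite L" "\<And>m. m \<in> L \<Longrightarrow> F m \<noteq> 0 \<and> leading_exponent (F m) = m"
  shows "vs.independent (F ` L)" "inj_on F L"
proof -
  show inj: "inj_on F L" using assms(2) by (metis inj_onI)
  show "vs.independent (F ` L)"
  proof (rule vs.independent_if_scalars_zero)
    fix u v
    assume sum: "(\<Sum>x\<in>F ` L. smul (u x) x) = 0" and v: "v \<in> F ` L"
    show "u v = 0"
    proof (rule ccontr)
      assume "u v \<noteq> 0"
      then have "{m \<in> L. u (F m) \<noteq> 0} \<noteq> {}" using v by auto
      then obtain m where m: "m \<in> {m \<in> L. u (F m) \<noteq> 0}"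
          "\<And>n. n \<in> {m \<in> L. u (F m) \<noteq> 0} \<Longrightarrow> n \<noteq> m \<Longrightarrow> grevlex_less n m"
        using grevlex_max[of "{m \<in> L. u (F m) \<noteq> 0}"] assms(1) by auto
      have z: "u (F n) * lookup (F n) m = 0" if "n \<in> L" "n \<noteq> m" for n
      proof (rule ccontr)
        assume "u (F n) * lookup (F n) m \<noteq> 0"
        then have "u (F n) \<noteq> 0" "m \<in> keys (F n)" by (auto simp: in_keys_iff)
        then show False
          using that m(2)[of n] leading_exponent_props(2)[of "F n" m] assms(2)[of n]
            grevlex_trans grevlex_irrefl by (metis (mono_tags, lifting) mem_Collect_eq)
      qed
      have rest: "(\<Sum>n\<in>L - {m}. u (F n) * lookup (F n) m) = 0"
        by (rule sum.neutral) (use z in blast)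
      have "0 = lookup (\<Sum>n\<in>L. smul (u (F n)) (F n)) m"
        using sum by (simp add: sum.reindex[OF inj])
      also have "\<dots> = (\<Sum>n\<in>L. u (F n) * lookup (F n) m)" by (simp add: lookup_sum lookup_smul)
      also have "\<dots> = u (F m) * lookup (F m) m"
        using m(1) assms(1) rest by (subst sum.remove[of L m]) auto
      finally show False
        using m(1) assms(2)[of m] leading_exponent_props(1)[of "F m"] by (auto simp: in_keys_iff)
    qed
  qed (use assms in simp)
qed

text \<open>
  Polynomials with distinct leading exponents are linearly independent.
\<close>

lemma card_leading_le_dim:
  fixes V :: "'a::field poly3 set"
  assumes "\<And>m. m \<in> L \<Longrightarrow> \<exists>f\<in>V. f \<noteq> 0 \<and> leading_exponent f = m" "V \<subseteq> dspace t"
  shows "finite L" "card L \<le> vs.dim V"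
proof -
  have "L \<subseteq> {m. mon_degree m = t}"
    using assms leading_exponent_props(1) unfolding dspace_def homogeneous_def by blast
  then show fin: "finite L" using finite_exponents finite_subset by blast
  obtain F where F: "\<And>m. m \<in> L \<Longrightarrow> F m \<in> V \<and> F m \<noteq> 0 \<and> leading_exponent (F m) = m"
    using assms(1) by metis
  have ind: "vs.independent (F ` L)" "inj_on F L"
    using independent_leading_exponents[OF fin] F by blast+
  obtain B where B: "F ` L \<subseteq> B" "B \<subseteq> V" "vs.independent B" "V \<subseteq> vs.span B"
    using vs.maximal_independent_subset_extend[of "F ` L" V] ind(1) F by blast
  have "finite B"
    using vs.independent_span_bound[OF finite_dbasis B(3)] B(2) assms(2) dspace_span[of t] by blast
  then have "card L \<le> card B" using B(1) card_mono card_image[OF ind(2)] by metis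
  then show "card L \<le> vs.dim V" using vs.basis_card_eq_dim B by metis
qed

lemma dim_dspace: "vs.dim (dspace t :: 'a::field poly3 set) = card {m :: 3 \<Rightarrow>\<^sub>0 nat. mon_degree m = t}"
proof (rule antisym)
  show "vs.dim (dspace t :: 'a poly3 set) \<le> card {m :: 3 \<Rightarrow>\<^sub>0 nat. mon_degree m = t}"
  proof (rule order_trans)
    show "vs.dim (dspace t :: 'a poly3 set) \<le> card (dbasis t :: 'a poly3 set)"
      by (rule vs.dim_le_card[OF dspace_span finite_dbasis])
    show "card (dbasis t :: 'a poly3 set) \<le> card {m :: 3 \<Rightarrow>\<^sub>0 nat. mon_degree m = t}"
      unfolding dbasis_def by (rule card_image_le[OF finite_exponents])
  qed
  show "card {m :: 3 \<Rightarrow>\<^sub>0 nat. mon_degree m = t} \<le> vs.dim (dspace t :: 'a poly3 set)"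
  proof (rule card_leading_le_dim(2)[where t = t])
    fix m :: "3 \<Rightarrow>\<^sub>0 nat" assume "m \<in> {m. mon_degree m = t}"
    then show "\<exists>f\<in>dspace t. f \<noteq> (0::'a poly3) \<and> leading_exponent f = m"
      using homogeneous_single[of m "1::'a"]
      by (intro bexI[of _ "single m 1"] conjI leading_exponentI)
        (auto simp: dspace_def dest: arg_cong[where f = "\<lambda>p. lookup p m"])
  qed simp
qed

section \<open>Hilbert functions\<close>

text \<open>
  The Hilbert function of \<open>S/I\<close> for an ideal \<open>I\<close>, extended by zero to negative degrees so that the degree shifts in
  exact sequences need no case distinction.
\<close>

definition hilb :: "'a::field poly3 set \<Rightarrow> int \<Rightarrow> int" where
  "hilb I t = (if t < 0 then 0
     else int (vs.dim (dspace (nat t) :: 'a poly3 set)) - int (vs.dim (I \<inter> dspace (nat t))))"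

lemma hilb_nat:
  fixes I :: "'a::field poly3 set"
  shows "hilb I (int t) = int (vs.dim (dspace t :: 'a poly3 set)) - int (vs.dim (I \<inter> dspace t))"
  by (simp add: hilb_def)

text \<open>
  Rank-nullity for multiplication by \<open>q\<close> from \<open>S\<^bsub>s\<^esub>\<close> to \<open>(S/I)\<^bsub>s+r\<^esub>\<close>.
\<close>

lemma dim_ideal_plus_multiples:
  fixes I :: "'a::field poly3 set"
  assumes "rng.subspace I" "homogeneous r q"
  shows "vs.dim {w + q * v | w v. w \<in> I \<inter> dspace (s + r) \<and> v \<in> dspace s}
       + vs.dim {v \<in> dspace s. q * v \<in> I} = vs.dim (I \<inter> dspace (s + r)) + vs.dim (dspace s :: 'a poly3 set)"
proof -
  have "{v \<in> dspace s. q * v \<in> I} = {v \<in> dspace s. q * v \<in> I \<inter> dspace (s + r)}"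
    using homogeneous_mult[OF assms(2)] by (auto simp: dspace_def add.commute[of s])
  moreover have "vs.dim {w + q * v | w v. w \<in> I \<inter> dspace (s + r) \<and> v \<in> dspace s}
       + vs.dim {v \<in> dspace s. q * v \<in> I \<inter> dspace (s + r)} = vs.dim (I \<inter> dspace (s + r)) + vs.dim (dspace s :: 'a poly3 set)"
  proof (rule vs.dim_sum_image[OF _ _ _ _ finite_dbasis subspace_dspace dspace_span finite_dbasis])
    show "I \<inter> dspace (s + r) \<subseteq> vs.span (dbasis (s + r))" using dspace_span[of "s + r"] by blast
    show "vs.subspace (I \<inter> dspace (s + r))"
      by (intro vs.subspace_inter ideal_imp_subspace assms subspace_dspace)
    show "q * (x + y) = q * x + q * y" for x y by (rule distrib_left)
    show "q * smul c x = smul c (q * x)" for c x by (simp add: smul_def mult.left_commute)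
  qed
  ultimately show ?thesis by simp
qed

text \<open>
  The effect of a nonzerodivisor on the Hilbert function.
\<close>

lemma hilb_add_gen:
  fixes I :: "'a::field poly3 set"
  assumes "graded_ideal I" "homogeneous d f" and reg: "\<And>g. f * g \<in> I \<Longrightarrow> g \<in> I"
  shows "hilb (add_gen I f) t = hilb I t - hilb I (t - int d)"
proof (cases "0 \<le> t")
  case True
  then obtain n where t: "t = int n" using nonneg_int_cases by blast
  have I: "rng.subspace I" using assms(1) by (simp add: graded_ideal_def)
  show ?thesis
  proof (cases "d \<le> n")
    case False
    have "add_gen I f \<inter> dspace n = I \<inter> dspace n"
    proof (intro equalityI subsetI)
      fix p assume p: "p \<in> add_gen I f \<inter> dspace n"
      then obtain k where "p - k * f \<in> I" by (auto simp: add_gen_def)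
      then have "hcomp n (p - k * f) \<in> I" using assms(1) by (simp add: graded_ideal_def)
      then have "p \<in> I" using False p
        by (simp add: hcomp_diff hcomp_mult[OF assms(2)] hcomp_homogeneous[of n] dspace_def)
      then show "p \<in> I \<inter> dspace n" using p by simp
    next
      fix p assume "p \<in> I \<inter> dspace n"
      then show "p \<in> add_gen I f \<inter> dspace n"
        by (auto simp: add_gen_def intro: exI[of _ 0])
    qed
    then show ?thesis using False by (simp add: t hilb_def)
  next
    case True
    then obtain s where s: "n = s + d" by (metis le_add_diff_inverse2)
    have "add_gen I f \<inter> dspace n = {w + f * v | w v. w \<in> I \<inter> dspace (s + d) \<and> v \<in> dspace s}"
    proof (intro equalityI subsetI)
      fix p assume p: "p \<in> add_gen I f \<inter> dspace n"
      then obtain k where "p - k * f \<in> I" by (auto simp: add_gen_def)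
      then have "hcomp n (p - k * f) \<in> I" using assms(1) by (simp add: graded_ideal_def)
      then have "hcomp n (p - k * f) \<in> I \<inter> dspace (s + d)"
        using s homogeneous_hcomp[of n] by (auto simp: dspace_def)
      moreover have "p = hcomp n (p - k * f) + f * hcomp s k"
        using p s hcomp_mult[OF assms(2), of n k]
        by (simp add: hcomp_diff hcomp_homogeneous[of n] dspace_def mult.commute)
      ultimately show "p \<in> {w + f * v | w v. w \<in> I \<inter> dspace (s + d) \<and> v \<in> dspace s}"
        using homogeneous_hcomp[of s k] unfolding dspace_def by blast
    next
      fix p assume "p \<in> {w + f * v | w v. w \<in> I \<inter> dspace (s + d) \<and> v \<in> dspace s}"
      then obtain w v where wv: "p = w + f * v" "w \<in> I" "homogeneous (s + d) w" "homogeneous s v"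
        by (auto simp: dspace_def)
      then have "p - v * f \<in> I" by (simp add: mult.commute)
      then have "p \<in> add_gen I f" by (auto simp: add_gen_def)
      moreover have "homogeneous n p"
        using wv homogeneous_mult[OF assms(2) wv(4)] s by (simp add: homogeneous_add add.commute)
      ultimately show "p \<in> add_gen I f \<inter> dspace n" by (simp add: dspace_def)
    qed
    moreover have "{v \<in> dspace s. f * v \<in> I} = I \<inter> dspace s"
      using reg rng.subspace_scale[OF I] by blast
    ultimately have "vs.dim (add_gen I f \<inter> dspace n) + vs.dim (I \<inter> dspace s)
        = vs.dim (I \<inter> dspace n) + vs.dim (dspace s :: 'a poly3 set)"
      using dim_ideal_plus_multiples[OF I assms(2), of s] s by simp
    then show ?thesis using s by (simp add: t hilb_def nat_add_distrib)
  qed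
qed (simp add: hilb_def)

lemma hilb_zero_ideal:
  "2 * hilb ({0} :: 'a::field poly3 set) t = (if t < 0 then 0 else (t + 1) * (t + 2))"
proof (cases "t < 0")
  case False
  then obtain n where t: "t = int n" using nonneg_int_cases[of t] by auto
  have "{0} \<inter> dspace n = {0 :: 'a poly3}" by (auto simp: dspace_def homogeneous_0)
  moreover have "vs.dim {0 :: 'a poly3} = 0"
    using vs.dim_le_card[of "{0 :: 'a poly3}" "{}"] by simp
  moreover have "2 * int (card {m :: 3 \<Rightarrow>\<^sub>0 nat. mon_degree m = n}) = (int n + 1) * (int n + 2)"
    using arg_cong[OF card_exponents[of n], of int] by (simp add: algebra_simps)
  ultimately show ?thesis by (simp add: t hilb_nat dim_dspace)
qed (simp add: hilb_def)


section \<open>Evaluation of polynomials and linear changes of coordinates\<close>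

text \<open>
  The value of the monomial with exponent vector \<open>m\<close> at the point \<open>g\<close>.
\<close>

definition mev :: "('v::finite \<Rightarrow> 'b::comm_ring_1) \<Rightarrow> ('v \<Rightarrow>\<^sub>0 nat) \<Rightarrow> 'b" where
  "mev g m = (\<Prod>v\<in>UNIV. g v ^ lookup m v)"

lemma mev_simps: "mev g (m + n) = mev g m * mev g n" "mev g 0 = 1"
  by (simp_all add: mev_def lookup_add power_add prod.distrib)

lemma mev_single: "mev g (single v k) = g v ^ k"
proof -
  have "mev g (single v k) = (\<Prod>w\<in>{v}. g w ^ k)"
    unfolding mev_def by (rule prod.mono_neutral_cong_right) (auto simp: lookup_single when_def)
  then show ?thesis by simp
qed

text \<open>
  A homomorphism of coefficient rings; evaluation along it is a ring homomorphism on polynomials.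
\<close>

locale coeff_hom =
  fixes h :: "'a::comm_ring_1 \<Rightarrow> 'b::comm_ring_1"
  assumes h0: "h 0 = 0" and h1: "h 1 = 1"
    and hadd: "h (a + b) = h a + h b" and hmult: "h (a * b) = h a * h b"
begin

lemma eval_superset:
  fixes g :: "'v::finite \<Rightarrow> 'b"
  assumes "finite A" "keys p \<subseteq> A"
  shows "eval_poly h g p = (\<Sum>m\<in>A. h (lookup p m) * mev g m)"
proof -
  have "(\<Prod>v\<in>keys m. g v ^ lookup m v) = mev g m" for m
    unfolding mev_def by (rule prod.mono_neutral_left) (auto simp: in_keys_iff)
  then have "eval_poly h g p = (\<Sum>m\<in>keys p. h (lookup p m) * mev g m)" by (simp add: eval_poly_def)
  also have "\<dots> = (\<Sum>m\<in>A. h (lookup p m) * mev g m)"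
    using assms by (intro sum.mono_neutral_left) (auto simp: in_keys_iff h0)
  finally show ?thesis .
qed

lemma eval_add: "eval_poly h g (p + q) = eval_poly h g p + eval_poly h g q" for g :: "'v::finite \<Rightarrow> 'b"
proof -
  have "eval_poly h g r = (\<Sum>m\<in>keys p \<union> keys q. h (lookup r m) * mev g m)"
    if "r \<in> {p, q, p + q}" for r
    using that keys_add[of p q] by (intro eval_superset) auto
  then show ?thesis by (simp add: lookup_add hadd distrib_right sum.distrib)
qed

lemma eval_single: "eval_poly h g (single m c) = h c * mev g m" for g :: "'v::finite \<Rightarrow> 'b"
  by (subst eval_superset[of "{m}"]) auto

lemma eval_mult: "eval_poly h g (p * q) = eval_poly h g p * eval_poly h g q" for g :: "'v::finite \<Rightarrow> 'b"
proof (induction p rule: mpoly_induct)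
  case (single m c)
  show ?case
  proof (induction q rule: mpoly_induct)
    case (single n d)
    show ?case
      by (simp only: mult_single eval_single mev_simps hmult mult.assoc mult.left_commute)
  qed (simp only: eval_add distrib_left)
qed (simp add: eval_add distrib_right)

lemma eval_const: "eval_poly h g (const_poly c) = h c" for g :: "'v::finite \<Rightarrow> 'b"
  by (simp add: const_poly_def eval_single mev_simps)

lemma eval_X: "eval_poly h g (X v) = g v" for g :: "'v::finite \<Rightarrow> 'b"
  by (simp add: X_def eval_single mev_single h1)

lemma eval_sum: "eval_poly h g (\<Sum>x\<in>A. f x) = (\<Sum>x\<in>A. eval_poly h g (f x))" for g :: "'v::finite \<Rightarrow> 'b"
proof (induction A rule: infinite_finite_induct)
  case (insert x A)
  then show ?case by (simp add: eval_add)
qed (use eval_const[of g 0] in \<open>simp_all add: const_poly_simps h0\<close>)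

lemma eval_prod: "eval_poly h g (\<Prod>x\<in>A. f x) = (\<Prod>x\<in>A. eval_poly h g (f x))" for g :: "'v::finite \<Rightarrow> 'b"
proof (induction A rule: infinite_finite_induct)
  case (insert x A)
  then show ?case by (simp add: eval_mult)
qed (use eval_const[of g 1] in \<open>simp_all add: const_poly_simps h1\<close>)

lemma eval_power: "eval_poly h g (p ^ k) = eval_poly h g p ^ k" for g :: "'v::finite \<Rightarrow> 'b"
  using eval_prod[of g "\<lambda>_. p" "{..<k}"] by simp

end

text \<open>
  Evaluation along \<open>const_poly\<close> covers linear changes of coordinates; evaluation along the identity covers polynomial
  functions of matrices.
\<close>

interpretation cc: coeff_hom "const_poly :: 'a::comm_ring_1 \<Rightarrow> ('v, 'a) mpoly"
  by unfold_locales (simp_all add: const_poly_simps)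

interpretation ci: coeff_hom "id :: 'a::comm_ring_1 \<Rightarrow> 'a"
  by unfold_locales simp_all

lemma single_eq_mev: "single m c = const_poly c * mev X (m :: 'v::finite \<Rightarrow>\<^sub>0 nat)"
proof -
  have "(\<Prod>v\<in>A. (X v :: ('v, 'a) mpoly) ^ lookup m v) = single (\<Sum>v\<in>A. single v (lookup m v)) 1"
    if "finite A" for A
    using that by (induction A rule: finite_induct) (simp_all add: X_power mult_single)
  moreover have "(\<Sum>v\<in>UNIV. single v (lookup m v)) = m"
    by (rule poly_mapping_eqI) (simp add: lookup_sum lookup_single when_def)
  ultimately show ?thesis by (simp add: mev_def const_poly_def mult_single)
qed

lemmas lc_def = linear_change_def

lemma lc_simps:
  "linear_change \<alpha> (p + q) = linear_change \<alpha> p + linear_change \<alpha> q"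
  "linear_change \<alpha> (p * q) = linear_change \<alpha> p * linear_change \<alpha> q"
  "linear_change \<alpha> (const_poly c) = const_poly c"
  "linear_change \<alpha> (X v) = (\<Sum>i\<in>UNIV. const_poly (\<alpha> $ i $ v) * X i)"
  "linear_change \<alpha> (sum f A) = (\<Sum>x\<in>A. linear_change \<alpha> (f x))"
  "linear_change \<alpha> (p ^ k) = linear_change \<alpha> p ^ k"
  by (simp_all only: lc_def cc.eval_add cc.eval_mult cc.eval_const cc.eval_X cc.eval_sum cc.eval_power)

lemma lc_smul: "linear_change \<alpha> (smul c p) = smul c (linear_change \<alpha> p)"
  by (simp add: smul_def lc_simps)

text \<open>
  A ring endomorphism that fixes the constants is determined by its values on the variables.
\<close>

lemma lc_eqI:
  assumes "\<And>p q. F (p + q) = F p + F q" "\<And>p q. F (p * q) = F p * F q" "\<And>c. F (const_poly c) = const_poly c"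
    and X: "\<And>v. F (X v) = G v"
  shows "F p = eval_poly const_poly G (p :: ('v::finite, 'a::comm_ring_1) mpoly)"
proof (induction p rule: mpoly_induct)
  case (single m c)
  have F1: "F 1 = 1" using assms(3)[of 1] by (simp add: const_poly_simps)
  have Fpow: "F (p ^ k) = F p ^ k" for p k by (induction k) (simp_all add: F1 assms(2))
  have Fprod: "F (\<Prod>v\<in>A. f v) = (\<Prod>v\<in>A. F (f v))" if "finite A" for A :: "'v set" and f
    using that by (induction A rule: finite_induct) (simp_all add: F1 assms(2))
  have "F (single m c) = const_poly c * mev G m"
    by (simp add: single_eq_mev assms(2,3) mev_def Fprod Fpow X)
  then show ?case by (simp add: cc.eval_single)
qed (simp add: assms(1) cc.eval_add)

lemma lc_comp: "linear_change \<alpha> (linear_change \<beta> p) = linear_change (\<alpha> ** \<beta>) p"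
proof -
  have "linear_change \<alpha> (linear_change \<beta> (X v)) = (\<Sum>i\<in>UNIV. const_poly ((\<alpha> ** \<beta>) $ i $ v) * X i)" for v
  proof -
    have c: "const_poly (sum f A) = (\<Sum>x\<in>A. const_poly (f x))" for f :: "3 \<Rightarrow> 'a" and A
      by (induction A rule: infinite_finite_induct) (simp_all add: const_poly_simps)
    have "linear_change \<alpha> (linear_change \<beta> (X v)) =
        (\<Sum>k\<in>UNIV. \<Sum>i\<in>UNIV. const_poly (\<beta> $ k $ v) * (const_poly (\<alpha> $ i $ k) * X i))"
      by (simp add: lc_simps sum_distrib_left)
    also have "\<dots> = (\<Sum>i\<in>UNIV. \<Sum>k\<in>UNIV. const_poly (\<beta> $ k $ v) * (const_poly (\<alpha> $ i $ k) * X i))"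
      by (rule sum.swap)
    also have "\<dots> = (\<Sum>i\<in>UNIV. const_poly ((\<alpha> ** \<beta>) $ i $ v) * X i)"
    proof (rule sum.cong[OF refl])
      fix i :: 3
      have "(const_poly ((\<alpha> ** \<beta>) $ i $ v) :: 'a poly3) = (\<Sum>k\<in>UNIV. const_poly (\<alpha> $ i $ k) * const_poly (\<beta> $ k $ v))"
        by (simp add: matrix_matrix_mult_def c const_poly_simps)
      moreover have "(\<Sum>k\<in>UNIV. const_poly (\<beta> $ k $ v) * (const_poly (\<alpha> $ i $ k) * X i)) =
          (\<Sum>k\<in>UNIV. const_poly (\<alpha> $ i $ k) * const_poly (\<beta> $ k $ v)) * X i"
        unfolding sum_distrib_right by (rule sum.cong[OF refl]) (simp only: mult.assoc mult.left_commute)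
      ultimately show "(\<Sum>k\<in>UNIV. const_poly (\<beta> $ k $ v) * (const_poly (\<alpha> $ i $ k) * X i)) =
          const_poly ((\<alpha> ** \<beta>) $ i $ v) * X i"
        by simp
    qed
    finally show ?thesis .
  qed
  then show ?thesis
    unfolding lc_def[of "\<alpha> ** \<beta>"] by (intro lc_eqI) (simp_all only: lc_simps)
qed

lemma lc_id: "linear_change (mat 1) p = p"
proof -
  have "X v = (\<Sum>i\<in>UNIV. const_poly ((mat 1 :: 'a^3^3) $ i $ v) * X i :: 'a poly3)" for v
  proof -
    have "(\<Sum>i\<in>UNIV. const_poly ((mat 1 :: 'a^3^3) $ i $ v) * X i :: 'a poly3) = (\<Sum>i\<in>UNIV. if i = v then X v else 0)"
      by (rule sum.cong) (simp_all add: mat_def const_poly_simps)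
    then show ?thesis by simp
  qed
  from lc_eqI[of "\<lambda>p. p", OF refl refl refl this] show ?thesis by (simp add: lc_def)
qed

lemma homogeneous_mev:
  assumes "\<And>v. homogeneous 1 (g v)"
  shows "homogeneous (mon_degree m) (mev g m)"
proof -
  have "homogeneous (\<Sum>v\<in>A. lookup m v) (\<Prod>v\<in>A. g v ^ lookup m v)" if "finite A" for A
    using that
  proof (induction A rule: finite_induct)
    case empty
    show ?case using homogeneous_const[of 1] by (simp add: const_poly_simps)
  next
    case (insert v A)
    then show ?case using homogeneous_mult homogeneous_power[OF assms, of _ v] by fastforce
  qed
  then show ?thesis by (simp add: mev_def mon_degree_def)
qed

lemma homogeneous_lc:
  assumes "homogeneous t p"
  shows "homogeneous t (linear_change \<alpha> p)"
proof -
  have X: "homogeneous 1 (\<Sum>i\<in>UNIV. const_poly (\<alpha> $ i $ v) * X i)" for v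
    using homogeneous_mult[OF homogeneous_const homogeneous_X] by (intro homogeneous_sum) auto
  have "homogeneous t (const_poly (lookup p m) * mev (\<lambda>v. \<Sum>i\<in>UNIV. const_poly (\<alpha> $ i $ v) * X i) m)"
    if "m \<in> keys p" for m
  proof -
    have "mon_degree m = t" using that assms by (simp add: homogeneous_def)
    then show ?thesis
      using homogeneous_mult[OF homogeneous_const homogeneous_mev[where m = m, OF X]] by simp
  qed
  then show ?thesis
    unfolding lc_def cc.eval_superset[OF finite_keys order_refl] by (rule homogeneous_sum)
qed

section \<open>Polynomial functions of a matrix\<close>

text \<open>
  Functions of a matrix that are polynomial in its nine entries.
\<close>

definition polyfun :: "('a::field^3^3 \<Rightarrow> 'a) \<Rightarrow> bool" where
  "polyfun F \<longleftrightarrow> (\<exists>p. \<forall>\<alpha>. F \<alpha> = eval_poly id (\<lambda>(i, j). \<alpha> $ i $ j) p)"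

lemma polyfun_const: "polyfun (\<lambda>\<alpha>. c)"
  unfolding polyfun_def by (rule exI[of _ "const_poly c"]) (simp add: ci.eval_const)

lemma polyfun_entry: "polyfun (\<lambda>\<alpha>. \<alpha> $ i $ j)"
  unfolding polyfun_def by (rule exI[of _ "X (i, j)"]) (simp add: ci.eval_X)

lemma polyfun_add:
  assumes "polyfun F" "polyfun G"
  shows "polyfun (\<lambda>\<alpha>. F \<alpha> + G \<alpha>)"
proof -
  obtain p q where "\<forall>\<alpha>. F \<alpha> = eval_poly id (\<lambda>(i, j). \<alpha> $ i $ j) p" "\<forall>\<alpha>. G \<alpha> = eval_poly id (\<lambda>(i, j). \<alpha> $ i $ j) q"
    using assms by (auto simp: polyfun_def)
  then show ?thesis unfolding polyfun_def by (intro exI[of _ "p + q"]) (simp add: ci.eval_add)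
qed

lemma polyfun_mult:
  assumes "polyfun F" "polyfun G"
  shows "polyfun (\<lambda>\<alpha>. F \<alpha> * G \<alpha>)"
proof -
  obtain p q where "\<forall>\<alpha>. F \<alpha> = eval_poly id (\<lambda>(i, j). \<alpha> $ i $ j) p" "\<forall>\<alpha>. G \<alpha> = eval_poly id (\<lambda>(i, j). \<alpha> $ i $ j) q"
    using assms by (auto simp: polyfun_def)
  then show ?thesis unfolding polyfun_def by (intro exI[of _ "p * q"]) (simp add: ci.eval_mult)
qed

lemma polyfun_diff: "polyfun F \<Longrightarrow> polyfun G \<Longrightarrow> polyfun (\<lambda>\<alpha>. F \<alpha> - G \<alpha>)"
  using polyfun_add[of F "\<lambda>\<alpha>. - 1 * G \<alpha>"] polyfun_mult[OF polyfun_const, of G "- 1"] by simp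

lemma polyfun_prod: "(\<And>x. x \<in> A \<Longrightarrow> polyfun (F x)) \<Longrightarrow> polyfun (\<lambda>\<alpha>. \<Prod>x\<in>A. F x \<alpha>)"
  by (induction A rule: infinite_finite_induct) (simp_all add: polyfun_const polyfun_mult)

text \<open>
  Polynomial-valued functions of a matrix that are finite sums of fixed polynomials weighted by polynomial functions;
  their coefficients are polynomial functions.
\<close>

inductive polymap :: "('a::field^3^3 \<Rightarrow> 'a poly3) \<Rightarrow> bool" where
  zero: "polymap (\<lambda>\<alpha>. 0)"
| step: "polyfun F \<Longrightarrow> polymap G \<Longrightarrow> polymap (\<lambda>\<alpha>. const_poly (F \<alpha>) * q + G \<alpha>)"

lemma polymap_lookup: "polymap G \<Longrightarrow> polyfun (\<lambda>\<alpha>. lookup (G \<alpha>) m)"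
proof (induction rule: polymap.induct)
  case (step F G q)
  then show ?case
    using polyfun_add[OF polyfun_mult[OF step(1) polyfun_const[of "lookup q m"]] step(3)]
    by (simp add: lookup_add lookup_const_mult)
qed (simp add: polyfun_const)

lemma polymap_add: "polymap G \<Longrightarrow> polymap H \<Longrightarrow> polymap (\<lambda>\<alpha>. G \<alpha> + H \<alpha>)"
proof (induction rule: polymap.induct)
  case (step F G q)
  then show ?case using polymap.step[OF step(1) step(3)[OF step(4)], of q] by (simp add: add.assoc)
qed simp

lemma polymap_term_mult: "polymap H \<Longrightarrow> polyfun F \<Longrightarrow> polymap (\<lambda>\<alpha>. const_poly (F \<alpha>) * q * H \<alpha>)"
proof (induction rule: polymap.induct)
  case (step F' G q')
  then show ?case
    using polymap.step[OF polyfun_mult[OF step(4) step(1)] step(3)[OF step(4)], of "q * q'"]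
    by (simp only: const_poly_simps distrib_left mult.assoc mult.left_commute)
qed (simp add: polymap.zero)

lemma polymap_mult: "polymap G \<Longrightarrow> polymap H \<Longrightarrow> polymap (\<lambda>\<alpha>. G \<alpha> * H \<alpha>)"
proof (induction rule: polymap.induct)
  case (step F G q)
  then show ?case
    using polymap_add[OF polymap_term_mult[OF step(4,1), of q] step(3)[OF step(4)]]
    by (simp only: distrib_right)
qed (simp add: polymap.zero)

lemma polymap_term: "polyfun F \<Longrightarrow> polymap (\<lambda>\<alpha>. const_poly (F \<alpha>) * q)"
  using polymap.step[OF _ polymap.zero] by simp

lemma polymap_const: "polymap (\<lambda>\<alpha>. q)"
  using polymap_term[OF polyfun_const[of 1], of q] by (simp add: const_poly_simps)

lemma polymap_sum: "(\<And>x. x \<in> A \<Longrightarrow> polymap (F x)) \<Longrightarrow> polymap (\<lambda>\<alpha>. \<Sum>x\<in>A. F x \<alpha>)"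
  by (induction A rule: infinite_finite_induct) (simp_all add: polymap_const polymap_add)

lemma polymap_prod: "(\<And>x. x \<in> A \<Longrightarrow> polymap (F x)) \<Longrightarrow> polymap (\<lambda>\<alpha>. \<Prod>x\<in>A. F x \<alpha>)"
  by (induction A rule: infinite_finite_induct) (simp_all add: polymap_const polymap_mult)

lemma polymap_power: "polymap F \<Longrightarrow> polymap (\<lambda>\<alpha>. F \<alpha> ^ k)"
  by (induction k) (simp_all add: polymap_const polymap_mult)

lemma polymap_lc: "polymap (\<lambda>\<alpha>. linear_change \<alpha> g)"
proof (induction g rule: mpoly_induct)
  case (single m c)
  have "polymap (\<lambda>\<alpha>. const_poly c * (\<Prod>v\<in>UNIV. (\<Sum>i\<in>UNIV. const_poly (\<alpha> $ i $ v) * X i) ^ lookup m v))"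
    by (intro polymap_mult polymap_const polymap_prod polymap_power polymap_sum polymap_term polyfun_entry)
  then show ?case by (simp add: lc_def cc.eval_single mev_def)
qed (simp add: lc_simps polymap_add)

text \<open>
  The rows \<open>v r \<alpha>\<close>, for \<open>r\<close> in \<open>R\<close>, are vectors with coordinates indexed by \<open>C\<close>, depending polynomially on
  \<open>\<alpha>\<close>. If they span the coordinate space at one matrix, they span it wherever a certain polynomial function does not
  vanish. This is fraction-free Gaussian elimination: a pivot that is nonzero at \<open>\<alpha>\<^sub>0\<close> clears one column, and
  the product of all pivots is the required function.
\<close>

lemma spanning_is_open:
  fixes v :: "'r \<Rightarrow> 'a::field^3^3 \<Rightarrow> 'k \<Rightarrow> 'a"
  assumes "finite C" "finite R" "\<And>r k. polyfun (\<lambda>\<alpha>. v r \<alpha> k)"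
    and "\<And>u. \<exists>c. \<forall>k\<in>C. (\<Sum>r\<in>R. c r * v r \<alpha>0 k) = u k"
  shows "\<exists>q. polyfun q \<and> q \<alpha>0 \<noteq> 0 \<and>
    (\<forall>\<alpha>. q \<alpha> \<noteq> 0 \<longrightarrow> (\<forall>u. \<exists>c. \<forall>k\<in>C. (\<Sum>r\<in>R. c r * v r \<alpha> k) = u k))"
  using assms(1,3,4)
proof (induction C arbitrary: v rule: finite_induct)
  case empty
  show ?case by (intro exI[of _ "\<lambda>_. 1"]) (simp add: polyfun_const)
next
  case (insert k C)
  obtain c where "\<forall>k'\<in>insert k C. (\<Sum>r\<in>R. c r * v r \<alpha>0 k') = (if k' = k then 1 else 0)"
    using insert.prems(2)[of "\<lambda>k'. if k' = k then 1 else 0"] by (rule exE)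
  then have "(\<Sum>r\<in>R. c r * v r \<alpha>0 k) \<noteq> 0" by simp
  then have "\<exists>r0\<in>R. v r0 \<alpha>0 k \<noteq> 0"
    by (rule contrapos_np) simp
  then obtain r0 where r0: "r0 \<in> R" "v r0 \<alpha>0 k \<noteq> 0" by blast
  define w where "w r \<alpha> k' = v r0 \<alpha> k * v r \<alpha> k' - v r \<alpha> k * v r0 \<alpha> k'" for r \<alpha> k'
  have w_sum: "(\<Sum>r\<in>R. c r * w r \<alpha> k') = v r0 \<alpha> k * (\<Sum>r\<in>R. c r * v r \<alpha> k') - (\<Sum>r\<in>R. c r * v r \<alpha> k) * v r0 \<alpha> k'"
    for c \<alpha> k'
    unfolding w_def sum_distrib_left sum_distrib_right sum_subtractf[symmetric]
    by (rule sum.cong[OF refl]) (simp only: right_diff_distrib mult.assoc mult.left_commute)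
  have "\<exists>c. \<forall>k'\<in>C. (\<Sum>r\<in>R. c r * w r \<alpha>0 k') = u k'" for u
  proof -
    obtain c where c: "\<forall>k'\<in>insert k C. (\<Sum>r\<in>R. c r * v r \<alpha>0 k') = (if k' = k then 0 else u k' / v r0 \<alpha>0 k)"
      using insert.prems(2)[of "\<lambda>k'. if k' = k then 0 else u k' / v r0 \<alpha>0 k"] by (rule exE)
    have "(\<Sum>r\<in>R. c r * w r \<alpha>0 k') = u k'" if "k' \<in> C" for k'
      using c that insert.hyps(2) r0(2) unfolding w_sum by auto
    then show ?thesis by blast
  qed
  moreover have "polyfun (\<lambda>\<alpha>. w r \<alpha> k')" for r k'
    unfolding w_def by (intro polyfun_diff polyfun_mult insert.prems(1))
  ultimately obtain q where q: "polyfun q" "q \<alpha>0 \<noteq> 0"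
      "\<And>\<alpha> u. q \<alpha> \<noteq> 0 \<Longrightarrow> \<exists>c. \<forall>k\<in>C. (\<Sum>r\<in>R. c r * w r \<alpha> k) = u k"
    using insert.IH[of w] by blast
  show ?case
  proof (rule exI[of _ "\<lambda>\<alpha>. v r0 \<alpha> k * q \<alpha>"], intro conjI allI impI)
    show "polyfun (\<lambda>\<alpha>. v r0 \<alpha> k * q \<alpha>)" by (intro polyfun_mult insert.prems(1) q)
    show "v r0 \<alpha>0 k * q \<alpha>0 \<noteq> 0" using r0 q by simp
    fix \<alpha> u
    assume nz: "v r0 \<alpha> k * q \<alpha> \<noteq> 0"
    define z where "z = u k / v r0 \<alpha> k"
    obtain c where c: "\<forall>k'\<in>C. (\<Sum>r\<in>R. c r * w r \<alpha> k') = u k' - z * v r0 \<alpha> k'"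
      using q(3)[of \<alpha> "\<lambda>k'. u k' - z * v r0 \<alpha> k'"] nz by auto
    define s where "s = (\<Sum>r\<in>R. c r * v r \<alpha> k)"
    define c' where "c' r = v r0 \<alpha> k * c r + (if r = r0 then z - s else 0)" for r
    have c': "(\<Sum>r\<in>R. c' r * v r \<alpha> k') = (\<Sum>r\<in>R. c r * w r \<alpha> k') + z * v r0 \<alpha> k'" for k'
    proof -
      have "(\<Sum>r\<in>R. c' r * v r \<alpha> k') = v r0 \<alpha> k * (\<Sum>r\<in>R. c r * v r \<alpha> k') + (\<Sum>r\<in>R. (if r = r0 then (z - s) * v r0 \<alpha> k' else 0))"
        unfolding sum_distrib_left sum.distrib[symmetric]
        by (rule sum.cong[OF refl]) (simp add: c'_def distrib_right)
      then show ?thesis using r0(1) assms(2) unfolding w_sum by (simp add: s_def left_diff_distrib)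
    qed
    have "(\<Sum>r\<in>R. c' r * v r \<alpha> k) = u k" using nz unfolding c' w_sum by (simp add: z_def)
    moreover have "(\<Sum>r\<in>R. c' r * v r \<alpha> k') = u k'" if "k' \<in> C" for k' using c that unfolding c' by simp
    ultimately show "\<exists>c. \<forall>k\<in>insert k C. (\<Sum>r\<in>R. c r * v r \<alpha> k) = u k" by blast
  qed
qed

lemma zariski_open_polyfun:
  assumes "polyfun q"
  shows "zariski_open_GL3 {\<alpha>. invertible \<alpha> \<and> q \<alpha> \<noteq> 0}"
proof -
  obtain p where "\<forall>\<alpha>. q \<alpha> = eval_poly id (\<lambda>(i, j). \<alpha> $ i $ j) p" using assms by (auto simp: polyfun_def)
  then show ?thesis unfolding zariski_open_GL3_def by (intro exI[of _ "{p}"]) simp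
qed

lemma eval_on_line:
  fixes p :: "(3 \<times> 3, 'a::field) mpoly"
  shows "\<exists>r. \<forall>z. eval_poly id (\<lambda>(i, j). (\<chi> i j. \<alpha> $ i $ j + z * \<beta> $ i $ j) $ i $ j) p = poly r z"
proof -
  define r where "r = (\<Sum>m\<in>keys p. Polynomial.smult (lookup p m) (\<Prod>(i, j)\<in>UNIV. [:\<alpha> $ i $ j, \<beta> $ i $ j:] ^ lookup m (i, j)))"
  have "eval_poly id (\<lambda>(i, j). (\<chi> i j. \<alpha> $ i $ j + z * \<beta> $ i $ j) $ i $ j) p = poly r z" for z
    unfolding ci.eval_superset[OF finite_keys order_refl] r_def
    by (simp add: poly_sum poly_prod mev_def case_prod_beta poly_power)
  then show ?thesis by blast
qed

lemma det_on_line: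
  fixes \<alpha> \<beta> :: "'a::field^3^3"
  shows "\<exists>r. \<forall>z. det (\<chi> i j. \<alpha> $ i $ j + z * \<beta> $ i $ j) = poly r z"
proof -
  have "\<forall>z. det (\<chi> i j. \<alpha> $ i $ j + z * \<beta> $ i $ j) = poly (det (\<chi> i j. [:\<alpha> $ i $ j, \<beta> $ i $ j:])) z"
    by (simp add: det_def poly_sum poly_prod)
  then show ?thesis by blast
qed

text \<open>
  Restricted to the line through a point of \<open>U\<close> and a point of \<open>V\<close>, the two defining polynomials and the determinant
  become nonzero univariate polynomials, which have a common non-root because the field is infinite.
\<close>

lemma zariski_open_inter:
  fixes U V :: "('a::field_char_0^3^3) set"
  assumes "zariski_open_GL3 U" "zariski_open_GL3 V" "U \<noteq> {}" "V \<noteq> {}"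
  shows "U \<inter> V \<noteq> {}"
proof -
  obtain P Q where P: "U = {\<alpha>. invertible \<alpha> \<and> (\<exists>p\<in>P. eval_poly id (\<lambda>(i, j). \<alpha> $ i $ j) p \<noteq> 0)}"
    and Q: "V = {\<alpha>. invertible \<alpha> \<and> (\<exists>p\<in>Q. eval_poly id (\<lambda>(i, j). \<alpha> $ i $ j) p \<noteq> 0)}"
    using assms(1,2) unfolding zariski_open_GL3_def by blast
  obtain \<alpha> \<beta> p q where a: "invertible \<alpha>" "p \<in> P" "eval_poly id (\<lambda>(i, j). \<alpha> $ i $ j) p \<noteq> 0"
    and b: "invertible \<beta>" "q \<in> Q" "eval_poly id (\<lambda>(i, j). \<beta> $ i $ j) q \<noteq> 0"
    using assms(3,4) P Q by blast
  define \<gamma> where "\<gamma> = (\<lambda>z. \<chi> i j. \<alpha> $ i $ j + z * (\<beta> - \<alpha>) $ i $ j)"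
  have \<gamma>: "\<gamma> 0 = \<alpha>" "\<gamma> 1 = \<beta>" by (simp_all add: \<gamma>_def vec_eq_iff)
  obtain r1 where r1: "\<And>z. eval_poly id (\<lambda>(i, j). \<gamma> z $ i $ j) p = poly r1 z"
    using eval_on_line[of \<alpha> "\<beta> - \<alpha>" p] unfolding \<gamma>_def by blast
  obtain r2 where r2: "\<And>z. eval_poly id (\<lambda>(i, j). \<gamma> z $ i $ j) q = poly r2 z"
    using eval_on_line[of \<alpha> "\<beta> - \<alpha>" q] unfolding \<gamma>_def by blast
  obtain r3 where r3: "\<And>z. det (\<gamma> z) = poly r3 z"
    using det_on_line[of \<alpha> "\<beta> - \<alpha>"] unfolding \<gamma>_def by blast
  have "poly r1 0 \<noteq> 0" "poly r2 1 \<noteq> 0" "poly r3 0 \<noteq> 0"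
    using r1[of 0] r2[of 1] r3[of 0] a b \<gamma> by (simp_all add: invertible_det_nz)
  then have "r1 * r2 * r3 \<noteq> 0" by auto
  then have "finite {z. poly (r1 * r2 * r3) z = 0}" by (rule poly_roots_finite)
  then obtain z where "poly (r1 * r2 * r3) z \<noteq> 0"
    using ex_new_if_finite[OF infinite_UNIV_char_0] by blast
  then have "poly r1 z \<noteq> 0" "poly r2 z \<noteq> 0" "poly r3 z \<noteq> 0" by auto
  then have "invertible (\<gamma> z)" "eval_poly id (\<lambda>(i, j). \<gamma> z $ i $ j) p \<noteq> 0"
    "eval_poly id (\<lambda>(i, j). \<gamma> z $ i $ j) q \<noteq> 0"
    using r1[of z] r2[of z] r3[of z] by (simp_all add: invertible_det_nz)
  then have "\<gamma> z \<in> U \<inter> V" using a(2) b(2) unfolding P Q by blast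
  then show ?thesis by blast
qed

lemma Gin_eqI:
  fixes I :: "'a::field_char_0 poly3 set"
  assumes "zariski_open_GL3 U" "U \<noteq> {}" "\<And>\<alpha>. \<alpha> \<in> U \<Longrightarrow> initial_ideal (linear_change \<alpha> ` I) = J"
  shows "Gin I = J"
  unfolding Gin_def
proof (rule the_equality)
  show "\<exists>U. zariski_open_GL3 U \<and> U \<noteq> {} \<and> (\<forall>\<alpha>\<in>U. initial_ideal (linear_change \<alpha> ` I) = J)"
    using assms by blast
  fix J'
  assume "\<exists>U. zariski_open_GL3 U \<and> U \<noteq> {} \<and> (\<forall>\<alpha>\<in>U. initial_ideal (linear_change \<alpha> ` I) = J')"
  then obtain U' where "zariski_open_GL3 U'" "U' \<noteq> {}" "\<And>\<alpha>. \<alpha> \<in> U' \<Longrightarrow> initial_ideal (linear_change \<alpha> ` I) = J'"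
    by blast
  then show "J' = J" using zariski_open_inter[OF assms(1) _ assms(2), of U'] assms(3) by fastforce
qed


section \<open>General powers of linear forms span\<close>

lemma smul_mult_distrib: "smul (a * b) (p * q) = smul a p * smul b q"
  by (simp only: smul_def const_poly_simps mult.assoc mult.left_commute)

lemma smul_power: "smul a p ^ k = smul (a ^ k) (p ^ k)"
proof (induction k)
  case 0
  show ?case by (simp add: smul_def const_poly_simps)
qed (simp add: smul_mult_distrib)

lemma binomial_smul:
  fixes x y :: "('v, 'a::field) mpoly"
  shows "(y + smul z x) ^ t = (\<Sum>k\<le>t. smul (of_nat (t choose k) * z ^ k) (y ^ (t - k) * x ^ k))"
proof -
  have of_nat: "of_nat n * q = smul (of_nat n) q" for n and q :: "('v, 'a) mpoly"
    by (simp add: smul_def const_poly_def)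
  have "(smul z x + y) ^ t = (\<Sum>k\<le>t. of_nat (t choose k) * smul z x ^ k * y ^ (t - k))"
    by (rule binomial_ring)
  also have "\<dots> = (\<Sum>k\<le>t. smul (of_nat (t choose k) * z ^ k) (y ^ (t - k) * x ^ k))"
    by (rule sum.cong[OF refl])
      (simp only: of_nat smul_power, simp only: smul_def const_poly_simps mult.assoc mult.left_commute mult.commute)
  finally show ?thesis by (simp add: add.commute)
qed

text \<open>
  Let \<open>V\<close> be the quotient of the span of \<open>W\<close> and \<open>S'\<close> by \<open>W\<close>; its dimension is at most \<open>h\<close>, and the
  powers \<open>(y\<^sub>0 + s x\<^sub>0)\<^sup>t\<close> trace a curve in it. The polynomials \<open>(y\<^sub>0 + s x\<^sub>0)\<^bsup>t-a\<^esup> x\<^sub>0\<^sup>a\<close> are, up to nonzero factors, its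
  derivatives at \<open>s\<close>, and for general \<open>s\<close> those of order less than \<open>h\<close> already span. Otherwise some nonzero
  functional on \<open>V\<close>, applied to the curve, would give a polynomial in \<open>s\<close> with a zero of order \<open>h\<close>;
  such polynomials form a space spanned by at most \<open>h\<close> elements, so \<open>wronskian\<close> applies.
\<close>

lemma osculating_span:
  fixes x0 y0 :: "('v, 'a::field_char_0) mpoly"
  assumes D: "finite D" "card D \<le> h" "S' \<subseteq> vs.span (W \<union> D)" and W: "vs.subspace W"
    and mem: "\<And>i. i \<le> t \<Longrightarrow> y0 ^ (t - i) * x0 ^ i \<in> S'"
    and gen: "S' \<subseteq> vs.span (W \<union> {y0 ^ (t - i) * x0 ^ i | i. i \<le> t})"
  shows "\<exists>E. finite E \<and> (\<forall>s. s \<notin> E \<longrightarrow>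
    S' \<subseteq> vs.span (W \<union> {(y0 + smul s x0) ^ (t - a) * x0 ^ a | a. a < h \<and> a \<le> t}))"
proof -
  define e where "e i = y0 ^ (t - i) * x0 ^ i" for i
  have "\<exists>k. e i - (\<Sum>\<delta>\<in>D. smul (k \<delta>) \<delta>) \<in> W" if i: "i \<le> t" for i
  proof -
    have "e i \<in> vs.span (W \<union> D)" using mem[OF i] D(3) by (auto simp: e_def)
    moreover have "vs.span W = W" using W by simp
    ultimately obtain w z where wz: "e i = w + z" "w \<in> W" "z \<in> vs.span D"
      unfolding vs.span_Un by blast
    then obtain k where "z = (\<Sum>\<delta>\<in>D. smul (k \<delta>) \<delta>)" using vs.span_finite[OF D(1)] by auto
    then show ?thesis using wz by (intro exI[of _ k]) simp
  qed
  then obtain k where k: "\<And>i. i \<le> t \<Longrightarrow> e i - (\<Sum>\<delta>\<in>D. smul (k i \<delta>) \<delta>) \<in> W" by metis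
  define pd where "pd \<delta> = (\<Sum>i\<le>t. Polynomial.monom (of_nat (t choose i) * k i \<delta>) i)" for \<delta>
  obtain E where E: "finite E" "\<And>s c. s \<notin> E \<Longrightarrow> [:-s, 1:] ^ card D dvd (\<Sum>\<delta>\<in>D. Polynomial.smult (c \<delta>) (pd \<delta>))
            \<Longrightarrow> (\<Sum>\<delta>\<in>D. Polynomial.smult (c \<delta>) (pd \<delta>)) = 0"
    using wronskian[OF D(1), of pd] by blast
  have "p \<in> vs.span (W \<union> {(y0 + smul s x0) ^ (t - a) * x0 ^ a | a. a < h \<and> a \<le> t})"
    if s: "s \<notin> E" and p: "p \<in> S'" for s p
  proof (rule ccontr)
    define y where "y = y0 + smul s x0"
    assume "p \<notin> vs.span (W \<union> {(y0 + smul s x0) ^ (t - a) * x0 ^ a | a. a < h \<and> a \<le> t})"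
    then obtain \<phi> where \<phi>: "\<And>x y. \<phi> (x + y) = \<phi> x + \<phi> y" "\<And>c x. \<phi> (smul c x) = c * \<phi> x"
        "\<And>u. u \<in> vs.span (W \<union> {(y0 + smul s x0) ^ (t - a) * x0 ^ a | a. a < h \<and> a \<le> t}) \<Longrightarrow> \<phi> u = 0" "\<phi> p = 1"
      by (rule vs.separating_functional) (rule that; assumption)
    have \<phi>0: "\<phi> 0 = 0" using \<phi>(2)[of 0 0] by simp
    have \<phi>_sum: "\<phi> (\<Sum>x\<in>A. f x) = (\<Sum>x\<in>A. \<phi> (f x))" for f and A :: "nat set"
      by (induction A rule: infinite_finite_induct) (simp_all add: \<phi>0 \<phi>(1))
    have \<phi>_sumD: "\<phi> (\<Sum>x\<in>A. f x) = (\<Sum>x\<in>A. \<phi> (f x))" for f and A :: "('v, 'a) mpoly set"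
      by (induction A rule: infinite_finite_induct) (simp_all add: \<phi>0 \<phi>(1))
    have \<phi>W: "\<phi> w = 0" if "w \<in> W" for w using that by (intro \<phi>(3) vs.span_base) simp
    have \<phi>y: "\<phi> (y ^ (t - a) * x0 ^ a) = 0" if "a < h" "a \<le> t" for a
      using that by (intro \<phi>(3) vs.span_base) (auto simp: y_def)
    have \<phi>e: "\<phi> (e i) = (\<Sum>\<delta>\<in>D. k i \<delta> * \<phi> \<delta>)" if "i \<le> t" for i
    proof -
      have "\<phi> (e i) = \<phi> (e i - (\<Sum>\<delta>\<in>D. smul (k i \<delta>) \<delta>)) + \<phi> (\<Sum>\<delta>\<in>D. smul (k i \<delta>) \<delta>)"
        unfolding \<phi>(1)[symmetric] by simp
      then show ?thesis using \<phi>W[OF k[OF that]] by (simp add: \<phi>_sumD \<phi>(2))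
    qed
    have smult_sum2: "Polynomial.smult c (\<Sum>i\<le>t. f i) = (\<Sum>i\<le>t. Polynomial.smult c (f i))" for c :: 'a and f
      by (induction t) (simp_all add: smult_add_right)
    \<comment> \<open>the functional applied to the curve, and its Taylor expansion \<open>Q\<close> at \<open>s\<close>\<close>
    define P where "P = (\<Sum>\<delta>\<in>D. Polynomial.smult (\<phi> \<delta>) (pd \<delta>))"
    have P: "P = (\<Sum>i\<le>t. Polynomial.monom (of_nat (t choose i) * \<phi> (e i)) i)"
    proof -
      have "P = (\<Sum>i\<le>t. \<Sum>\<delta>\<in>D. Polynomial.monom (of_nat (t choose i) * (k i \<delta> * \<phi> \<delta>)) i)"
        unfolding P_def pd_def smult_sum2 smult_monom
        by (subst sum.swap) (simp only: mult.assoc mult.left_commute mult.commute)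
      also have "\<dots> = (\<Sum>i\<le>t. Polynomial.monom (of_nat (t choose i) * \<phi> (e i)) i)"
        by (rule sum.cong) (simp_all add: \<phi>e sum_distrib_left monom_sum)
      finally show ?thesis .
    qed
    define Q where "Q = (\<Sum>a\<le>t. Polynomial.smult (of_nat (t choose a) * \<phi> (y ^ (t - a) * x0 ^ a)) ([:-s, 1:] ^ a))"
    have "P = Q"
    proof -
      have "poly P z = poly Q z" for z
      proof -
        have lin: "poly [:-s, 1:] z = z - s" by simp
        have "poly P z = \<phi> ((y0 + smul z x0) ^ t)"
          unfolding binomial_smul \<phi>_sum \<phi>(2) P
          by (simp only: poly_sum poly_monom e_def mult.assoc mult.commute[of "\<phi> _"])
        also have "y0 + smul z x0 = y + smul (z - s) x0"
          by (simp add: y_def smul_def const_poly_def single_diff left_diff_distrib)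
        also have "\<phi> ((y + smul (z - s) x0) ^ t) = poly Q z"
          unfolding binomial_smul \<phi>_sum \<phi>(2) Q_def
          by (simp only: poly_sum poly_smult poly_power lin mult.assoc mult.commute[of "\<phi> _"])
        finally show ?thesis .
      qed
      then show ?thesis using poly_eq_poly_eq_iff[of P Q] by auto
    qed
    have "[:-s, 1:] ^ h dvd Q"
      unfolding Q_def
    proof (rule dvd_sum)
      fix a assume "a \<in> {..t}"
      then show "[:-s, 1:] ^ h dvd Polynomial.smult (of_nat (t choose a) * \<phi> (y ^ (t - a) * x0 ^ a)) ([:-s, 1:] ^ a)"
        by (cases "a < h") (simp_all add: \<phi>y dvd_smult le_imp_power_dvd)
    qed
    then have "[:-s, 1:] ^ card D dvd P" using \<open>P = Q\<close> D(2) power_le_dvd by blast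
    then have "P = 0" using E(2)[OF s] unfolding P_def by blast
    have "\<phi> (e i) = 0" if "i \<le> t" for i
    proof -
      have "Polynomial.coeff P i = of_nat (t choose i) * \<phi> (e i)"
        using that by (simp add: P coeff_sum)
      then show ?thesis using \<open>P = 0\<close> that by simp
    qed
    then have "W \<union> {y0 ^ (t - i) * x0 ^ i | i. i \<le> t} \<subseteq> {u. \<phi> u = 0}"
      using \<phi>W by (auto simp: e_def)
    moreover have "vs.subspace {u. \<phi> u = 0}" by (simp add: vs.subspace_def \<phi> \<phi>0)
    ultimately have "vs.span (W \<union> {y0 ^ (t - i) * x0 ^ i | i. i \<le> t}) \<subseteq> {u. \<phi> u = 0}"
      by (rule vs.span_minimal)
    then show False using gen p \<phi>(4) by auto
  qed
  then show ?thesis using E(1) by blast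
qed

section \<open>The strong Lefschetz property and dimensions\<close>

text \<open>
  The subspace \<open>I\<^bsub>s+r\<^esub> + q S\<^bsub>s\<^esub>\<close> of \<open>S\<^bsub>s+r\<^esub>\<close>, for \<open>q\<close> homogeneous of degree \<open>r\<close>.
\<close>

definition mult_image :: "'a::field poly3 set \<Rightarrow> 'a poly3 \<Rightarrow> nat \<Rightarrow> nat \<Rightarrow> 'a poly3 set" where
  "mult_image I q s r = {w + q * v | w v. w \<in> I \<inter> dspace (s + r) \<and> v \<in> dspace s}"

lemma mult_image_subspace:
  assumes "rng.subspace I"
  shows "vs.subspace (mult_image I q s r)"
proof -
  have sub: "vs.subspace ((\<lambda>v. q * v) ` dspace s)"
  proof -
    have "vs.subspace (dspace s :: 'a poly3 set)" by (rule subspace_dspace)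
    then show ?thesis
      unfolding vs.subspace_def
      by (auto simp: image_iff distrib_left[symmetric] smul_def mult.left_commute[of _ q])
  qed
  have "mult_image I q s r = {x + y | x y. x \<in> I \<inter> dspace (s + r) \<and> y \<in> (\<lambda>v. q * v) ` dspace s}"
    by (auto simp: mult_image_def)
  then show ?thesis
    using vs.subspace_sums[OF vs.subspace_inter[OF ideal_imp_subspace[OF assms] subspace_dspace[of "s + r"]] sub] by simp
qed

lemma mult_image_le:
  assumes "homogeneous r q"
  shows "mult_image I q s r \<subseteq> dspace (s + r)"
  using homogeneous_mult[OF assms] by (auto simp: mult_image_def dspace_def add.commute[of s] intro!: homogeneous_add)

lemma coset_eq_iff:
  fixes I :: "'a::comm_ring_1 set"
  assumes "rng.subspace I"
  shows "f +o I = g +o I \<longleftrightarrow> f - g \<in> I"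
proof
  assume "f +o I = g +o I"
  moreover have "f \<in> f +o I" using rng.subspace_0[OF assms] by (auto simp: elt_set_plus_def)
  ultimately show "f - g \<in> I" by (auto simp: elt_set_plus_def)
next
  assume fg: "f - g \<in> I"
  have le: "a +o I \<subseteq> b +o I" if "a - b \<in> I" for a b
  proof
    fix x assume "x \<in> a +o I"
    then obtain i where "x = a + i" "i \<in> I" by (auto simp: elt_set_plus_def)
    then have "x = b + ((a - b) + i)" "(a - b) + i \<in> I"
      using that rng.subspace_add[OF assms] by auto
    then show "x \<in> b +o I" unfolding elt_set_plus_def by blast
  qed
  show "f +o I = g +o I" using le[OF fg] le[of g f] fg rng.subspace_neg[OF assms fg] by auto
qed

lemma quot_mult_coset:
  fixes I :: "'a::comm_ring_1 set"
  assumes "rng.subspace I"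
  shows "quot_mult I p (f +o I) = (p * f) +o I"
proof (intro equalityI subsetI)
  fix x assume "x \<in> quot_mult I p (f +o I)"
  then obtain i j where "x = p * (f + i) + j" "i \<in> I" "j \<in> I"
    by (auto simp: quot_mult_def elt_set_plus_def elt_set_times_def set_plus_def)
  then have "x = p * f + (p * i + j)" "p * i + j \<in> I"
    using rng.subspace_add[OF assms rng.subspace_scale[OF assms]] by (auto simp: distrib_left add.assoc)
  then show "x \<in> (p * f) +o I" unfolding elt_set_plus_def by blast
next
  fix x assume "x \<in> (p * f) +o I"
  then obtain j where "x = p * (f + 0) + j" "j \<in> I" by (auto simp: elt_set_plus_def)
  moreover have "0 \<in> I" using rng.subspace_0[OF assms] .
  ultimately show "x \<in> quot_mult I p (f +o I)"
    unfolding quot_mult_def elt_set_plus_def elt_set_times_def set_plus_def by blast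
qed

text \<open>
  A map of maximal rank from \<open>(S/I)\<^bsub>s\<^esub>\<close> to \<open>(S/I)\<^bsub>s+r\<^esub>\<close> has a cokernel of the smallest possible
  dimension; only the upper bound is needed.
\<close>

lemma mult_image_codim:
  fixes I :: "'a::field poly3 set" and q :: "'a poly3"
  assumes I: "rng.subspace I" and q: "homogeneous r q"
    and inj_or_surj: "inj_on (quot_mult I q) (quot_graded I s) \<or>
      quot_mult I q ` quot_graded I s = quot_graded I (s + r)"
  shows "int (vs.dim (dspace (s + r) :: 'a poly3 set)) - int (vs.dim (mult_image I q s r))
    \<le> max 0 (hilb I (int (s + r)) - hilb I (int s))"
  using inj_or_surj
proof
  assume inj: "inj_on (quot_mult I q) (quot_graded I s)"
  have "{v \<in> dspace s. q * v \<in> I} = I \<inter> dspace s"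
  proof (intro equalityI subsetI)
    fix v assume v: "v \<in> {v \<in> dspace s. q * v \<in> I}"
    then have "quot_mult I q (v +o I) = quot_mult I q (0 +o I)"
      unfolding quot_mult_coset[OF I] coset_eq_iff[OF I] by simp
    moreover have "v +o I \<in> quot_graded I s" "0 +o I \<in> quot_graded I s"
      using v homogeneous_0 unfolding quot_graded_def dspace_def by blast+
    ultimately have "v +o I = 0 +o I" using inj by (auto dest: inj_onD)
    then show "v \<in> I \<inter> dspace s" using v unfolding coset_eq_iff[OF I] by simp
  qed (use rng.subspace_scale[OF I] in auto)
  then have "vs.dim (mult_image I q s r) + vs.dim (I \<inter> dspace s)
      = vs.dim (I \<inter> dspace (s + r)) + vs.dim (dspace s :: 'a poly3 set)"
    using dim_ideal_plus_multiples[OF I q, of s] unfolding mult_image_def by simp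
  then show ?thesis unfolding hilb_nat by linarith
next
  assume surj: "quot_mult I q ` quot_graded I s = quot_graded I (s + r)"
  have "dspace (s + r) \<subseteq> mult_image I q s r"
  proof
    fix p :: "'a poly3" assume p: "p \<in> dspace (s + r)"
    then have "p +o I \<in> quot_mult I q ` quot_graded I s"
      unfolding surj by (auto simp: quot_graded_def dspace_def)
    then obtain f where f: "homogeneous s f" "p +o I = (q * f) +o I"
      unfolding quot_graded_def by (auto simp: quot_mult_coset[OF I])
    have "p - q * f \<in> I" using f(2) unfolding coset_eq_iff[OF I] .
    moreover have "vs.subspace (dspace (s + r) :: 'a poly3 set)" by (rule subspace_dspace)
    then have "p - q * f \<in> dspace (s + r)"
      using p homogeneous_mult[OF q f(1)] by (intro vs.subspace_diff) (simp_all add: dspace_def add.commute)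
    ultimately have "p - q * f \<in> I \<inter> dspace (s + r)" "p = (p - q * f) + q * f" "f \<in> dspace s"
      using f by (auto simp: dspace_def)
    then show "p \<in> mult_image I q s r" unfolding mult_image_def by blast
  qed
  then have "mult_image I q s r = dspace (s + r)" using mult_image_le[OF q] by blast
  then show ?thesis by simp
qed

lemma hilb_nonneg: "0 \<le> hilb (I :: 'a::field poly3 set) t"
proof -
  have "vs.dim (I \<inter> dspace n) \<le> vs.dim (dspace n :: 'a poly3 set)" for n
  proof -
    obtain B :: "'a poly3 set" where B: "B \<subseteq> dspace n" "vs.independent B" "dspace n \<subseteq> vs.span B"
        "card B = vs.dim (dspace n :: 'a poly3 set)"
      by (rule vs.basis_exists) (rule that; assumption)
    moreover have "finite B"
      using vs.independent_span_bound[OF finite_dbasis B(2)] B(1) dspace_span[of n] by blast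
    ultimately show ?thesis using vs.dim_le_card[of "I \<inter> dspace n" B] by auto
  qed
  then show ?thesis by (simp add: hilb_def)
qed


section \<open>The Hilbert function of the complete intersection\<close>

text \<open>
  Twice the Hilbert function of \<open>S\<close>.
\<close>

definition hilb_S2 :: "int \<Rightarrow> int" where
  "hilb_S2 t = (if t < 0 then 0 else (t + 1) * (t + 2))"

lemma hilb_S2_ge: "- 2 \<le> t \<Longrightarrow> hilb_S2 t = (t + 1) * (t + 2)"
proof -
  assume "- 2 \<le> t"
  then consider "t = - 2" | "t = - 1" | "0 \<le> t" by linarith
  then show ?thesis by cases (auto simp: hilb_S2_def)
qed

lemma hilb_S2_diff: "hilb_S2 t - hilb_S2 (t - 1) = 2 * max 0 (t + 1)"
proof -
  consider "t < 0" | "t = 0" | "1 \<le> t" by linarith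
  then show ?thesis by cases (auto simp: hilb_S2_def algebra_simps)
qed

text \<open>
  Homogeneous ideals with the Hilbert function of a complete intersection of degrees \<open>p < d = d\<close>.
\<close>

locale ci_ideal =
  fixes I :: "'a::field_char_0 poly3 set" and p d :: nat
  assumes p2: "2 \<le> p" and pd: "p < d" and graded: "graded_ideal I"
    and hilb_I: "2 * hilb I t = hilb_S2 t - hilb_S2 (t - int p) - 2 * hilb_S2 (t - int d)
      + 2 * hilb_S2 (t - int p - int d) + hilb_S2 (t - 2 * int d) - hilb_S2 (t - int p - 2 * int d)"
begin

lemma ideal: "rng.subspace I" using graded by (simp add: graded_ideal_def)

text \<open>
  In the lower half of the degrees this is the first difference of the Hilbert function. The truncated subtraction is
  exact there; beyond it the last entry is zero.
\<close>

definition G :: "nat \<Rightarrow> nat" where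
  "G t = min (t + 1) (min p (p + 2 * d - 2 - 2 * t))"

text \<open>
  The largest degree in which the Hilbert function is nonzero.
\<close>

definition e :: nat where "e = p + 2 * d - 3"

lemma int_e: "int e = int p + 2 * int d - 3"
  using p2 pd by (simp add: e_def)

lemma hilb_neg: "t < 0 \<Longrightarrow> hilb I t = 0"
  by (simp add: hilb_def)

lemma hilb_large:
  assumes "int e < t"
  shows "hilb I t = 0"
proof -
  have "2 * hilb I t = 0"
  proof -
    have t: "t \<ge> int p + 2 * int d - 2" using assms int_e by simp
    show ?thesis
      unfolding hilb_I using t p2 pd
      by (subst (1 2 3 4 5 6) hilb_S2_ge, simp_all, algebra)
  qed
  then show ?thesis by simp
qed

text \<open>
  The Hilbert function of \<open>K[x\<^sub>1, x\<^sub>2]/(f)\<close> for a nonzero form \<open>f\<close> of degree \<open>p\<close>.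
\<close>

definition m :: "int \<Rightarrow> int" where "m t = max 0 (t + 1) - max 0 (t + 1 - int p)"

lemma hilb_diff: "hilb I t - hilb I (t - 1) = m t - 2 * m (t - int d) + m (t - 2 * int d)"
proof -
  have "2 * (hilb I t - hilb I (t - 1)) = 2 * hilb I t - 2 * hilb I (t - 1)" by simp
  also have "\<dots> = 2 * (m t - 2 * m (t - int d) + m (t - 2 * int d))"
    using hilb_S2_diff[of t] hilb_S2_diff[of "t - int p"] hilb_S2_diff[of "t - int d"]
      hilb_S2_diff[of "t - int p - int d"] hilb_S2_diff[of "t - 2 * int d"]
      hilb_S2_diff[of "t - int p - 2 * int d"]
    unfolding hilb_I m_def by (simp add: algebra_simps)
  finally show ?thesis by simp
qed

lemma hilb_diff_antisym:
  "hilb I (int e + 1 - t) - hilb I (int e - t) = - (hilb I t - hilb I (t - 1))"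
proof -
  have mx: "max 0 x - max 0 (- x) = x" for x :: int by simp
  have "hilb I (int e + 1 - t) - hilb I (int e - t) = m (int e + 1 - t)
      - 2 * m (int e + 1 - t - int d) + m (int e + 1 - t - 2 * int d)"
    using hilb_diff[of "int e + 1 - t"] by simp
  then show ?thesis
    using mx[of "t + 1"] mx[of "t + 1 - int p"] mx[of "t - int d + 1"] mx[of "t - int d + 1 - int p"]
      mx[of "t - 2 * int d + 1"] mx[of "t - 2 * int d + 1 - int p"]
    unfolding hilb_diff m_def int_e by (simp add: algebra_simps)
qed

text \<open>
  The difference of both sides is independent of \<open>t\<close> by the antisymmetry of the first difference, and it vanishes at
  \<open>t = - 1\<close>.
\<close>

lemma hilb_sym: "hilb I (int e - t) = hilb I t"
proof -
  define K where "K t = hilb I t - hilb I (int e - t)" for t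
  have step: "K t = K (t - 1)" for t
    using hilb_diff_antisym[of t] by (simp add: K_def algebra_simps)
  have "K (int n) = 0" for n
  proof (induction n)
    case 0
    have "K (- 1) = 0" by (simp add: K_def hilb_neg hilb_large)
    then show ?case using step[of 0] by simp
  qed (use step[of "int (Suc _)"] in simp)
  moreover have "K t = 0" if "t < 0" using that by (simp add: K_def hilb_neg hilb_large)
  ultimately have "K t = 0" by (metis int_nat_eq not_less)
  then show ?thesis by (simp add: K_def)
qed

lemma hilb_diff_G:
  assumes "2 * t \<le> e"
  shows "hilb I (int t) - hilb I (int t - 1) = int (G t)"
proof -
  have t: "2 * int t \<le> int p + 2 * int d - 3" using assms int_e by simp
  have G: "int (G t) = min (int t + 1) (min (int p) (int p + 2 * int d - 2 - 2 * int t))"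
    using t p2 pd unfolding G_def by (simp add: of_nat_diff)
  moreover have "m (int t) = min (int t + 1) (int p)" by (simp add: m_def min_def max_def)
  moreover have "m (int t - int d) = max 0 (int t - int d + 1)" using t p2 pd by (simp add: m_def)
  moreover have "m (int t - 2 * int d) = 0" using t p2 pd by (simp add: m_def)
  ultimately have "hilb I (int t) - hilb I (int t - 1)
      = min (int t + 1) (int p) - 2 * max 0 (int t - int d + 1)"
    unfolding hilb_diff by simp
  also have "\<dots> = min (int t + 1) (min (int p) (int p + 2 * int d - 2 - 2 * int t))"
    using t pd by (cases "t < d") (simp_all add: min_def max_def)
  finally show ?thesis using G by simp
qed

lemma hilb_sum_half:
  assumes "2 * t \<le> e"
  shows "hilb I (int t) = (\<Sum>i\<le>t. int (G i))"
  using assms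
proof (induction t)
  case 0
  then show ?case using hilb_diff_G[of 0] by (simp add: hilb_neg)
next
  case (Suc t)
  then show ?case using hilb_diff_G[of "Suc t"] by simp
qed

lemma hilb_sum:
  assumes "t \<le> e"
  shows "hilb I (int t) = (\<Sum>i\<le>min t (e - t). int (G i))"
proof (cases "t \<le> e - t")
  case True
  then show ?thesis using hilb_sum_half[of t] by (simp add: min_def)
next
  case False
  then have "hilb I (int (e - t)) = (\<Sum>i\<le>e - t. int (G i))" by (intro hilb_sum_half) simp
  then show ?thesis using False assms hilb_sym[of "int t"] by (simp add: min_def of_nat_diff)
qed

lemma hilb_mono:
  assumes "s < T" "e \<le> s + T"
  shows "hilb I (int T) \<le> hilb I (int s)"
proof (cases "T \<le> e")
  case True
  have "(\<Sum>i\<le>min T (e - T). int (G i)) \<le> (\<Sum>i\<le>min s (e - s). int (G i))"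
    using assms by (intro sum_mono2) auto
  then show ?thesis using hilb_sum[of T] hilb_sum[of s] True assms by simp
qed (use hilb_large[of "int T"] hilb_nonneg[of I "int s"] in simp)

end

section \<open>Coordinates adapted to a strong Lefschetz element\<close>

text \<open>
  Modulo the ideal \<open>\<alpha> I\<close>, every monomial of degree \<open>T\<close> is congruent to a combination of monomials with exponents
  in \<open>M\<close>.
\<close>

definition reduces_into :: "'a::field poly3 set \<Rightarrow> 'a^3^3 \<Rightarrow> nat \<Rightarrow> (3 \<Rightarrow>\<^sub>0 nat) set \<Rightarrow> bool" where
  "reduces_into I \<alpha> T M \<longleftrightarrow> (\<forall>n. mon_degree n = T \<longrightarrow>
     (\<exists>f\<in>I. homogeneous T f \<and> keys (single n 1 - linear_change \<alpha> f) \<subseteq> M))"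

lemma subspace_keys: "vs.subspace {z :: ('v, 'a::field) mpoly. keys z \<subseteq> M}"
  unfolding vs.subspace_def
proof (intro conjI ballI allI)
  fix x y :: "('v, 'a) mpoly" assume "x \<in> {z. keys z \<subseteq> M}" "y \<in> {z. keys z \<subseteq> M}"
  then show "x + y \<in> {z. keys z \<subseteq> M}" using keys_add[of x y] by auto
next
  fix c and x :: "('v, 'a) mpoly" assume "x \<in> {z. keys z \<subseteq> M}"
  then show "smul c x \<in> {z. keys z \<subseteq> M}" by (auto simp: in_keys_iff lookup_smul)
qed simp

lemma lc_0: "linear_change \<alpha> 0 = 0"
  using lc_simps(5)[of \<alpha> "\<lambda>_. 0" "{}"] by simp

text \<open>
  The condition says that elements of \<open>\<alpha> I\<^sub>T\<close>, projected to the coordinates outside \<open>M\<close>, span. At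
  \<open>\<alpha>\<^sub>0\<close> the elements chosen below project to the unit vectors.
\<close>

lemma reduces_into_open:
  fixes I :: "'a::field poly3 set"
  assumes I: "rng.subspace I" and reduces_into: "reduces_into I \<alpha>0 T M"
  shows "\<exists>q. polyfun q \<and> q \<alpha>0 \<noteq> 0 \<and> (\<forall>\<alpha>. q \<alpha> \<noteq> 0 \<longrightarrow> reduces_into I \<alpha> T M)"
proof -
  define C where "C = {n :: 3 \<Rightarrow>\<^sub>0 nat. mon_degree n = T} - M"
  have fin: "finite C" using finite_exponents by (simp add: C_def)
  obtain F where F: "\<And>n. mon_degree n = T \<Longrightarrow>
      F n \<in> I \<and> homogeneous T (F n) \<and> keys (single n 1 - linear_change \<alpha>0 (F n)) \<subseteq> M"
    using reduces_into unfolding reduces_into_def by metis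
  define v where "v r \<alpha> k = lookup (linear_change \<alpha> (F r)) k" for r and \<alpha> :: "'a^3^3" and k
  have v0: "v r \<alpha>0 k = (if k = r then 1 else 0)" if "r \<in> C" "k \<in> C" for r k
  proof -
    have "k \<notin> keys (single r 1 - linear_change \<alpha>0 (F r))" using F[of r] that by (auto simp: C_def)
    then have "lookup (single r 1) k - v r \<alpha>0 k = 0" by (simp add: in_keys_iff lookup_minus v_def)
    then show ?thesis by (auto simp: lookup_single when_def)
  qed
  have span0: "\<exists>c. \<forall>k\<in>C. (\<Sum>r\<in>C. c r * v r \<alpha>0 k) = u k" for u
  proof -
    have "(\<Sum>r\<in>C. u r * v r \<alpha>0 k) = u k" if "k \<in> C" for k
    proof -
      have "(\<Sum>r\<in>C. u r * v r \<alpha>0 k) = (\<Sum>r\<in>C. if k = r then u r else 0)"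
        using that by (intro sum.cong) (simp_all add: v0)
      then show ?thesis using fin that by simp
    qed
    then show ?thesis by blast
  qed
  have "polyfun (\<lambda>\<alpha>. v r \<alpha> k)" for r k
    unfolding v_def by (rule polymap_lookup[OF polymap_lc])
  then obtain q where q: "polyfun q" "q \<alpha>0 \<noteq> 0"
      "\<And>\<alpha>. q \<alpha> \<noteq> 0 \<Longrightarrow> \<forall>u. \<exists>c. \<forall>k\<in>C. (\<Sum>r\<in>C. c r * v r \<alpha> k) = u k"
    using spanning_is_open[of C C v \<alpha>0, OF fin fin _ span0] by blast
  have "reduces_into I \<alpha> T M" if nz: "q \<alpha> \<noteq> 0" for \<alpha>
    unfolding reduces_into_def
  proof (intro allI impI)
    fix n :: "3 \<Rightarrow>\<^sub>0 nat" assume n: "mon_degree n = T"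
    obtain c where c: "\<forall>k\<in>C. (\<Sum>r\<in>C. c r * v r \<alpha> k) = (if k = n then 1 else 0)"
      using q(3)[OF nz, THEN spec[of _ "\<lambda>k. if k = n then 1 else 0"]] by (rule exE)
    define f where "f = (if n \<in> M then 0 else \<Sum>r\<in>C. smul (c r) (F r))"
    have Fr: "F r \<in> I" "homogeneous T (F r)" if "r \<in> C" for r using F[of r] that by (auto simp: C_def)
    have "f \<in> I"
      using rng.subspace_0[OF I] Fr rng.subspace_scale[OF I] by (auto simp: f_def smul_def intro!: rng.subspace_sum[OF I])
    moreover have hf: "homogeneous T f"
      using Fr by (auto simp: f_def homogeneous_0 intro!: homogeneous_sum homogeneous_smul)
    moreover have "keys (single n 1 - linear_change \<alpha> f) \<subseteq> M"
    proof
      fix k assume k: "k \<in> keys (single n 1 - linear_change \<alpha> f)"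
      then have ne: "lookup (single n 1) k - lookup (linear_change \<alpha> f) k \<noteq> 0"
        by (simp add: in_keys_iff lookup_minus)
      show "k \<in> M"
      proof (cases "n \<in> M")
        case True
        then have "linear_change \<alpha> f = 0" by (simp add: f_def lc_0)
        then show ?thesis using ne True by (auto simp: lookup_single when_def split: if_splits)
      next
        case False
        show ?thesis
        proof (rule ccontr)
          assume "k \<notin> M"
          have "mon_degree k = T"
          proof (rule ccontr)
            assume "mon_degree k \<noteq> T"
            then have "k \<notin> keys (linear_change \<alpha> f)" "k \<noteq> n"
              using homogeneous_lc[OF hf, of \<alpha>] n by (auto simp: homogeneous_def)
            then show False using ne by (simp add: in_keys_iff lookup_single when_def)
          qed
          then have "k \<in> C" using \<open>k \<notin> M\<close> by (simp add: C_def)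
          moreover have "lookup (linear_change \<alpha> f) k = (\<Sum>r\<in>C. c r * v r \<alpha> k)"
            using False by (simp add: f_def lc_simps lc_smul lookup_sum lookup_smul v_def)
          ultimately show False using ne c by (auto simp: lookup_single when_def split: if_splits)
        qed
      qed
    qed
    ultimately show "\<exists>f\<in>I. homogeneous T f \<and> keys (single n 1 - linear_change \<alpha> f) \<subseteq> M" by blast
  qed
  then show ?thesis using q by blast
qed

lemma reduces_into_open_finite:
  fixes I :: "'a::field poly3 set"
  assumes I: "rng.subspace I" and "finite A" "\<And>x. x \<in> A \<Longrightarrow> reduces_into I \<alpha>0 (T x) (M x)"
  shows "\<exists>q. polyfun q \<and> q \<alpha>0 \<noteq> 0 \<and> (\<forall>\<alpha>. q \<alpha> \<noteq> 0 \<longrightarrow> (\<forall>x\<in>A. reduces_into I \<alpha> (T x) (M x)))"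
proof -
  obtain q where q: "\<And>x. x \<in> A \<Longrightarrow> polyfun (q x) \<and> q x \<alpha>0 \<noteq> 0 \<and> (\<forall>\<alpha>. q x \<alpha> \<noteq> 0 \<longrightarrow> reduces_into I \<alpha> (T x) (M x))"
    using reduces_into_open[OF I assms(3)] by metis
  show ?thesis
    by (rule exI[of _ "\<lambda>\<alpha>. \<Prod>x\<in>A. q x \<alpha>"]) (use q assms(2) in \<open>auto intro: polyfun_prod\<close>)
qed

text \<open>
  The linear form \<open>\<ell>\<close> is completed to a basis of the linear forms by two of the variables, called \<open>x\<^sub>0\<close> and
  \<open>y\<^sub>0\<close>; then \<open>x\<^sub>0, y\<^sub>0 + s x\<^sub>0, \<ell>\<close> is a basis for every \<open>s\<close>.
\<close>

lemma adapted_frames: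
  fixes l :: "'a::field poly3"
  assumes l: "homogeneous 1 l" "l \<noteq> 0"
  obtains x0 y0 :: "'a poly3" and \<gamma> :: "'a \<Rightarrow> 'a^3^3" where
    "\<And>s. invertible (\<gamma> s)"
    "\<And>s. linear_change (\<gamma> s) (X 1) = x0"
    "\<And>s. linear_change (\<gamma> s) (X 2) = y0 + smul s x0"
    "\<And>s. linear_change (\<gamma> s) (X 3) = l"
proof -
  note thesisI = that
  define c where "c i = lookup l (single i 1)" for i :: 3
  have l_eq: "l = (\<Sum>i\<in>UNIV. const_poly (c i) * X i)"
  proof (rule poly_mapping_eqI)
    fix k :: "3 \<Rightarrow>\<^sub>0 nat"
    have r: "lookup (\<Sum>i\<in>UNIV. const_poly (c i) * X i) k = (\<Sum>i\<in>UNIV. if single i 1 = k then c i else 0)"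
      by (simp add: lookup_sum lookup_const_mult X_def lookup_single when_def if_distrib cong: if_cong)
    show "lookup l k = lookup (\<Sum>i\<in>UNIV. const_poly (c i) * X i) k"
    proof (cases "\<exists>i. k = single i 1")
      case True
      then obtain i where i: "k = single i 1" by blast
      have "single j (1::nat) = k \<longleftrightarrow> j = i" for j
        unfolding i by (metis lookup_single_eq lookup_single_not_eq zero_neq_one)
      then show ?thesis unfolding r by (simp add: c_def i)
    next
      case False
      have "mon_degree k \<noteq> 1"
      proof
        assume "mon_degree k = 1"
        then have "lookup k 1 + lookup k 2 + lookup k 3 = 1" by (simp add: mon_degree_3)
        then consider "lookup k 1 = 1 \<and> lookup k 2 = 0 \<and> lookup k 3 = 0"
          | "lookup k 1 = 0 \<and> lookup k 2 = 1 \<and> lookup k 3 = 0"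
          | "lookup k 1 = 0 \<and> lookup k 2 = 0 \<and> lookup k 3 = 1" by linarith
        then have "k = expo 1 0 0 \<or> k = expo 0 1 0 \<or> k = expo 0 0 1"
          using expo_lookup[of k] by cases auto
        then show False using False by (auto simp: expo_def)
      qed
      then have "lookup l k = 0" using l(1) by (auto simp: homogeneous_def in_keys_iff)
      moreover have "(\<Sum>i\<in>UNIV. if single i 1 = k then c i else 0) = 0"
        using False by (intro sum.neutral) auto
      ultimately show ?thesis unfolding r by simp
    qed
  qed
  have frame: thesis if det: "\<And>s. det (\<chi> i j. if j = 1 then u i else if j = 2 then w i + s * u i else c i) \<noteq> 0"
    for u w :: "3 \<Rightarrow> 'a"
  proof (rule thesisI)
    define \<gamma> :: "'a \<Rightarrow> 'a^3^3" where "\<gamma> s = (\<chi> i j. if j = 1 then u i else if j = 2 then w i + s * u i else c i)" for s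
    show "invertible (\<gamma> s)" for s using det[of s] by (simp add: invertible_det_nz \<gamma>_def)
    show "linear_change (\<gamma> s) (X 1) = (\<Sum>i\<in>UNIV. const_poly (u i) * X i)" for s
      by (simp add: lc_simps \<gamma>_def)
    show "linear_change (\<gamma> s) (X 3) = l" for s
      unfolding l_eq by (simp only: lc_simps \<gamma>_def vec_lambda_beta three_neq if_False)
    show "linear_change (\<gamma> s) (X 2) = (\<Sum>i\<in>UNIV. const_poly (w i) * X i) + smul s (\<Sum>i\<in>UNIV. const_poly (u i) * X i)" for s
      by (simp only: lc_simps \<gamma>_def vec_lambda_beta three_neq if_False if_True simp_thms smul_def const_poly_simps
          distrib_right sum.distrib sum_distrib_left mult.assoc)
  qed
  have "\<exists>i. c i \<noteq> 0"
  proof (rule ccontr)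
    assume "\<not> (\<exists>i. c i \<noteq> 0)"
    then have "l = 0" unfolding l_eq by (simp add: const_poly_simps)
    then show False using l(2) by simp
  qed
  then have "c 1 \<noteq> 0 \<or> c 2 \<noteq> 0 \<or> c 3 \<noteq> 0" using exhaust_3 by metis
  then show thesis
  proof (elim disjE)
    assume "c 1 \<noteq> 0"
    then show thesis
      by (intro frame[of "\<lambda>i. if i = 2 then 1 else 0" "\<lambda>i. if i = 3 then 1 else 0"])
        (simp only: det_3 vec_lambda_beta three_neq if_True if_False, simp)
  next
    assume "c 2 \<noteq> 0"
    then show thesis
      by (intro frame[of "\<lambda>i. if i = 1 then 1 else 0" "\<lambda>i. if i = 3 then 1 else 0"])
        (simp only: det_3 vec_lambda_beta three_neq if_True if_False, simp)
  next
    assume "c 3 \<noteq> 0"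
    then show thesis
      by (intro frame[of "\<lambda>i. if i = 1 then 1 else 0" "\<lambda>i. if i = 2 then 1 else 0"])
        (simp only: det_3 vec_lambda_beta three_neq if_True if_False, simp)
  qed
qed

lemma lc_inverse:
  fixes \<gamma> :: "'a::field^3^3"
  assumes "invertible \<gamma>"
  obtains \<alpha> where "invertible \<alpha>" "\<And>p. linear_change \<alpha> (linear_change \<gamma> p) = p"
    "\<And>p. linear_change \<gamma> (linear_change \<alpha> p) = p"
proof -
  obtain \<alpha> where "\<gamma> ** \<alpha> = mat 1" "\<alpha> ** \<gamma> = mat 1" using assms unfolding invertible_def by blast
  then show ?thesis by (intro that[of \<alpha>]) (auto simp: lc_comp lc_id invertible_def)
qed

lemma single_expo: "single (expo a b c) (1::'a::comm_ring_1) = X 1 ^ a * X 2 ^ b * X 3 ^ c"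
  by (simp only: mon_eq_single[symmetric] mon_def)


lemma keys_X3_power_mult:
  fixes q :: "'a::comm_ring_1 poly3"
  assumes "k \<in> keys (X 3 ^ b * q)"
  shows "b \<le> lookup k 3"
proof -
  have "keys (X 3 ^ b * q) \<subseteq> {u + w | u w. u \<in> keys (X 3 ^ b :: 'a poly3) \<and> w \<in> keys q}"
    by (rule keys_mult)
  then obtain u w where "k = u + w" "u \<in> keys (X 3 ^ b :: 'a poly3)" using assms by blast
  then show ?thesis by (auto simp: X_power lookup_add split: if_splits)
qed

text \<open>
  A complete intersection as above with a strong Lefschetz element \<open>\<ell>\<close>.
\<close>

locale ci_lefschetz = ci_ideal +
  fixes l :: "'a::field_char_0 poly3"
  assumes l: "homogeneous 1 l"
    and lefschetz: "\<And>b t. b \<ge> 1 \<Longrightarrow> inj_on (quot_mult I (l ^ b)) (quot_graded I t) \<or>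
           quot_mult I (l ^ b) ` quot_graded I t = quot_graded I (t + b)"
begin

lemma codim_l: "b \<ge> 1 \<Longrightarrow> int (vs.dim (dspace (s + b) :: 'a poly3 set)) - int (vs.dim (mult_image I (l ^ b) s b))
    \<le> max 0 (hilb I (int (s + b)) - hilb I (int s))"
  using mult_image_codim[OF ideal _ lefschetz[of b s]] homogeneous_power[OF l, of b] by simp

lemma l_nonzero: "l \<noteq> 0"
proof
  assume "l = 0"
  have "mult_image I (l ^ 1) 0 1 = I \<inter> dspace 1"
    using homogeneous_0 by (auto simp: mult_image_def \<open>l = 0\<close> dspace_def)
  then have "hilb I 1 \<le> max 0 (hilb I 1 - hilb I 0)"
    using codim_l[of 1 0] hilb_nat[of I 1] by simp
  moreover have "G 0 = 1" "G 1 = 2" "2 \<le> e" using p2 pd by (auto simp: G_def e_def)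
  then have "hilb I 0 = 1" "hilb I 1 = 3"
    using hilb_sum_half[of 0] hilb_sum_half[of 1] by simp_all
  ultimately show False by simp
qed

text \<open>
  Multiplication by \<open>\<ell>\<^sup>b\<close> is surjective onto degree \<open>s + b\<close>, since by symmetry and unimodality the Hilbert function
  is at least as large in degree \<open>s\<close>.
\<close>

lemma degree_spanned_by_multiples:
  assumes "b \<ge> 1" "e \<le> s + (s + b)"
  shows "mult_image I (l ^ b) s b = dspace (s + b)"
proof (rule vs.dim_le_imp_eq[OF mult_image_subspace[OF ideal] _ dspace_span finite_dbasis])
  show "mult_image I (l ^ b) s b \<subseteq> dspace (s + b)"
    using mult_image_le[of b "l ^ b"] homogeneous_power[OF l, of b] by simp
  show "vs.dim (dspace (s + b) :: 'a poly3 set) \<le> vs.dim (mult_image I (l ^ b) s b)"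
    using codim_l[OF assms(1), of s] hilb_mono[of s "s + b"] assms by simp
qed

text \<open>
  The matrix \<open>\<alpha>\<close> is inverse to a frame \<open>x\<^sub>0, y\<^sub>0 + s x\<^sub>0, \<ell>\<close>, where \<open>s\<close> avoids the finitely many exceptional
  values for all degrees at once.
\<close>

lemma general_coordinates:
  obtains \<alpha> where "invertible \<alpha>"
    "\<And>T c. c < T \<Longrightarrow> T \<le> e \<Longrightarrow> e < 2 * T - c \<Longrightarrow> reduces_into I \<alpha> T {k. c < lookup k 3}"
    "\<And>t. 1 \<le> t \<Longrightarrow> 2 * t \<le> e \<Longrightarrow> reduces_into I \<alpha> t {k. 0 < lookup k 3 \<or> lookup k 1 < G t}"
proof -
  obtain x0 y0 :: "'a poly3" and \<gamma> :: "'a \<Rightarrow> 'a^3^3" where \<gamma>: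
    "\<And>s. invertible (\<gamma> s)"
    "\<And>s. linear_change (\<gamma> s) (X 1) = x0"
    "\<And>s. linear_change (\<gamma> s) (X 2) = y0 + smul s x0"
    "\<And>s. linear_change (\<gamma> s) (X 3) = l"
    using adapted_frames[OF l l_nonzero] by metis
  have y0: "linear_change (\<gamma> 0) (X 2) = y0" using \<gamma>(3)[of 0] by simp
  have hom: "homogeneous 1 x0" "homogeneous 1 y0"
    using homogeneous_lc[OF homogeneous_X, of "\<gamma> 0"] \<gamma>(2) y0 by metis+
  have osc: "\<exists>E. finite E \<and> (\<forall>s. s \<notin> E \<longrightarrow>
      dspace t \<subseteq> vs.span (mult_image I l (t - 1) 1 \<union> {(y0 + smul s x0) ^ (t - a) * x0 ^ a | a. a < G t \<and> a \<le> t}))"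
    if t: "1 \<le> t" "2 * t \<le> e" for t
  proof -
    define W where "W = mult_image I l (t - 1) 1"
    have t1: "t - 1 + 1 = t" using t by simp
    have W: "vs.subspace W" "W \<subseteq> dspace t"
      unfolding W_def using mult_image_subspace[OF ideal] mult_image_le[OF l, of I "t - 1"] t1 by simp_all
    have "int (vs.dim (dspace t :: 'a poly3 set)) - int (vs.dim W) \<le> int (G t)"
      using codim_l[of 1 "t - 1"] hilb_diff_G[OF t(2)] t by (simp add: W_def of_nat_diff)
    then have "vs.dim (dspace t :: 'a poly3 set) \<le> vs.dim W + G t" by linarith
    then obtain D where D: "finite D" "card D \<le> G t" "dspace t \<subseteq> vs.span (W \<union> D)"
      using vs.complement_exists[OF W dspace_span finite_dbasis] by metis
    show ?thesis
      unfolding W_def[symmetric]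
    proof (rule osculating_span[OF D W(1)])
      show "y0 ^ (t - i) * x0 ^ i \<in> dspace t" if "i \<le> t" for i
        using homogeneous_mult[OF homogeneous_power[OF hom(2), of "t - i"] homogeneous_power[OF hom(1), of i]] that
        by (simp add: dspace_def)
      show "dspace t \<subseteq> vs.span (W \<union> {y0 ^ (t - i) * x0 ^ i |i. i \<le> t})"
      proof
        fix p :: "'a poly3" assume p: "p \<in> dspace t"
        obtain \<beta> where \<beta>: "\<And>p. linear_change (\<gamma> 0) (linear_change \<beta> p) = p"
          using lc_inverse[OF \<gamma>(1)] by metis
        define p' where "p' = linear_change \<beta> p"
        have p': "homogeneous t p'" using p homogeneous_lc by (simp add: p'_def dspace_def)
        have "p = linear_change (\<gamma> 0) (\<Sum>k\<in>keys p'. smul (lookup p' k) (single k 1))"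
        proof -
          have "p' = (\<Sum>k\<in>keys p'. smul (lookup p' k) (single k 1))"
            by (subst mpoly_sum_single) (simp add: smul_def const_poly_def mult_single)
          then show ?thesis using \<beta>[of p] by (simp add: p'_def)
        qed
        also have "\<dots> = (\<Sum>k\<in>keys p'. smul (lookup p' k) (linear_change (\<gamma> 0) (single k 1)))"
          by (simp add: lc_simps lc_smul)
        also have "\<dots> \<in> vs.span (W \<union> {y0 ^ (t - i) * x0 ^ i |i. i \<le> t})"
        proof (intro vs.span_sum vs.span_scale vs.span_base)
          fix k assume "k \<in> keys p'"
          then have "mon_degree k = t" using p' by (simp add: homogeneous_def)
          then obtain a b c where k: "k = expo a b c" "a + b + c = t"
            using expo_lookup[of k] mon_degree_3[of k] by metis
          have lk: "linear_change (\<gamma> 0) (single k 1) = x0 ^ a * y0 ^ b * l ^ c"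
            unfolding k single_expo by (simp only: lc_simps(2,6) \<gamma>(2,4) y0)
          show "linear_change (\<gamma> 0) (single k 1) \<in> W \<union> {y0 ^ (t - i) * x0 ^ i |i. i \<le> t}"
          proof (cases c)
            case 0
            then have "linear_change (\<gamma> 0) (single k 1) = y0 ^ (t - a) * x0 ^ a" "a \<le> t"
              using lk k by (auto simp: mult.commute)
            then show ?thesis by blast
          next
            case (Suc c')
            then have "linear_change (\<gamma> 0) (single k 1) = 0 + l * (x0 ^ a * y0 ^ b * l ^ c')"
              using lk by (simp only: power_Suc add_0 mult.left_commute[of _ l])
            moreover have "homogeneous (a * 1 + b * 1 + c' * 1) (x0 ^ a * y0 ^ b * l ^ c')"
              by (intro homogeneous_mult homogeneous_power hom l)
            then have "x0 ^ a * y0 ^ b * l ^ c' \<in> dspace (t - 1)"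
              using k(2) Suc by (auto simp: dspace_def)
            moreover have "0 \<in> I \<inter> dspace (t - 1 + 1)"
              using rng.subspace_0[OF ideal] homogeneous_0 by (simp add: dspace_def)
            ultimately show ?thesis unfolding W_def mult_image_def by blast
          qed
        qed
        finally show "p \<in> vs.span (W \<union> {y0 ^ (t - i) * x0 ^ i |i. i \<le> t})" .
      qed
    qed
  qed
  define Q where "Q t s \<longleftrightarrow> dspace t \<subseteq> vs.span (mult_image I l (t - 1) 1
      \<union> {(y0 + smul s x0) ^ (t - a) * x0 ^ a | a. a < G t \<and> a \<le> t})" for t s
  have "\<forall>t. \<exists>E. 1 \<le> t \<and> 2 * t \<le> e \<longrightarrow> finite E \<and> (\<forall>s. s \<notin> E \<longrightarrow> Q t s)"
    using osc unfolding Q_def[symmetric] by blast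
  then obtain E where E': "\<forall>t. 1 \<le> t \<and> 2 * t \<le> e \<longrightarrow> finite (E t) \<and> (\<forall>s. s \<notin> E t \<longrightarrow> Q t s)"
    by (rule exE[OF choice])
  have E: "\<And>t. 1 \<le> t \<Longrightarrow> 2 * t \<le> e \<Longrightarrow> finite (E t)"
      "\<And>t s. 1 \<le> t \<Longrightarrow> 2 * t \<le> e \<Longrightarrow> s \<notin> E t \<Longrightarrow> Q t s"
    using E' by blast+
  have "finite (\<Union>t\<in>{t. 1 \<le> t \<and> 2 * t \<le> e}. E t)"
  proof (intro finite_UN_I)
    show "finite {t. 1 \<le> t \<and> 2 * t \<le> e}" by (rule finite_subset[of _ "{..e}"]) auto
  qed (use E(1) in auto)
  then obtain s where s: "s \<notin> (\<Union>t\<in>{t. 1 \<le> t \<and> 2 * t \<le> e}. E t)"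
    using ex_new_if_finite[OF infinite_UNIV_char_0] by blast
  obtain \<alpha> where \<alpha>: "invertible \<alpha>" "\<And>p. linear_change \<alpha> (linear_change (\<gamma> s) p) = p"
    using lc_inverse[OF \<gamma>(1)[of s]] by metis
  have \<alpha>X: "linear_change \<alpha> x0 = X 1" "linear_change \<alpha> (y0 + smul s x0) = X 2" "linear_change \<alpha> l = X 3"
    using \<alpha>(2)[of "X 1"] \<alpha>(2)[of "X 2"] \<alpha>(2)[of "X 3"] by (simp_all add: \<gamma>)
  show thesis
  proof (rule that[OF \<alpha>(1)])
    fix T c assume Tc: "c < T" "T \<le> e" "e < 2 * T - c"
    define s' where "s' = T - (c + 1)"
    have T: "T = s' + (c + 1)" using Tc by (simp add: s'_def)
    show "reduces_into I \<alpha> T {k. c < lookup k 3}"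
      unfolding reduces_into_def
    proof (intro allI impI)
      fix n :: "3 \<Rightarrow>\<^sub>0 nat" assume n: "mon_degree n = T"
      have "linear_change (\<gamma> s) (single n 1) \<in> dspace T"
        using homogeneous_lc[OF homogeneous_single[of n 1]] n by (auto simp: dspace_def)
      also have "\<dots> = mult_image I (l ^ (c + 1)) s' (c + 1)"
        unfolding T using Tc T by (intro degree_spanned_by_multiples[symmetric]) auto
      finally obtain f v where fv: "linear_change (\<gamma> s) (single n 1) = f + l ^ (c + 1) * v" "f \<in> I" "homogeneous T f"
        unfolding mult_image_def T by (auto simp: dspace_def)
      have "linear_change \<alpha> (f + l ^ (c + 1) * v) = single n 1"
        using \<alpha>(2)[of "single n 1"] fv(1) by simp
      then have "linear_change \<alpha> f + X 3 ^ (c + 1) * linear_change \<alpha> v = single n 1"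
        by (simp only: lc_simps(1,2,6) \<alpha>X)
      then have "single n 1 - linear_change \<alpha> f = X 3 ^ (c + 1) * linear_change \<alpha> v"
        by (metis add_diff_cancel_left')
      then have "keys (single n 1 - linear_change \<alpha> f) \<subseteq> {k. c < lookup k 3}"
        using keys_X3_power_mult[of _ "c + 1" "linear_change \<alpha> v"] by (metis Suc_eq_plus1 Suc_le_eq mem_Collect_eq subsetI)
      then show "\<exists>f\<in>I. homogeneous T f \<and> keys (single n 1 - linear_change \<alpha> f) \<subseteq> {k. c < lookup k 3}"
        using fv by blast
    qed
  next
    fix t assume t: "1 \<le> t" "2 * t \<le> e"
    then have t1: "t - 1 + 1 = t" by simp
    define W where "W = mult_image I l (t - 1) 1"
    define M where "M = {k :: 3 \<Rightarrow>\<^sub>0 nat. 0 < lookup k 3 \<or> lookup k 1 < G t}"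
    define Y where "Y = {(y0 + smul s x0) ^ (t - a) * x0 ^ a | a. a < G t \<and> a \<le> t}"
    have W: "vs.span W = W" using mult_image_subspace[OF ideal] by (simp add: W_def)
    have Y: "keys (linear_change \<alpha> z) \<subseteq> M" if "z \<in> vs.span Y" for z
    proof -
      have "vs.span Y \<subseteq> {z. keys (linear_change \<alpha> z) \<subseteq> M}"
      proof (rule vs.span_minimal)
        show "Y \<subseteq> {z. keys (linear_change \<alpha> z) \<subseteq> M}"
        proof
          fix z assume "z \<in> Y"
          then obtain a where a: "z = (y0 + smul s x0) ^ (t - a) * x0 ^ a" "a < G t" "a \<le> t"
            by (auto simp: Y_def)
          have "linear_change \<alpha> z = X 2 ^ (t - a) * X 1 ^ a" unfolding a(1) by (simp only: lc_simps(2,6) \<alpha>X)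
          also have "\<dots> = single (expo a (t - a) 0) 1" unfolding single_expo by (simp add: mult.commute)
          finally show "z \<in> {z. keys (linear_change \<alpha> z) \<subseteq> M}" using a(2) by (simp add: M_def lookup_expo)
        qed
        show "vs.subspace {z. keys (linear_change \<alpha> z) \<subseteq> M}"
          using subspace_keys[of M, where 'a = 'a] unfolding vs.subspace_def mem_Collect_eq lc_0 lc_simps lc_smul by blast
      qed
      then show ?thesis using that by auto
    qed
    show "reduces_into I \<alpha> t {k. 0 < lookup k 3 \<or> lookup k 1 < G t}"
      unfolding reduces_into_def M_def[symmetric]
    proof (intro allI impI)
      fix n :: "3 \<Rightarrow>\<^sub>0 nat" assume n: "mon_degree n = t"
      have "linear_change (\<gamma> s) (single n 1) \<in> dspace t"
        using homogeneous_lc[OF homogeneous_single[of n 1]] n by (auto simp: dspace_def)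
      also have "dspace t \<subseteq> vs.span (W \<union> Y)" unfolding W_def Y_def Q_def[symmetric] using E(2)[OF t, of s] s t by blast
      finally obtain w z where wz: "linear_change (\<gamma> s) (single n 1) = w + z" "w \<in> W" "z \<in> vs.span Y"
        unfolding vs.span_Un W by blast
      from wz(2) obtain f v where f: "w = f + l * v" "f \<in> I" "homogeneous t f"
        unfolding W_def mult_image_def t1 by (auto simp: dspace_def)
      have "linear_change \<alpha> (f + l * v + z) = single n 1" using \<alpha>(2)[of "single n 1"] wz(1) f(1) by simp
      then have "linear_change \<alpha> f + (X 3 ^ 1 * linear_change \<alpha> v + linear_change \<alpha> z) = single n 1"
        by (simp add: lc_simps(1,2) \<alpha>X add.assoc)
      then have "single n 1 - linear_change \<alpha> f = X 3 ^ 1 * linear_change \<alpha> v + linear_change \<alpha> z"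
        by (metis add_diff_cancel_left')
      moreover have "X 3 ^ 1 * linear_change \<alpha> v \<in> {z. keys z \<subseteq> M}"
        using keys_X3_power_mult[of _ 1 "linear_change \<alpha> v"] by (auto simp: M_def Suc_le_eq)
      moreover have "linear_change \<alpha> z \<in> {z. keys z \<subseteq> M}" using Y[OF wz(3)] by simp
      ultimately have "single n 1 - linear_change \<alpha> f \<in> {z. keys z \<subseteq> M}"
        using vs.subspace_add[OF subspace_keys] by simp
      then show "\<exists>f\<in>I. homogeneous t f \<and> keys (single n 1 - linear_change \<alpha> f) \<subseteq> M" using f by blast
    qed
  qed
qed

section \<open>The generic initial ideal\<close>

text \<open>
  The exponents of the monomials in the generic initial ideal; here \<open>p + 2d - 2 = e + 1\<close>.
\<close>

definition gin_exps :: "(3 \<Rightarrow>\<^sub>0 nat) set" where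
  "gin_exps = {k. p \<le> lookup k 1 \<or> p + 2 * d - 2 \<le> 3 * lookup k 1 + 2 * lookup k 2
     \<or> p + 2 * d - 2 \<le> 2 * lookup k 1 + 2 * lookup k 2 + lookup k 3}"

lemma e_Suc: "p + 2 * d - 2 = Suc e"
  using p2 pd by (simp add: e_def)

text \<open>
  A monomial \<open>x\<^sub>1\<^sup>a x\<^sub>2\<^sup>b x\<^sub>3\<^sup>c\<close> of degree \<open>T\<close> outside the set has \<open>a < G(t)\<close> for \<open>t = a + b\<close>, and
  \<open>t \<le> min(T, e - T)\<close>; summing \<open>G\<close> over these \<open>t\<close> gives \<open>H(T)\<close>.
\<close>

lemma card_standard:
  "int (card ({k. mon_degree k = T} - gin_exps)) \<le> hilb I (int T)"
proof (cases "T \<le> e")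
  case False
  then have "{k. mon_degree k = T} - gin_exps = {}"
    unfolding gin_exps_def e_Suc by (auto simp: mon_degree_3)
  then show ?thesis using hilb_nonneg[of I "int T"] by (simp only: card.empty of_nat_0)
next
  case True
  have "{k. mon_degree k = T} - gin_exps \<subseteq>
      (\<lambda>(t, a). expo a (t - a) (T - t)) ` (SIGMA t:{..min T (e - T)}. {..<G t})"
  proof
    fix k assume k: "k \<in> {k. mon_degree k = T} - gin_exps"
    obtain a b c where abc: "k = expo a b c" using expo_lookup[of k] by metis
    have h: "a + b + c = T" "a < p" "3 * a + 2 * b < Suc e" "2 * a + 2 * b + c < Suc e"
      using k unfolding gin_exps_def e_Suc abc by (auto simp: mon_degree_expo lookup_expo)
    have "a < G (a + b)" using h unfolding G_def e_Suc by auto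
    then have "(a + b, a) \<in> (SIGMA t:{..min T (e - T)}. {..<G t})" using h True by auto
    moreover have "k = (\<lambda>(t, a). expo a (t - a) (T - t)) (a + b, a)" using h abc by auto
    ultimately show "k \<in> (\<lambda>(t, a). expo a (t - a) (T - t)) ` (SIGMA t:{..min T (e - T)}. {..<G t})"
      by (rule rev_image_eqI)
  qed
  then have "card ({k. mon_degree k = T} - gin_exps) \<le> card (SIGMA t:{..min T (e - T)}. {..<G t})"
    by (rule surj_card_le[rotated]) simp
  then have "card ({k. mon_degree k = T} - gin_exps) \<le> (\<Sum>t\<le>min T (e - T). G t)" by simp
  then have "int (card ({k. mon_degree k = T} - gin_exps)) \<le> int (\<Sum>t\<le>min T (e - T). G t)"
    by (simp only: of_nat_le_iff)
  then show ?thesis using hilb_sum[OF True] by (simp only: of_nat_sum)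
qed

lemma hcomp_lc: "hcomp t (linear_change \<alpha> q) = linear_change \<alpha> (hcomp t q)"
proof (induction q rule: mpoly_induct)
  case (single m c)
  show ?case
    by (simp add: hcomp_homogeneous[OF homogeneous_lc[OF homogeneous_single]]
        hcomp_homogeneous[OF homogeneous_single] lc_0)
qed (simp add: lc_simps hcomp_add)

context
  fixes \<alpha> :: "'a^3^3"
  assumes inv: "invertible \<alpha>"
begin

lemma ideal_lc: "rng.subspace (linear_change \<alpha> ` I)"
  unfolding rng.subspace_def
proof (intro conjI ballI allI)
  show "0 \<in> linear_change \<alpha> ` I"
    using rng.subspace_0[OF ideal] lc_0[of \<alpha>] by (metis imageI)
next
  fix x y assume "x \<in> linear_change \<alpha> ` I" "y \<in> linear_change \<alpha> ` I"
  then show "x + y \<in> linear_change \<alpha> ` I"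
    using rng.subspace_add[OF ideal] by (auto simp: lc_simps(1)[symmetric])
next
  fix c x assume "x \<in> linear_change \<alpha> ` I"
  then obtain f where f: "x = linear_change \<alpha> f" "f \<in> I" by blast
  obtain \<beta> where "linear_change \<alpha> (linear_change \<beta> c) = c"
    using lc_inverse[OF inv] by metis
  then have "c * x = linear_change \<alpha> (linear_change \<beta> c * f)" by (simp add: lc_simps f)
  then show "c * x \<in> linear_change \<alpha> ` I" using rng.subspace_scale[OF ideal f(2)] by blast
qed

lemma dim_lc_le: "vs.dim (linear_change \<alpha> ` I \<inter> dspace T) \<le> vs.dim (I \<inter> dspace T)"
proof -
  obtain B where B: "B \<subseteq> I \<inter> dspace T" "vs.independent B" "I \<inter> dspace T \<subseteq> vs.span B" "card B = vs.dim (I \<inter> dspace T)"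
    by (rule vs.basis_exists)
  have fin: "finite B" using vs.independent_span_bound[OF finite_dbasis B(2)] B(1) dspace_span[of T] by blast
  have "linear_change \<alpha> ` I \<inter> dspace T \<subseteq> vs.span (linear_change \<alpha> ` B)"
  proof
    fix x assume x: "x \<in> linear_change \<alpha> ` I \<inter> dspace T"
    then obtain f where f: "x = linear_change \<alpha> f" "f \<in> I" by blast
    have "x = linear_change \<alpha> (hcomp T f)"
      using x hcomp_homogeneous[of T x T] by (simp add: f(1) hcomp_lc dspace_def)
    moreover have "hcomp T f \<in> vs.span B"
    proof -
      have "hcomp T f \<in> I \<inter> dspace T"
        using graded f(2) homogeneous_hcomp[of T f] by (simp add: graded_ideal_def dspace_def)
      then show ?thesis using B(3) by blast
    qed
    moreover have "vs.span B \<subseteq> {z. linear_change \<alpha> z \<in> vs.span (linear_change \<alpha> ` B)}"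
    proof (rule vs.span_minimal)
      show "vs.subspace {z. linear_change \<alpha> z \<in> vs.span (linear_change \<alpha> ` B)}"
        by (auto simp: vs.subspace_def lc_0 lc_simps lc_smul intro: vs.span_zero vs.span_add vs.span_scale)
    qed (auto intro: vs.span_base)
    ultimately show "x \<in> vs.span (linear_change \<alpha> ` B)" by blast
  qed
  then have "vs.dim (linear_change \<alpha> ` I \<inter> dspace T) \<le> card (linear_change \<alpha> ` B)"
    using vs.dim_le_card fin by blast
  then show ?thesis using card_image_le[OF fin, of "linear_change \<alpha>"] B(4) by linarith
qed

lemma leading_of_reduces_into:
  assumes "reduces_into I \<alpha> T M" "mon_degree k = T" "k \<notin> M"
    and "\<And>n. n \<in> M \<Longrightarrow> mon_degree n = T \<Longrightarrow> grevlex_less n k"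
  obtains g where "g \<in> linear_change \<alpha> ` I" "homogeneous T g" "k \<in> keys g"
    "\<And>n. n \<in> keys g \<Longrightarrow> n \<noteq> k \<Longrightarrow> grevlex_less n k"
proof -
  obtain f where f: "f \<in> I" "homogeneous T f" "keys (single k 1 - linear_change \<alpha> f) \<subseteq> M"
    using assms(1,2) unfolding reduces_into_def by blast
  define g where "g = linear_change \<alpha> f"
  have g: "homogeneous T g" using homogeneous_lc[OF f(2)] by (simp add: g_def)
  have *: "lookup g n = lookup (single k 1) n" if "n \<notin> M" for n
  proof -
    have "n \<notin> keys (single k 1 - linear_change \<alpha> f)" using that f(3) by blast
    then show ?thesis by (simp add: g_def lookup_minus in_keys_iff)
  qed
  show thesis
  proof (rule that[of g])
    show "g \<in> linear_change \<alpha> ` I" using f by (simp add: g_def)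
    show "k \<in> keys g" using *[OF assms(3)] by (simp add: in_keys_iff)
    fix n assume n: "n \<in> keys g" "n \<noteq> k"
    then have "n \<in> M" using *[of n] by (auto simp: in_keys_iff lookup_single when_def)
    then show "grevlex_less n k" using assms(4) n(1) g by (simp add: homogeneous_def)
  qed (rule g)
qed

text \<open>
  For each exponent vector in \<open>gin_exps\<close> of degree at most \<open>e\<close>, one of the two hypotheses rewrites the monomial
  itself, or its part in \<open>x\<^sub>1, x\<^sub>2\<close>, in terms of smaller monomials. Equality then follows by counting in each degree.
\<close>

lemma leading_exponents:
  assumes 1: "\<And>T c. c < T \<Longrightarrow> T \<le> e \<Longrightarrow> e < 2 * T - c \<Longrightarrow> reduces_into I \<alpha> T {k. c < lookup k 3}"
    and 2: "\<And>t. 1 \<le> t \<Longrightarrow> 2 * t \<le> e \<Longrightarrow> reduces_into I \<alpha> t {k. 0 < lookup k 3 \<or> lookup k 1 < G t}"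
  shows "{leading_exponent f | f. f \<in> linear_change \<alpha> ` I \<and> f \<noteq> 0} = gin_exps"
proof -
  define V where "V = linear_change \<alpha> ` I"
  have V: "rng.subspace V" using ideal_lc by (simp add: V_def)
  define L where "L = {leading_exponent f | f. f \<in> V \<and> f \<noteq> 0}"
  have LI: "k \<in> L" if "g \<in> V" "k \<in> keys g" "\<And>n. n \<in> keys g \<Longrightarrow> n \<noteq> k \<Longrightarrow> grevlex_less n k" for g k
  proof -
    have "leading_exponent g = k" "g \<noteq> 0" using leading_exponentI[OF that(2,3)] that(2) by auto
    then show ?thesis using that(1) unfolding L_def by blast
  qed
  have sub: "gin_exps \<subseteq> L"
  proof
    fix k assume k: "k \<in> gin_exps"
    obtain a b c where abc: "k = expo a b c" using expo_lookup[of k] by metis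
    define t where "t = a + b"
    define T where "T = t + c"
    have deg: "mon_degree k = T" by (simp add: abc mon_degree_expo T_def t_def)
    \<comment> \<open>degrees in which the ideal is everything; the powers of \<open>x\<^sub>3\<close>; the \<open>x\<^sub>1, x\<^sub>2\<close>-part\<close>
    consider "e < T" | "T \<le> e" "e < 2 * t + c" | "2 * t + c \<le> e" by linarith
    then show "k \<in> L"
    proof cases
      case 1
      have "I \<inter> dspace T = dspace T"
      proof (rule vs.dim_le_imp_eq[OF _ _ dspace_span finite_dbasis])
        show "vs.subspace (I \<inter> dspace T)"
          by (intro vs.subspace_inter ideal_imp_subspace ideal subspace_dspace)
        show "vs.dim (dspace T :: 'a poly3 set) \<le> vs.dim (I \<inter> dspace T)"
          using hilb_large[of "int T"] 1 hilb_nat[of I T] by simp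
      qed simp
      moreover obtain \<beta> where \<beta>: "linear_change \<alpha> (linear_change \<beta> (single k 1)) = single k 1"
        using lc_inverse[OF inv] by metis
      moreover have "linear_change \<beta> (single k 1) \<in> dspace T"
        using homogeneous_lc[OF homogeneous_single[of k 1], of \<beta>] deg by (auto simp: dspace_def)
      ultimately have "single k 1 \<in> V" unfolding V_def by (metis Int_iff imageI)
      then show ?thesis by (rule LI) auto
    next
      case 2
      then have "c < T" "e < 2 * T - c" by (auto simp: T_def)
      then have "reduces_into I \<alpha> T {k. c < lookup k 3}" using 2 1[of c T] by blast
      then obtain g where "g \<in> V" "k \<in> keys g" "\<And>n. n \<in> keys g \<Longrightarrow> n \<noteq> k \<Longrightarrow> grevlex_less n k"
      proof (rule leading_of_reduces_into[OF _ deg])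
        show "k \<notin> {k. c < lookup k 3}" by (simp add: abc lookup_expo)
        fix n :: "3 \<Rightarrow>\<^sub>0 nat" assume "n \<in> {k. c < lookup k 3}" "mon_degree n = T"
        then show "grevlex_less n k" using deg by (simp add: grevlex_less_def abc lookup_expo)
      qed (auto simp: V_def)
      then show ?thesis by (rule LI)
    next
      case 3
      have a: "p \<le> a \<or> Suc e \<le> 3 * a + 2 * b"
        using k 3 unfolding gin_exps_def e_Suc abc by (auto simp: lookup_expo t_def)
      have "1 \<le> t" "2 * t \<le> e" "G t \<le> a"
        using a 3 p2 unfolding G_def e_Suc t_def by auto
      then have "reduces_into I \<alpha> t {k. 0 < lookup k 3 \<or> lookup k 1 < G t}" by (intro 2)
      then obtain g where g: "g \<in> V" "homogeneous t g" "expo a b 0 \<in> keys g"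
          "\<And>n. n \<in> keys g \<Longrightarrow> n \<noteq> expo a b 0 \<Longrightarrow> grevlex_less n (expo a b 0)"
      proof (rule leading_of_reduces_into[where k = "expo a b 0"])
        show "mon_degree (expo a b 0) = t" by (simp add: mon_degree_expo t_def)
        show "expo a b 0 \<notin> {k. 0 < lookup k 3 \<or> lookup k 1 < G t}"
          using \<open>G t \<le> a\<close> by (simp add: lookup_expo)
        fix n :: "3 \<Rightarrow>\<^sub>0 nat"
        assume n: "n \<in> {k. 0 < lookup k 3 \<or> lookup k 1 < G t}" "mon_degree n = t"
        then have "lookup n 1 + lookup n 2 + lookup n 3 = a + b" "0 < lookup n 3 \<or> lookup n 1 < a"
          using \<open>G t \<le> a\<close> by (auto simp: mon_degree_3 t_def)
        then have "0 < lookup n 3 \<or> (lookup n 3 = 0 \<and> b < lookup n 2)" by linarith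
        then show "grevlex_less n (expo a b 0)"
          using n(2) unfolding grevlex_less_def mon_degree_expo lookup_expo by (auto simp: t_def)
      qed (auto simp: V_def)
      have k_eq: "expo 0 0 c + expo a b 0 = k" by (simp add: expo_add abc)
      show ?thesis
      proof (rule LI)
        show "single (expo 0 0 c) 1 * g \<in> V" using rng.subspace_scale[OF V g(1)] .
        show "k \<in> keys (single (expo 0 0 c) 1 * g)"
          using g(3) lookup_single_mult[of "expo 0 0 c" 1 g "expo a b 0"] by (simp add: k_eq in_keys_iff)
        fix n assume n: "n \<in> keys (single (expo 0 0 c) 1 * g)" "n \<noteq> k"
        then obtain n' where n': "n = expo 0 0 c + n'"
          using lookup_single_mult_eq_0[of n "expo 0 0 c" 1 g] by (auto simp: in_keys_iff)
        then have "n' \<in> keys g" using n(1) lookup_single_mult[of "expo 0 0 c" 1 g n'] by (simp add: in_keys_iff)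
        moreover have "n' \<noteq> expo a b 0" using n(2) n' k_eq by auto
        ultimately have "grevlex_less n' (expo a b 0)" by (rule g(4))
        then show "grevlex_less n k"
          unfolding n' k_eq[symmetric] grevlex_less_def by (auto simp: lookup_add mon_degree_simps)
      qed
    qed
  qed
  have "L \<inter> {k. mon_degree k = T} = gin_exps \<inter> {k. mon_degree k = T}" for T
  proof -
    define S where "S = {k :: 3 \<Rightarrow>\<^sub>0 nat. mon_degree k = T}"
    have fS: "finite S" using finite_exponents by (simp add: S_def)
    have "card (L \<inter> S) \<le> vs.dim (V \<inter> dspace T)"
    proof (rule card_leading_le_dim(2)[where t = T])
      fix k assume k: "k \<in> L \<inter> S"
      then obtain f where f: "f \<in> V" "f \<noteq> 0" "leading_exponent f = k" by (auto simp: L_def)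
      have kk: "k \<in> keys f" using leading_exponent_props(1)[OF f(2)] f(3) by simp
      have kh: "k \<in> keys (hcomp T f)" using kk k by (simp add: in_keys_iff lookup_hcomp S_def)
      have "leading_exponent (hcomp T f) = k"
      proof (rule leading_exponentI[OF kh])
        fix n assume "n \<in> keys (hcomp T f)" "n \<noteq> k"
        then show "grevlex_less n k" using leading_exponent_props(2)[OF f(2), of n] f(3)
          by (auto simp: in_keys_iff lookup_hcomp split: if_splits)
      qed
      moreover have "hcomp T f \<noteq> 0" using kh by auto
      moreover have "hcomp T f \<in> V"
        using f(1) graded by (auto simp: V_def hcomp_lc graded_ideal_def)
      ultimately show "\<exists>f\<in>V \<inter> dspace T. f \<noteq> 0 \<and> leading_exponent f = k"
        using homogeneous_hcomp[of T f] by (auto simp: dspace_def)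
    qed simp
    also have "\<dots> \<le> vs.dim (I \<inter> dspace T)" unfolding V_def by (rule dim_lc_le)
    finally have "int (card (L \<inter> S)) \<le> int (card S) - hilb I (int T)"
      unfolding hilb_nat dim_dspace S_def by simp
    also have "\<dots> \<le> int (card S) - int (card (S - gin_exps))"
      using card_standard[of T] by (simp add: S_def)
    also have "\<dots> = int (card (gin_exps \<inter> S))"
      using card_Diff_subset_Int[of S gin_exps] card_mono[OF fS, of "S \<inter> gin_exps"] fS
      by (simp add: Int_commute of_nat_diff)
    finally have "card (L \<inter> S) \<le> card (gin_exps \<inter> S)" by simp
    then have "gin_exps \<inter> S = L \<inter> S"
      using sub fS by (intro card_seteq) auto
    then show ?thesis by (simp add: S_def)
  qed
  then have "L = gin_exps" by blast
  then show ?thesis by (simp add: L_def V_def)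
qed

end

theorem Gin_eq: "Gin I = ideal_gen ((\<lambda>k. single k 1) ` gin_exps)"
proof -
  obtain \<alpha>0 where \<alpha>0: "invertible \<alpha>0"
    "\<And>T c. c < T \<Longrightarrow> T \<le> e \<Longrightarrow> e < 2 * T - c \<Longrightarrow> reduces_into I \<alpha>0 T {k. c < lookup k 3}"
    "\<And>t. 1 \<le> t \<Longrightarrow> 2 * t \<le> e \<Longrightarrow> reduces_into I \<alpha>0 t {k. 0 < lookup k 3 \<or> lookup k 1 < G t}"
    by (rule general_coordinates) (rule that; assumption)
  define A where "A = {(T, c). c < T \<and> T \<le> e \<and> e < 2 * T - c}"
  have "A \<subseteq> {..e} \<times> {..e}" by (auto simp: A_def)
  then have finA: "finite A" by (rule finite_subset) simp
  obtain q1 where q1: "polyfun q1" "q1 \<alpha>0 \<noteq> 0"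
    "\<And>\<alpha>. q1 \<alpha> \<noteq> 0 \<Longrightarrow> \<forall>x\<in>A. reduces_into I \<alpha> (fst x) {k. snd x < lookup k 3}"
    using reduces_into_open_finite[OF ideal finA, of \<alpha>0 fst "\<lambda>x. {k. snd x < lookup k 3}"] \<alpha>0(2)
    by (auto simp: A_def)
  define B where "B = {t. 1 \<le> t \<and> 2 * t \<le> e}"
  have "B \<subseteq> {..e}" by (auto simp: B_def)
  then have finB: "finite B" by (rule finite_subset) simp
  obtain q2 where q2: "polyfun q2" "q2 \<alpha>0 \<noteq> 0"
    "\<And>\<alpha>. q2 \<alpha> \<noteq> 0 \<Longrightarrow> \<forall>t\<in>B. reduces_into I \<alpha> t {k. 0 < lookup k 3 \<or> lookup k 1 < G t}"
    using reduces_into_open_finite[OF ideal finB, of \<alpha>0 "\<lambda>t. t" "\<lambda>t. {k. 0 < lookup k 3 \<or> lookup k 1 < G t}"] \<alpha>0(3)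
    by (auto simp: B_def)
  show ?thesis
  proof (rule Gin_eqI)
    show "zariski_open_GL3 {\<alpha>. invertible \<alpha> \<and> q1 \<alpha> * q2 \<alpha> \<noteq> 0}"
      by (intro zariski_open_polyfun polyfun_mult q1 q2)
    show "{\<alpha>. invertible \<alpha> \<and> q1 \<alpha> * q2 \<alpha> \<noteq> 0} \<noteq> {}" using \<alpha>0(1) q1(2) q2(2) by auto
    fix \<alpha> assume \<alpha>: "\<alpha> \<in> {\<alpha>. invertible \<alpha> \<and> q1 \<alpha> * q2 \<alpha> \<noteq> 0}"
    then have "{leading_exponent f | f. f \<in> linear_change \<alpha> ` I \<and> f \<noteq> 0} = gin_exps"
      using q1(3)[of \<alpha>] q2(3)[of \<alpha>] by (intro leading_exponents) (auto simp: A_def B_def)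
    moreover have "{single (leading_exponent f) 1 | f. f \<in> linear_change \<alpha> ` I \<and> f \<noteq> 0}
        = (\<lambda>k. single k (1::'a)) ` {leading_exponent f | f. f \<in> linear_change \<alpha> ` I \<and> f \<noteq> 0}"
      by blast
    ultimately show "initial_ideal (linear_change \<alpha> ` I) = ideal_gen ((\<lambda>k. single k 1) ` gin_exps)"
      by (simp only: initial_ideal_def)
  qed
qed

end


section \<open>Monomial generators\<close>

lemma mon_mult: "mon a b c * mon a' b' c' = mon (a + a') (b + b') (c + c')"
  by (simp add: mon_eq_single mult_single expo_add)

lemma translate_mons12: "mon 0 b c *o mons12 j = {mon a (b + b') c | a b'. a + b' = j}"
proof -
  have "mon 0 b c *o mons12 j = {mon 0 b c * mon a b' 0 | a b'. a + b' = j}"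
    unfolding elt_set_times_def mons12_def by blast
  then show ?thesis by (simp add: mon_mult)
qed

text \<open>
  Two sets of monomials generate the same ideal if one contains the other and each of its elements is divisible by an
  element of the smaller one.
\<close>

lemma monomial_ideal_eqI:
  fixes Gs :: "'a::comm_ring_1 poly3 set"
  assumes 1: "\<And>g. g \<in> Gs \<Longrightarrow> \<exists>a b c. g = mon a b c \<and> P a b c"
    and 2: "\<And>a b c. P a b c \<Longrightarrow> \<exists>a' b' c'. mon a' b' c' \<in> Gs \<and> a' \<le> a \<and> b' \<le> b \<and> c' \<le> c"
  shows "ideal_gen {mon a b c | a b c. P a b c} = ideal_gen Gs"
  unfolding ideal_gen_def
proof (rule antisym)
  show "rng.span {mon a b c | a b c. P a b c} \<subseteq> rng.span Gs"
  proof (rule rng.span_minimal)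
    show "{mon a b c | a b c. P a b c} \<subseteq> rng.span Gs"
    proof clarify
      fix a b c assume "P a b c"
      then obtain a' b' c' where m: "mon a' b' c' \<in> Gs" "a' \<le> a" "b' \<le> b" "c' \<le> c" using 2 by blast
      then have "mon a b c = mon (a - a') (b - b') (c - c') * (mon a' b' c' :: 'a poly3)"
        by (simp add: mon_mult)
      then show "mon a b c \<in> rng.span Gs" using m(1) by (simp add: rng.span_base rng.span_scale)
    qed
  qed simp
  show "rng.span Gs \<subseteq> rng.span {mon a b c | a b c. P a b c}"
    by (rule rng.span_mono) (use 1 in blast)
qed

text \<open>
  Membership in the generic initial ideal as a condition on the exponents of a monomial.
\<close>

definition gin_cond :: "nat \<Rightarrow> nat \<Rightarrow> nat \<Rightarrow> nat \<Rightarrow> nat \<Rightarrow> bool" where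
  "gin_cond p d a b c \<longleftrightarrow> p \<le> a \<or> p + 2 * d - 2 \<le> 3 * a + 2 * b \<or> p + 2 * d - 2 \<le> 2 * a + 2 * b + c"

text \<open>
  A monomial with \<open>a < p\<close> and \<open>3a + 2b \<ge> p + 2d - 2\<close> is divisible by a generator free of \<open>x\<^sub>3\<close>. If instead only
  the third condition holds, then \<open>x\<^sub>1\<^sup>a x\<^sub>2\<^sup>b\<close> times the power of \<open>x\<^sub>3\<close> with exponent
  \<open>p + 2d - 2 - 2(a + b)\<close> is itself a generator; the size of \<open>a + b\<close> decides in which of the last three families.
\<close>

lemma generators_even:
  assumes p: "p = 2 * q" "1 \<le> q" "p < d"
  shows "ideal_gen {mon a b c | a b c. gin_cond p d a b c} = ideal_gen
         ({mon p 0 0}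
          \<union> (\<Union>j\<in>{1..(p - 2) div 2}.
               {mon (p + 1 - 2*j) (d + 3*j - p - 2) 0, mon (p - 2*j) (d + 3*j - p - 1) 0})
          \<union> {mon 1 ((p + 2*d - 4) div 2) 0, mon 0 ((p + 2*d - 2) div 2) 0}
          \<union> (\<Union>j\<in>{1..(p - 2) div 2}. mon_list (2*j - 1) ((p + 2*d) div 2 - 3*j) (2*j))
          \<union> (\<Union>j\<in>{1..d - p}. mon 0 (d + 1 - p - j) (p - 2 + 2*j) *o mons12 (p - 1))
          \<union> (\<Union>j\<in>{1..p}. mon 0 0 (2*d - p - 2 + 2*j) *o mons12 (p - j)) :: 'a::comm_ring_1 poly3 set)"
    (is "_ = ideal_gen (?A \<union> ?B \<union> ?C \<union> ?D \<union> ?E \<union> ?F)")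
proof (rule monomial_ideal_eqI)
  have divs: "(p - 2) div 2 = q - 1" "(p + 2*d - 4) div 2 = q + d - 2"
      "(p + 2*d - 2) div 2 = q + d - 1" "(p + 2*d) div 2 = q + d"
    using p by auto
  fix g :: "'a poly3" assume "g \<in> ?A \<union> ?B \<union> ?C \<union> ?D \<union> ?E \<union> ?F"
  then consider "g \<in> ?A" | "g \<in> ?B" | "g \<in> ?C" | "g \<in> ?D" | "g \<in> ?E" | "g \<in> ?F" by blast
  then show "\<exists>a b c. g = mon a b c \<and> gin_cond p d a b c"
  proof cases
    case 1
    then have "g = mon p 0 0 \<and> gin_cond p d p 0 0" by (simp add: gin_cond_def)
    then show ?thesis by blast
  next
    case 2
    then obtain j where j: "1 \<le> j" "j \<le> q - 1"
      "g = mon (p + 1 - 2*j) (d + 3*j - p - 2) 0 \<or> g = mon (p - 2*j) (d + 3*j - p - 1) 0"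
      unfolding divs by auto
    moreover have "gin_cond p d (p + 1 - 2*j) (d + 3*j - p - 2) 0" "gin_cond p d (p - 2*j) (d + 3*j - p - 1) 0"
      using j(1,2) p unfolding gin_cond_def by auto
    ultimately show ?thesis by blast
  next
    case 3
    then have "g = mon 1 (q + d - 2) 0 \<or> g = mon 0 (q + d - 1) 0" unfolding divs by simp
    moreover have "gin_cond p d 1 (q + d - 2) 0" "gin_cond p d 0 (q + d - 1) 0"
      using p unfolding gin_cond_def by auto
    ultimately show ?thesis by blast
  next
    case 4
    then obtain j i where ji: "1 \<le> j" "j \<le> q - 1" "i \<le> 2*j - 1"
      "g = mon (2*j - 1 - i) (q + d - 3*j + i) (2*j)"
      unfolding divs mon_list_def by auto
    moreover have "gin_cond p d (2*j - 1 - i) (q + d - 3*j + i) (2*j)"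
      using ji(1-3) p unfolding gin_cond_def by auto
    ultimately show ?thesis by blast
  next
    case 5
    then obtain j a b where h: "1 \<le> j" "j \<le> d - p" "a + b = p - 1"
      "g = mon a (d + 1 - p - j + b) (p - 2 + 2*j)"
      unfolding translate_mons12 by auto
    moreover have "gin_cond p d a (d + 1 - p - j + b) (p - 2 + 2*j)"
      using h(1-3) p unfolding gin_cond_def by auto
    ultimately show ?thesis by blast
  next
    case 6
    then obtain j a b where h: "1 \<le> j" "j \<le> p" "a + b = p - j"
      "g = mon a (0 + b) (2*d - p - 2 + 2*j)"
      unfolding translate_mons12 by auto
    moreover have "gin_cond p d a (0 + b) (2*d - p - 2 + 2*j)"
      using h(1-3) p unfolding gin_cond_def by auto
    ultimately show ?thesis by blast
  qed
next
  have divs: "(p - 2) div 2 = q - 1" "(p + 2*d - 4) div 2 = q + d - 2"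
      "(p + 2*d - 2) div 2 = q + d - 1" "(p + 2*d) div 2 = q + d"
    using p by auto
  fix a b c assume P: "gin_cond p d a b c"
  have N: "p + 2 * d - 2 = 2 * (q + d - 1)" using p by simp
  consider "p \<le> a" | "a < p" "2 * (q + d - 1) \<le> 3 * a + 2 * b"
    | "a < p" "3 * a + 2 * b < 2 * (q + d - 1)" "2 * (q + d - 1) \<le> 2 * a + 2 * b + c"
    using P unfolding gin_cond_def N by linarith
  then have "\<exists>a' b' c'. mon a' b' c' \<in> ?A \<union> ?B \<union> ?C \<union> ?D \<union> ?E \<union> ?F \<and> a' \<le> a \<and> b' \<le> b \<and> c' \<le> c"
  proof cases
    case 1
    moreover have "mon p 0 0 \<in> ?A" by simp
    ultimately show ?thesis by blast
  next
    case 2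
    have "a = 0 \<or> a = 1 \<or> (2 \<le> a \<and> even a) \<or> (3 \<le> a \<and> odd a)" by presburger
    then consider "a = 0" | "a = 1" | "2 \<le> a" "even a" | "3 \<le> a" "odd a" by blast
    then show ?thesis
    proof cases
      case 1
      then have "q + d - 1 \<le> b" using 2 by linarith
      moreover have "mon 0 (q + d - 1) 0 \<in> ?C" unfolding divs by simp
      ultimately show ?thesis by blast
    next
      case a: 2
      then have "1 \<le> a" "q + d - 2 \<le> b" using 2 by linarith+
      moreover have "mon 1 (q + d - 2) 0 \<in> ?C" unfolding divs by simp
      ultimately show ?thesis by blast
    next
      case 3
      then obtain r where r: "a = 2 * r" by blast
      define j where "j = q - r"
      have "mon (p - 2*j) (d + 3*j - p - 1) 0 \<in> ?B" unfolding divs using 2 3 r p by (intro UN_I[of j]) (auto simp: j_def)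
      moreover have "p - 2*j \<le> a" "d + 3*j - p - 1 \<le> b" using 2 3 r p by (auto simp: j_def)
      ultimately show ?thesis by blast
    next
      case 4
      then obtain r where r: "a = 2 * r + 1" by (meson oddE)
      define j where "j = q - r"
      have "mon (p + 1 - 2*j) (d + 3*j - p - 2) 0 \<in> ?B" unfolding divs using 2 4 r p by (intro UN_I[of j]) (auto simp: j_def)
      moreover have "p + 1 - 2*j \<le> a" "d + 3*j - p - 2 \<le> b" using 2 4 r p by (auto simp: j_def)
      ultimately show ?thesis by blast
    qed
  next
    case 3
    define j where "j = q + d - 1 - (a + b)"
    have j: "1 \<le> j" "a + b = q + d - 1 - j" "j \<le> q + d - 1" "2 * j \<le> c" "a < 2 * j" using 3 by (auto simp: j_def)
    have "mon a b (2 * j) \<in> ?D \<union> ?E \<union> ?F"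
    proof -
      consider "j \<le> q - 1" | "q \<le> j" "j + q < d" | "d \<le> j + q" by linarith
      then show ?thesis
      proof cases
        case 1
        have eq: "a = 2*j - 1 - (2*j - 1 - a)" "b = q + d - 3*j + (2*j - 1 - a)" using 1 j p by auto
        have "mon a b (2*j) \<in> mon_list (2*j - 1) (q + d - 3*j) (2*j)"
          unfolding mon_list_def using eq by (metis (mono_tags, lifting) diff_le_self mem_Collect_eq)
        then show ?thesis unfolding divs using 1 j(1) by auto
      next
        case 2
        have "mon a b (2*j) = mon a (d + 1 - p - (j - q + 1) + (p - 1 - a)) (p - 2 + 2*(j - q + 1))"
        proof -
          obtain k where k: "j = q + k" using 2 le_Suc_ex by blast
          obtain r where r: "d = j + q + 1 + r" using 2 less_imp_Suc_add[of "j + q" d] by auto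
          obtain a' where a': "p = a + 1 + a'" using \<open>a < p\<close> less_imp_Suc_add[of a p] by auto
          have "d + 1 - p - (j - q + 1) = r + 1" "p - 2 + 2*(j - q + 1) = 2*j" using k r p by auto
          moreover have "p - 1 - a = a'" using a' by simp
          moreover have "a + b = q + q + r" using j(2) r p(2) by simp
          then have "b = r + 1 + a'" using a' p(1) by linarith
          ultimately show ?thesis by simp
        qed
        moreover have "a + (p - 1 - a) = p - 1" using \<open>a < p\<close> by simp
        ultimately have "mon a b (2*j) \<in> mon 0 (d + 1 - p - (j - q + 1)) (p - 2 + 2*(j - q + 1)) *o mons12 (p - 1)"
          unfolding translate_mons12 by blast
        moreover have "j - q + 1 \<in> {1..d - p}" using 2 p by auto
        ultimately show ?thesis by blast
      next
        case 3
        have "mon a b (2*j) = mon a (0 + b) (2*d - p - 2 + 2*(j + q + 1 - d))"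
          using 3 j p by (intro arg_cong2[of _ _ _ _ "mon a"]) arith+
        moreover have "a + b = p - (j + q + 1 - d)" using 3 j p by auto
        ultimately have "mon a b (2*j) \<in> mon 0 0 (2*d - p - 2 + 2*(j + q + 1 - d)) *o mons12 (p - (j + q + 1 - d))"
          unfolding translate_mons12 by blast
        moreover have "j + q + 1 - d \<in> {1..p}" using 3 j p by auto
        ultimately show ?thesis by blast
      qed
    qed
    then show ?thesis using j(4) by blast
  qed
  then show "\<exists>a' b' c'. mon a' b' c' \<in> ?A \<union> ?B \<union> ?C \<union> ?D \<union> ?E \<union> ?F \<and> a' \<le> a \<and> b' \<le> b \<and> c' \<le> c" .
qed

text \<open>
  The argument is the same as for even \<open>p\<close>. The exponent of \<open>x\<^sub>3\<close> is now odd, and the value \<open>1\<close> accounts for the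
  generator divisible by \<open>x\<^sub>3\<close> exactly once.
\<close>

lemma generators_odd:
  assumes p: "p = 2 * q + 1" "1 \<le> q" "p < d"
  shows "ideal_gen {mon a b c | a b c. gin_cond p d a b c} = ideal_gen
         ({mon p 0 0}
          \<union> (\<Union>j\<in>{1..(p - 1) div 2}.
               {mon (p + 1 - 2*j) (d + 3*j - p - 2) 0, mon (p - 2*j) (d + 3*j - p - 1) 0})
          \<union> {mon 0 ((p + 2*d - 1) div 2) 0, mon 0 ((p + 2*d - 3) div 2) 1}
          \<union> (\<Union>j\<in>{1..(p - 3) div 2}. mon_list (2*j) ((p + 2*d - 3) div 2 - 3*j) (2*j + 1))
          \<union> (\<Union>j\<in>{1..d - p}. mon 0 (d + 1 - p - j) (p - 2 + 2*j) *o mons12 (p - 1))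
          \<union> (\<Union>j\<in>{1..p}. mon 0 0 (2*d - p - 2 + 2*j) *o mons12 (p - j)) :: 'a::comm_ring_1 poly3 set)"
    (is "_ = ideal_gen (?A \<union> ?B \<union> ?C \<union> ?D \<union> ?E \<union> ?F)")
proof (rule monomial_ideal_eqI)
  have divs: "(p - 1) div 2 = q" "(p + 2*d - 1) div 2 = q + d"
      "(p + 2*d - 3) div 2 = q + d - 1" "(p - 3) div 2 = q - 1"
    using p by auto
  fix g :: "'a poly3" assume "g \<in> ?A \<union> ?B \<union> ?C \<union> ?D \<union> ?E \<union> ?F"
  then consider "g \<in> ?A" | "g \<in> ?B" | "g \<in> ?C" | "g \<in> ?D" | "g \<in> ?E" | "g \<in> ?F" by blast
  then show "\<exists>a b c. g = mon a b c \<and> gin_cond p d a b c"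
  proof cases
    case 1
    then have "g = mon p 0 0 \<and> gin_cond p d p 0 0" by (simp add: gin_cond_def)
    then show ?thesis by blast
  next
    case 2
    then obtain j where j: "1 \<le> j" "j \<le> q"
      "g = mon (p + 1 - 2*j) (d + 3*j - p - 2) 0 \<or> g = mon (p - 2*j) (d + 3*j - p - 1) 0"
      unfolding divs by auto
    moreover have "gin_cond p d (p + 1 - 2*j) (d + 3*j - p - 2) 0" "gin_cond p d (p - 2*j) (d + 3*j - p - 1) 0"
      using j(1,2) p unfolding gin_cond_def by auto
    ultimately show ?thesis by blast
  next
    case 3
    then have "g = mon 0 (q + d) 0 \<or> g = mon 0 (q + d - 1) 1" unfolding divs by simp
    moreover have "gin_cond p d 0 (q + d) 0" "gin_cond p d 0 (q + d - 1) 1"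
      using p unfolding gin_cond_def by auto
    ultimately show ?thesis by blast
  next
    case 4
    then obtain j i where ji: "1 \<le> j" "j \<le> q - 1" "i \<le> 2*j"
      "g = mon (2*j - i) (q + d - 1 - 3*j + i) (2*j + 1)"
      unfolding divs mon_list_def by auto
    moreover have "gin_cond p d (2*j - i) (q + d - 1 - 3*j + i) (2*j + 1)"
      using ji(1-3) p unfolding gin_cond_def by auto
    ultimately show ?thesis by blast
  next
    case 5
    then obtain j a b where h: "1 \<le> j" "j \<le> d - p" "a + b = p - 1"
      "g = mon a (d + 1 - p - j + b) (p - 2 + 2*j)"
      unfolding translate_mons12 by auto
    moreover have "gin_cond p d a (d + 1 - p - j + b) (p - 2 + 2*j)"
      using h(1-3) p unfolding gin_cond_def by auto
    ultimately show ?thesis by blast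
  next
    case 6
    then obtain j a b where h: "1 \<le> j" "j \<le> p" "a + b = p - j"
      "g = mon a (0 + b) (2*d - p - 2 + 2*j)"
      unfolding translate_mons12 by auto
    moreover have "gin_cond p d a (0 + b) (2*d - p - 2 + 2*j)"
      using h(1-3) p unfolding gin_cond_def by auto
    ultimately show ?thesis by blast
  qed
next
  have divs: "(p - 1) div 2 = q" "(p + 2*d - 1) div 2 = q + d"
      "(p + 2*d - 3) div 2 = q + d - 1" "(p - 3) div 2 = q - 1"
    using p by auto
  fix a b c assume P: "gin_cond p d a b c"
  have N: "p + 2 * d - 2 = 2 * (q + d - 1) + 1" using p by simp
  consider "p \<le> a" | "a < p" "2 * (q + d - 1) + 1 \<le> 3 * a + 2 * b"
    | "a < p" "3 * a + 2 * b < 2 * (q + d - 1) + 1" "2 * (q + d - 1) + 1 \<le> 2 * a + 2 * b + c"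
    using P unfolding gin_cond_def N by linarith
  then have "\<exists>a' b' c'. mon a' b' c' \<in> ?A \<union> ?B \<union> ?C \<union> ?D \<union> ?E \<union> ?F \<and> a' \<le> a \<and> b' \<le> b \<and> c' \<le> c"
  proof cases
    case 1
    moreover have "mon p 0 0 \<in> ?A" by simp
    ultimately show ?thesis by blast
  next
    case 2
    consider "a = 0" | "0 < a" "even a" | "odd a" by blast
    then show ?thesis
    proof cases
      case 1
      then have "q + d \<le> b" using 2 by linarith
      moreover have "mon 0 (q + d) 0 \<in> ?C" unfolding divs by simp
      ultimately show ?thesis by blast
    next
      case a: 2
      then obtain r where r: "a = 2 * r" by blast
      define j where "j = q + 1 - r"
      have "mon (p + 1 - 2*j) (d + 3*j - p - 2) 0 \<in> ?B" unfolding divs using 2 a r p by (intro UN_I[of j]) (auto simp: j_def)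
      moreover have "p + 1 - 2*j \<le> a" "d + 3*j - p - 2 \<le> b" using 2 a r p by (auto simp: j_def)
      ultimately show ?thesis by blast
    next
      case 3
      then obtain r where r: "a = 2 * r + 1" by (meson oddE)
      define j where "j = q - r"
      have "mon (p - 2*j) (d + 3*j - p - 1) 0 \<in> ?B" unfolding divs using 2 r p by (intro UN_I[of j]) (auto simp: j_def)
      moreover have "p - 2*j \<le> a" "d + 3*j - p - 1 \<le> b" using 2 r p by (auto simp: j_def)
      ultimately show ?thesis by blast
    qed
  next
    case 3
    define j where "j = q + d - 1 - (a + b)"
    have j: "a + b = q + d - 1 - j" "j \<le> q + d - 1" "2 * j + 1 \<le> c" "a \<le> 2 * j" using 3 by (auto simp: j_def)
    have "mon a b (2 * j + 1) \<in> ?C \<union> ?D \<union> ?E \<union> ?F"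
    proof -
      consider "j = 0" | "1 \<le> j" "j \<le> q - 1" | "1 \<le> j" "q \<le> j" "j + q + 1 < d" | "d \<le> j + q + 1" by linarith
      then show ?thesis
      proof cases
        case 1
        then have "a = 0" "b = q + d - 1" using j by auto
        then show ?thesis using 1 by (simp add: divs)
      next
        case 2
        have eq: "a = 2*j - (2*j - a)" "b = q + d - 1 - 3*j + (2*j - a)" using 2 j p by auto
        have "mon a b (2*j + 1) \<in> mon_list (2*j) (q + d - 1 - 3*j) (2*j + 1)"
          unfolding mon_list_def using eq by (metis (mono_tags, lifting) diff_le_self mem_Collect_eq)
        then show ?thesis unfolding divs using 2 by auto
      next
        case 3
        have "mon a b (2*j + 1) = mon a (d + 1 - p - (j - q + 1) + (p - 1 - a)) (p - 2 + 2*(j - q + 1))"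
        proof -
          obtain k where k: "j = q + k" using 3 le_Suc_ex by blast
          obtain r where r: "d = j + q + 2 + r" using 3 less_imp_Suc_add[of "j + q + 1" d] by auto
          obtain a' where a': "p = a + 1 + a'" using \<open>a < p\<close> less_imp_Suc_add[of a p] by auto
          have "d + 1 - p - (j - q + 1) = r + 1" "p - 2 + 2*(j - q + 1) = 2*j + 1" using k r p by auto
          moreover have "p - 1 - a = a'" using a' by simp
          moreover have "a + b = q + q + r + 1" using j(1) r p(2) by simp
          then have "b = r + 1 + a'" using a' p(1) by linarith
          ultimately show ?thesis by simp
        qed
        moreover have "a + (p - 1 - a) = p - 1" using \<open>a < p\<close> by simp
        ultimately have "mon a b (2*j + 1) \<in> mon 0 (d + 1 - p - (j - q + 1)) (p - 2 + 2*(j - q + 1)) *o mons12 (p - 1)"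
          unfolding translate_mons12 by blast
        moreover have "j - q + 1 \<in> {1..d - p}" using 3 p by auto
        ultimately show ?thesis by blast
      next
        case 4
        have "mon a b (2*j + 1) = mon a (0 + b) (2*d - p - 2 + 2*(j + q + 2 - d))"
          using 4 j p by (intro arg_cong2[of _ _ _ _ "mon a"]) arith+
        moreover have "a + b = p - (j + q + 2 - d)" using 4 j p by auto
        ultimately have "mon a b (2*j + 1) \<in> mon 0 0 (2*d - p - 2 + 2*(j + q + 2 - d)) *o mons12 (p - (j + q + 2 - d))"
          unfolding translate_mons12 by blast
        moreover have "j + q + 2 - d \<in> {1..p}" using 4 j p by auto
        ultimately show ?thesis by blast
      qed
    qed
    then show ?thesis using j(3) by blast
  qed
  then show "\<exists>a' b' c'. mon a' b' c' \<in> ?A \<union> ?B \<union> ?C \<union> ?D \<union> ?E \<union> ?F \<and> a' \<le> a \<and> b' \<le> b \<and> c' \<le> c" .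
qed

section \<open>Complete intersections with the strong Lefschetz property\<close>

text \<open>
  Each element of a regular sequence subtracts from the Hilbert function its shift by the degree of that element.
\<close>

lemma graded_hilb_complete_intersection:
  fixes f1 f2 f3 :: "'a::field poly3"
  assumes "homogeneous p f1" "homogeneous d f2" "homogeneous d f3"
    and "regular_sequence [f1, f2, f3]"
  shows "graded_ideal (ideal_gen {f1, f2, f3})"
    and "2 * hilb (ideal_gen {f1, f2, f3}) t = hilb_S2 t - hilb_S2 (t - int p) - 2 * hilb_S2 (t - int d)
      + 2 * hilb_S2 (t - int p - int d) + hilb_S2 (t - 2 * int d) - hilb_S2 (t - int p - 2 * int d)"
proof -
  define I1 where "I1 = ideal_gen {f1}"
  define I2 where "I2 = ideal_gen {f1, f2}"
  have 0: "ideal_gen {} = {0 :: 'a poly3}" by (simp add: ideal_gen_def)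
  have I1: "I1 = add_gen {0} f1" unfolding I1_def ideal_gen_insert 0 ..
  have I2: "I2 = add_gen I1 f2" unfolding I1_def I2_def ideal_gen_insert[symmetric] by (simp add: insert_commute)
  have I3: "ideal_gen {f1, f2, f3} = add_gen I2 f3"
    unfolding I2_def ideal_gen_insert[symmetric] by (simp add: insert_commute)
  have reg: "g \<in> ideal_gen (set (take i [f1, f2, f3]))"
    if "i < 3" "[f1, f2, f3] ! i * g \<in> ideal_gen (set (take i [f1, f2, f3]))" for i g
    using assms(4) that by (simp add: regular_sequence_def)
  have reg1: "g \<in> {0}" if "f1 * g \<in> {0}" for g using reg[of 0 g] that by (simp add: 0)
  have reg2: "g \<in> I1" if "f2 * g \<in> I1" for g using reg[of 1 g] that by (simp add: I1_def)
  have reg3: "g \<in> I2" if "f3 * g \<in> I2" for g using reg[of 2 g] that by (simp add: I2_def numeral_2_eq_2)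
  have g1: "graded_ideal I1" unfolding I1 by (rule graded_ideal_add_gen[OF graded_ideal_0 assms(1)])
  have g2: "graded_ideal I2" unfolding I2 by (rule graded_ideal_add_gen[OF g1 assms(2)])
  show "graded_ideal (ideal_gen {f1, f2, f3})" unfolding I3 by (rule graded_ideal_add_gen[OF g2 assms(3)])
  have h0: "2 * hilb ({0} :: 'a poly3 set) t = hilb_S2 t" for t
    by (simp add: hilb_zero_ideal hilb_S2_def)
  have h1: "2 * hilb I1 t = hilb_S2 t - hilb_S2 (t - int p)" for t
    using hilb_add_gen[OF graded_ideal_0 assms(1) reg1, of t] h0[of t] h0[of "t - int p"] unfolding I1 by simp
  have comm: "hilb_S2 (t - int d - int p) = hilb_S2 (t - int p - int d)" for t
    by (rule arg_cong[of _ _ hilb_S2]) simp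
  have h2: "2 * hilb I2 t = hilb_S2 t - hilb_S2 (t - int p) - hilb_S2 (t - int d) + hilb_S2 (t - int p - int d)" for t
    using hilb_add_gen[OF g1 assms(2) reg2, of t] h1[of t] h1[of "t - int d"]
      comm[of t]
    unfolding I2 by simp
  have "t - int d - int d = t - 2 * int d" "t - int p - int d - int d = t - int p - 2 * int d"
    "t - int d - int p - int d = t - int p - 2 * int d" by simp_all
  then show "2 * hilb (ideal_gen {f1, f2, f3}) t = hilb_S2 t - hilb_S2 (t - int p) - 2 * hilb_S2 (t - int d)
      + 2 * hilb_S2 (t - int p - int d) + hilb_S2 (t - 2 * int d) - hilb_S2 (t - int p - 2 * int d)"
    using hilb_add_gen[OF g2 assms(3) reg3, of t] h2[of t] h2[of "t - int d"]
      comm[of t]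
    unfolding I3 by simp
qed

theorem proposition2p3p13:
  fixes f1 f2 f3 :: "'a::field_char_0 poly3"
    and d1 d2 d3 d :: nat
    and I J :: "'a poly3 set"
  assumes "2 \<le> d1" and "d1 < d2" and "d2 = d3" and "d3 = d"
    and "homogeneous d1 f1" and "homogeneous d2 f2" and "homogeneous d3 f3"
    and "regular_sequence [f1, f2, f3]"
    and "I = ideal_gen {f1, f2, f3}"
    and "J = Gin I"
    and "strong_lefschetz I"
  shows
    "(even d1 \<longrightarrow>
       J = ideal_gen
         ({mon d1 0 0}
          \<union> (\<Union>j\<in>{1..(d1 - 2) div 2}.
               {mon (d1 + 1 - 2*j) (d + 3*j - d1 - 2) 0, mon (d1 - 2*j) (d + 3*j - d1 - 1) 0})
          \<union> {mon 1 ((d1 + 2*d - 4) div 2) 0, mon 0 ((d1 + 2*d - 2) div 2) 0}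
          \<union> (\<Union>j\<in>{1..(d1 - 2) div 2}. mon_list (2*j - 1) ((d1 + 2*d) div 2 - 3*j) (2*j))
          \<union> (\<Union>j\<in>{1..d - d1}. mon 0 (d + 1 - d1 - j) (d1 - 2 + 2*j) *o mons12 (d1 - 1))
          \<union> (\<Union>j\<in>{1..d1}. mon 0 0 (2*d - d1 - 2 + 2*j) *o mons12 (d1 - j))))
     \<and>
     (odd d1 \<longrightarrow>
       J = ideal_gen
         ({mon d1 0 0}
          \<union> (\<Union>j\<in>{1..(d1 - 1) div 2}.
               {mon (d1 + 1 - 2*j) (d + 3*j - d1 - 2) 0, mon (d1 - 2*j) (d + 3*j - d1 - 1) 0})
          \<union> {mon 0 ((d1 + 2*d - 1) div 2) 0, mon 0 ((d1 + 2*d - 3) div 2) 1}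
          \<union> (\<Union>j\<in>{1..(d1 - 3) div 2}. mon_list (2*j) ((d1 + 2*d - 3) div 2 - 3*j) (2*j + 1))
          \<union> (\<Union>j\<in>{1..d - d1}. mon 0 (d + 1 - d1 - j) (d1 - 2 + 2*j) *o mons12 (d1 - 1))
          \<union> (\<Union>j\<in>{1..d1}. mon 0 0 (2*d - d1 - 2 + 2*j) *o mons12 (d1 - j))))"
proof -
  have d: "d1 < d" "homogeneous d f2" "homogeneous d f3" using assms(2,3,4,6,7) by simp_all
  obtain l where l: "homogeneous 1 l \<and> (\<forall>b\<ge>1. \<forall>t. inj_on (quot_mult I (l ^ b)) (quot_graded I t) \<or>
           quot_mult I (l ^ b) ` quot_graded I t = quot_graded I (t + b))"
    using assms(11) unfolding strong_lefschetz_def by (rule exE)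
  interpret ci_lefschetz I d1 d l
    using assms(1) d(1) l graded_hilb_complete_intersection[OF assms(5) d(2,3) assms(8)]
    by unfold_locales (simp_all add: assms(9))
  have "(\<lambda>k. single k (1::'a)) ` gin_exps = {mon a b c | a b c. gin_cond d1 d a b c}"
  proof (intro equalityI subsetI)
    fix g :: "'a poly3" assume "g \<in> (\<lambda>k. single k 1) ` gin_exps"
    then obtain k where k: "g = single k 1" "k \<in> gin_exps" by blast
    then have "g = mon (lookup k 1) (lookup k 2) (lookup k 3)" by (simp add: mon_eq_single expo_lookup)
    moreover have "gin_cond d1 d (lookup k 1) (lookup k 2) (lookup k 3)"
      using k(2) by (simp add: gin_exps_def gin_cond_def)
    ultimately show "g \<in> {mon a b c | a b c. gin_cond d1 d a b c}" by blast
  next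
    fix g :: "'a poly3" assume "g \<in> {mon a b c | a b c. gin_cond d1 d a b c}"
    then obtain a b c where g: "g = single (expo a b c) 1" "gin_cond d1 d a b c" by (auto simp: mon_eq_single)
    then have "expo a b c \<in> gin_exps" by (simp add: gin_exps_def gin_cond_def lookup_expo)
    then show "g \<in> (\<lambda>k. single k 1) ` gin_exps" using g(1) by blast
  qed
  then have J: "J = ideal_gen {mon a b c | a b c. gin_cond d1 d a b c}"
    using Gin_eq assms(10) by simp
  show ?thesis
    unfolding J
  proof (intro conjI impI, goal_cases)
    case 1
    then obtain q where q: "d1 = 2 * q" by blast
    then have "1 \<le> q" using assms(1) by simp
    then show ?case by (rule generators_even[OF q _ d(1)])
  next
    case 2
    then obtain q where q: "d1 = 2 * q + 1" by (meson oddE)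
    then have "1 \<le> q" using assms(1) by simp
    then show ?case by (rule generators_odd[OF q _ d(1)])
  qed
qed

end
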